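(* Let $n\ge 2$, let $W=\mathfrak{S}_n$ be the symmetric group with Coxeter generators $S=\{s_1,\dots,s_{n-1}\}$, $s_i=(i,i+1)$ (the Coxeter group of type $A_{n-1}$), and let $u,v\in W$ with $u\le v$ in Bruhat order. Let $$z_n=\min([u,v]\cap W_{S\setminus\{s_{n-1}\}}v),\qquad z_1=\min([u,v]\cap W_{S\setminus\{s_1\}}v),$$ $$z^n=\min([u,v]\cap vW_{S\setminus\{s_{n-1}\}}),\qquad z^1=\min([u,v]\cap vW_{S\setminus\{s_1\}})$$ be the standard hypercube decompositions of $[u,v]$, and let $DS(z,z')$ denote the multiset of $(z,z')$-double shortcuts for $[u,v]$. Then the following equalities of multisets hold: 1. $DS(z_n,z_1)=DS(z_1,z_n)$; 2. $DS(z^n,z^1)=DS(z^1,z^n)$; 3. $DS(z_n,z^n)=DS(z^n,z_n)$; 4. $DS(z^1,z_1)=DS(z_1,z^1)$.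
   Context: Permutations are composed from right to left, $(xy)(i)=x(y(i))$. $\le$ is the Bruhat order on $W=\mathfrak{S}_n$, and $[u,v]=\{x\in W: u\le x\le v\}$. For $J\subseteq S$, $W_J$ is the subgroup generated by $J$; $W_Jv=\{wv:w\in W_J\}$ and $vW_J=\{vw:w\in W_J\}$. $\min$ denotes the minimum in Bruhat order (the minima defining $z_n,z_1,z^n,z^1$ are known to exist; these four elements need not be distinct). $\mathcal{B}(W)$ is the Bruhat graph: the directed graph with vertex set $W$ and an edge $x\to y$ whenever $y=tx$ for some reflection (transposition) $t$ and $\ell(x)<\ell(y)$, where $\ell$ on elements of $W$ is Coxeter length. A path $\Gamma=(u=x_0\to x_1\to\cdots\to x_r=v)$ in $\mathcal{B}(W)$ has length $\ell(\Gamma)=r$ and support $\mathrm{supp}(\Gamma)=\{x_0,\dots,x_r\}$. For $u\le v$, $d(u,v)$ is the minimal length of a path from $u$ to $v$ in $\mathcal{B}(W)$. Hypercube decompositions. For a finite set $E$, the hypercube $H_E$ is the directed graph whose vertices are the subsets of $E$, with an edge $E_1\to E_2$ if and only if $E_2$ is obtained from $E_1$ by adding one element. Let $p\in W$ and let $E$ be a set of edges of $\mathcal{B}(W)$ all having target $p$. $E$ spans a hypercube if there exists a unique embedding of directed graphs $\theta_E:H_E\to\mathcal{B}(W)$ such that for every $\alpha\in E$ the edge $(E\setminus\{\alpha\}\to E)$ is sent to $\alpha$. $E$ spans a hypercube cluster if every subset $E'\subseteq E$ consisting of edges with pairwise (Bruhat-)incomparable sources spans a hypercube. An element $z\in[u,v]$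 is a hypercube decomposition of $[u,v]$ if: (i) whenever $x\in[u,v]$ and $a_1,a_2,y\in[z,v]$ with $a_1\ne a_2$ satisfy $x\to a_1\to y$ and $x\to a_2\to y$, then $x\in[z,v]$; and (ii) for all $p\in[z,v]$ the set $E^p=\{x\to p: x\in[u,v]\setminus[z,v]\}$ of edges of $\mathcal{B}(W)$ spans a hypercube cluster. A hypercube decomposition $z$ of $[u,v]$ is amazing if for all $x\in[u,v]$ the intersection $[z,v]\cap[x,v]$ has a minimum, denoted $z\vee x$, and $z\vee x$ is a hypercube decomposition of $[x,v]$. The elements $z_n,z_1,z^n,z^1$, called the standard hypercube decompositions of $[u,v]$, are known to be amazing hypercube decompositions. Shortcuts. For $z\in[u,v]$, the set of shortcuts for $[u,v]$ with respect to $z$ is $$W^z_{[u,v]}=\{p\in[z,v]: \mathrm{supp}(\Gamma)\cap[z,v]=\{p\}\text{ for all paths }\Gamma\text{ from }u\text{ to }p\text{ of length }d(u,p)\}.$$ Double shortcuts. For amazing hypercube decompositions $z,z'$ of $[u,v]$, $DS(z,z')$ is the multiset $$\{(d(u,p)+d(p,b),\,b): p\in W^z_{[u,v]}\text{ and }b\in W^{z'\vee p}_{[p,v]}\},$$ where each such pair $(p,b)$ contributes one element, counted with multiplicity. *)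

theory Defs
  imports "HOL-Algebra.Sym_Groups" "HOL-Algebra.Coset" "HOL-Algebra.Generated_Groups"
    "HOL-Library.Multiset"
begin

text \<open>
  The ambient group is \<open>sym_group n\<close>: functions on \<open>nat\<close> that permute \<open>{1..n}\<close> and fix every
  other number, multiplied by composition from right to left.
\<close>

definition simple_refl :: "nat \<Rightarrow> nat \<Rightarrow> nat" where
  "simple_refl i = Transposition.transpose i (i + 1)"

definition simple_refls :: "nat \<Rightarrow> (nat \<Rightarrow> nat) set" where
  "simple_refls n = simple_refl ` {1..n - 1}"

definition refls :: "nat \<Rightarrow> (nat \<Rightarrow> nat) set" where
  "refls n = {Transposition.transpose a b |a b. a \<in> {1..n} \<and> b \<in> {1..n} \<and> a \<noteq> b}"

definition coxeter_length :: "nat \<Rightarrow> (nat \<Rightarrow> nat) \<Rightarrow> nat" where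
  "coxeter_length n w =
     (LEAST k. \<exists>ss. length ss = k \<and> set ss \<subseteq> simple_refls n \<and> foldr (\<circ>) ss id = w)"

definition bruhat_edge :: "nat \<Rightarrow> (nat \<Rightarrow> nat) \<Rightarrow> (nat \<Rightarrow> nat) \<Rightarrow> bool" where
  "bruhat_edge n x y \<longleftrightarrow> x \<in> carrier (sym_group n) \<and> y \<in> carrier (sym_group n) \<and>
     (\<exists>t\<in>refls n. y = t \<circ> x) \<and> coxeter_length n x < coxeter_length n y"

definition bruhat_le :: "nat \<Rightarrow> (nat \<Rightarrow> nat) \<Rightarrow> (nat \<Rightarrow> nat) \<Rightarrow> bool" where
  "bruhat_le n x y \<longleftrightarrow> x \<in> carrier (sym_group n) \<and> y \<in> carrier (sym_group n) \<and>
     (bruhat_edge n)\<^sup>*\<^sup>* x y"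

definition bruhat_interval :: "nat \<Rightarrow> (nat \<Rightarrow> nat) \<Rightarrow> (nat \<Rightarrow> nat) \<Rightarrow> (nat \<Rightarrow> nat) set" where
  "bruhat_interval n u v = {x. bruhat_le n u x \<and> bruhat_le n x v}"

text \<open>Meaningful only when \<open>A\<close> has a minimum (which is then unique, by antisymmetry).\<close>

definition bruhat_min :: "nat \<Rightarrow> (nat \<Rightarrow> nat) set \<Rightarrow> (nat \<Rightarrow> nat)" where
  "bruhat_min n A = (THE m. m \<in> A \<and> (\<forall>x\<in>A. bruhat_le n m x))"

text \<open>A path is its list of vertices, so its support is \<open>set xs\<close> and its length \<open>length xs - 1\<close>.\<close>

definition bruhat_path ::
  "nat \<Rightarrow> (nat \<Rightarrow> nat) \<Rightarrow> (nat \<Rightarrow> nat) list \<Rightarrow> (nat \<Rightarrow> nat) \<Rightarrow> bool" where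
  "bruhat_path n u xs v \<longleftrightarrow> xs \<noteq> [] \<and> set xs \<subseteq> carrier (sym_group n) \<and>
     hd xs = u \<and> last xs = v \<and> successively (bruhat_edge n) xs"

definition bruhat_dist :: "nat \<Rightarrow> (nat \<Rightarrow> nat) \<Rightarrow> (nat \<Rightarrow> nat) \<Rightarrow> nat" where
  "bruhat_dist n u v = (LEAST r. \<exists>xs. bruhat_path n u xs v \<and> length xs - 1 = r)"

definition parabolic :: "nat \<Rightarrow> (nat \<Rightarrow> nat) set \<Rightarrow> (nat \<Rightarrow> nat) set" where
  "parabolic n J = generate (sym_group n) J"

text \<open>
  The minima of \<open>[u,v] \<inter> W\<^sub>J v\<close> and \<open>[u,v] \<inter> v W\<^sub>J\<close> for \<open>J = S - {s\<^sub>i}\<close>. The standard hypercube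
  decompositions are the instances \<open>i = n - 1\<close> and \<open>i = 1\<close>.
\<close>

definition lower_std :: "nat \<Rightarrow> nat \<Rightarrow> (nat \<Rightarrow> nat) \<Rightarrow> (nat \<Rightarrow> nat) \<Rightarrow> (nat \<Rightarrow> nat)" where
  "lower_std n i u v = bruhat_min n (bruhat_interval n u v \<inter>
     (parabolic n (simple_refls n - {simple_refl i}) #>\<^bsub>sym_group n\<^esub> v))"

definition upper_std :: "nat \<Rightarrow> nat \<Rightarrow> (nat \<Rightarrow> nat) \<Rightarrow> (nat \<Rightarrow> nat) \<Rightarrow> (nat \<Rightarrow> nat)" where
  "upper_std n i u v = bruhat_min n (bruhat_interval n u v \<inter>
     (v <#\<^bsub>sym_group n\<^esub> parabolic n (simple_refls n - {simple_refl i})))"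

text \<open>
  \<open>hd_join n v z x\<close> is \<open>z \<or> x\<close> relative to the top element \<open>v\<close>. It is the minimum it is meant
  to be whenever \<open>z\<close> is an amazing hypercube decomposition of some \<open>[u,v]\<close> containing \<open>x\<close>; this
  is the only role of that hypothesis in the definition of double shortcuts below, which is
  therefore stated for arbitrary \<open>z\<close> and \<open>z'\<close>.
\<close>

definition hd_join ::
  "nat \<Rightarrow> (nat \<Rightarrow> nat) \<Rightarrow> (nat \<Rightarrow> nat) \<Rightarrow> (nat \<Rightarrow> nat) \<Rightarrow> (nat \<Rightarrow> nat)" where
  "hd_join n v z x = bruhat_min n (bruhat_interval n z v \<inter> bruhat_interval n x v)"

definition shortcuts ::
  "nat \<Rightarrow> (nat \<Rightarrow> nat) \<Rightarrow> (nat \<Rightarrow> nat) \<Rightarrow> (nat \<Rightarrow> nat) \<Rightarrow> (nat \<Rightarrow> nat) set" where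
  "shortcuts n u v z = {p \<in> bruhat_interval n z v.
     \<forall>xs. bruhat_path n u xs p \<and> length xs - 1 = bruhat_dist n u p \<longrightarrow>
       set xs \<inter> bruhat_interval n z v = {p}}"

text \<open>The set of pairs \<open>(p, b)\<close> is finite, as \<open>mset_set\<close> requires: all its entries lie in the
  finite set \<open>carrier (sym_group n)\<close>.\<close>

definition double_shortcuts ::
  "nat \<Rightarrow> (nat \<Rightarrow> nat) \<Rightarrow> (nat \<Rightarrow> nat) \<Rightarrow> (nat \<Rightarrow> nat) \<Rightarrow> (nat \<Rightarrow> nat) \<Rightarrow>
     (nat \<times> (nat \<Rightarrow> nat)) multiset" where
  "double_shortcuts n u v z z' =
     image_mset (\<lambda>(p, b). (bruhat_dist n u p + bruhat_dist n p b, b))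
       (mset_set (SIGMA p : shortcuts n u v z. shortcuts n p v (hd_join n v z' p)))"

end

theory Submission
  imports Defs
begin

text \<open>
  Write \<open>last\<close> for the statistic \<open>x \<mapsto> x n\<close>. Going up in Bruhat order can only lower it, and the four
  standard hypercube decompositions are the minima of the level sets of \<open>last\<close> and of its
  transports along two symmetries of the Bruhat graph: inversion, and conjugation by the longest
  element. These turn \<open>x n\<close> into \<open>x\<inverse> n\<close> and, up to relabelling, into \<open>x 1\<close> and \<open>x\<inverse> 1\<close>. Hence only two
  equalities are at stake, for the pairs (\<open>x n\<close>, \<open>x 1\<close>) and (\<open>x n\<close>, \<open>x\<inverse> n\<close>); the others are their
  images under inversion and conjugation.

  In terms of a statistic \<open>f\<close>, a shortcut from \<open>u\<close> is an element \<open>p\<close> such that every geodesic from \<open>u\<close>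
  to \<open>p\<close> meets the \<open>f\<close>-level of \<open>p\<close> in \<open>p\<close> only (\<open>entry_points\<close>); the top element \<open>v\<close> serves merely to
  select among these. For \<open>last\<close> they can be listed: choose positions \<open>j\<^sub>r < \<dots> < j\<^sub>1 < n\<close> along which,
  together with \<open>n\<close>, the word \<open>u\<close> increases, and swap position \<open>n\<close> with \<open>j\<^sub>1\<close>, then with \<open>j\<^sub>2\<close>, and so on;
  the distance is \<open>r\<close>. That no others exist is the exchange argument behind reflection orders: any
  path can be rearranged, without changing its length, so that it begins with such a sequence of swaps
  and has its final last entry after them (\<open>path_through_rotation\<close>). That all of these qualify is a count of transpositions and of inversions
  (\<open>rotation_geodesic_entry\<close>). Consequently the multiset of pairs (distance, shortcut) is obtained
  from the single pair \<open>(0, u)\<close> by applying, for \<open>j = n - 1, \<dots>, 1\<close>, the operator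
  \<open>E\<^sub>j\<^sub>n\<close>: keep \<open>x\<close>, and if \<open>x j < x n\<close> also add \<open>x\<close> with positions \<open>j\<close> and \<open>n\<close> swapped, at one more
  unit of distance. Double shortcuts come from composing two such products of operators.

  For (\<open>x n\<close>, \<open>x 1\<close>) both orders of composition reduce to products over the same set of reflections,
  which touch position \<open>1\<close> or position \<open>n\<close>, arranged in two reflection orders. These products agree, since
  \<open>E\<^sub>1\<^sub>j E\<^sub>1\<^sub>n E\<^sub>j\<^sub>n = E\<^sub>j\<^sub>n E\<^sub>1\<^sub>n E\<^sub>1\<^sub>j\<close> and operators on disjoint positions commute.

  For (\<open>x n\<close>, \<open>x\<inverse> n\<close>) one product swaps positions and the other swaps values, and the factors do not
  commute. They do so after a deformation: compare positions (or values) by the order in which \<open>n\<close>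
  has been moved down to sit just below \<open>a\<close>. With the parameters staggered the two families commute
  square by square (\<open>left_branch_at_right_branch_at\<close>); this is the commutation of left and right
  multiplication in a Hecke algebra. On the levels that matter, the extreme orders with \<open>n\<close> on top and
  with \<open>n\<close> at the bottom select the same elements.
\<close>

section \<open>Inversions and the edges of the Bruhat graph\<close>

abbreviation trp :: "nat \<Rightarrow> nat \<Rightarrow> nat \<Rightarrow> nat" where
  "trp \<equiv> Transposition.transpose"

definition inversions :: "nat set \<Rightarrow> (nat \<Rightarrow> nat) \<Rightarrow> (nat \<times> nat) set" where
  "inversions S x = {(a, b). a \<in> S \<and> b \<in> S \<and> a < b \<and> x b < x a}"

lemma finite_inversions: "finite S \<Longrightarrow> finite (inversions S x)"
  by (rule finite_subset[of _ "S \<times> S"]) (auto simp: inversions_def)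

text \<open>
  An injection from the old inversions into the new ones misses the pair \<open>(a, b)\<close>. The set \<open>S\<close> is
  arbitrary because the inversions among a chosen subset of positions are counted again when paths
  between two given elements are analysed.
\<close>

lemma card_inversions_swap:
  assumes S: "finite S" "a \<in> S" "b \<in> S" and ab: "a < b" "x a < x b"
  shows "card (inversions S x) < card (inversions S (x \<circ> trp a b))"
proof -
  define t where "t = trp a b"
  have t: "t a = b" "t b = a" "\<And>c. c \<noteq> a \<Longrightarrow> c \<noteq> b \<Longrightarrow> t c = c" "\<And>c. t (t c) = c"
    by (auto simp: t_def)
  have tS: "t c \<in> S" if "c \<in> S" for c
    using that S t by (cases "c = a"; cases "c = b") auto
  \<comment> \<open>Transport an inversion along \<open>t\<close>, unless \<open>t\<close> reverses its two positions; then it stays an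
    inversion where it is.\<close>
  define f where "f = (\<lambda>(c, d). if t c < t d then (t c, t d) else (c, d))"
  have inj: "inj_on f (inversions S x)"
  proof (rule inj_onI, clarify)
    fix c d c' d'
    assume *: "(c, d) \<in> inversions S x" "(c', d') \<in> inversions S x" "f (c, d) = f (c', d')"
    then have "c < d" "c' < d'" by (auto simp: inversions_def)
    moreover have "t c = t c' \<longleftrightarrow> c = c'" "t d = t d' \<longleftrightarrow> d = d'" using t(4) by metis+
    ultimately show "c = c' \<and> d = d'"
      using *(3) t(4)[of c] t(4)[of d] t(4)[of c'] t(4)[of d']
      by (cases "t c < t d"; cases "t c' < t d'") (auto simp: f_def)
  qed
  have stays: "x (t d) < x (t c) \<and> (c, d) \<noteq> (a, b)"
    if cd: "c < d" "x d < x c" "\<not> t c < t d" for c d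
  proof -
    consider "c = a" "d < b" | "a < c" "d = b" | "c = a" "d = b"
      using cd(1,3) ab(1) t(1,2) t(3)[of c] t(3)[of d]
      by (cases "c = a"; cases "c = b"; cases "d = a"; cases "d = b") auto
    then show ?thesis
    proof cases
      case 1
      then have "t d = d" using cd t(3) by auto
      with 1 cd ab t show ?thesis by auto
    next
      case 2
      then have "t c = c" using cd t(3) by auto
      with 2 cd ab t show ?thesis by auto
    next
      case 3
      with 3 cd ab show ?thesis by auto
    qed
  qed
  have sub: "f ` inversions S x \<subseteq> inversions S (x \<circ> t) - {(a, b)}"
  proof clarify
    fix c d c' d' assume *: "(c, d) \<in> inversions S x" "(c', d') = f (c, d)"
    then have cd: "c < d" "x d < x c" "c \<in> S" "d \<in> S" by (auto simp: inversions_def)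
    show "(c', d') \<in> inversions S (x \<circ> t) - {(a, b)}"
    proof (cases "t c < t d")
      case True
      moreover have "\<not> (t c = a \<and> t d = b)"
      proof
        assume "t c = a \<and> t d = b"
        then have "c = b" "d = a" using t(1,2) t(4)[of c] t(4)[of d] by auto
        with cd(1) ab(1) show False by simp
      qed
      ultimately show ?thesis using *(2) cd tS t(4) by (auto simp: f_def inversions_def)
    next
      case False
      with *(2) cd stays[OF cd(1,2) False] show ?thesis by (auto simp: f_def inversions_def)
    qed
  qed
  have "(a, b) \<in> inversions S (x \<circ> t)"
    using S ab t by (auto simp: inversions_def)
  with sub have "f ` inversions S x \<subset> inversions S (x \<circ> t)" by blast
  then have "card (f ` inversions S x) < card (inversions S (x \<circ> t))"
    by (rule psubset_card_mono[OF finite_inversions[OF S(1)]])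
  then show ?thesis by (simp add: card_image[OF inj] t_def)
qed

lemma foldr_comp_Cons: "foldr (\<circ>) (s # ss) id = s \<circ> foldr (\<circ>) ss id"
  unfolding foldr.simps(2) by (rule o_apply)

lemma foldr_comp_append: "foldr (\<circ>) (ss @ ts) id = foldr (\<circ>) ss id \<circ> foldr (\<circ>) ts id"
  by (induction ss) (auto simp: comp_assoc)

lemma simple_refl_permutes: "k \<in> {1..<n} \<Longrightarrow> simple_refl k permutes {1..n}"
  unfolding simple_refl_def by (rule permutes_swap_id) auto

lemma foldr_simple_permutes:
  "set ss \<subseteq> simple_refls n \<Longrightarrow> foldr (\<circ>) ss id permutes {1..n}"
proof (induction ss)
  case Nil
  then show ?case using permutes_id[of "{1..n}"] by (simp add: id_def)
next
  case (Cons s ss)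
  then have "s permutes {1..n}"
    using simple_refl_permutes[of _ n] by (cases n) (auto simp: simple_refls_def)
  moreover have "foldr (\<circ>) ss id permutes {1..n}"
    using Cons by (metis insert_subset list.simps(15))
  ultimately show ?case by (simp only: foldr_comp_Cons permutes_compose)
qed

text \<open>
  Left multiplication by a simple reflection changes the order of just one pair of values.
\<close>

lemma card_inversions_foldr_le:
  assumes "set ss \<subseteq> simple_refls n"
  shows "card (inversions {1..n} (foldr (\<circ>) ss id)) \<le> length ss"
  using assms
proof (induction ss)
  case Nil
  have "inversions {1..n} id = {}" by (auto simp: inversions_def)
  then show ?case by (simp add: id_def)
next
  case (Cons s ss)
  let ?w = "foldr (\<circ>) ss id"
  obtain k where k: "s = trp k (k + 1)"
    using Cons.prems by (auto simp: simple_refls_def simple_refl_def)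
  have w: "?w permutes {1..n}" using Cons.prems by (intro foldr_simple_permutes) auto
  have "inversions {1..n} (s \<circ> ?w) \<subseteq>
      insert (inv' ?w k, inv' ?w (k + 1)) (inversions {1..n} ?w)"
  proof (clarify)
    fix a b assume ab: "(a, b) \<in> inversions {1..n} (s \<circ> ?w)" "(a, b) \<notin> inversions {1..n} ?w"
    then have "a < b" "?w a \<le> ?w b" by (auto simp: inversions_def)
    moreover have "?w a \<noteq> ?w b"
      using \<open>a < b\<close> permutes_inj[OF w] by (simp add: inj_eq)
    ultimately have "?w a < ?w b" by simp
    moreover have "s (?w b) < s (?w a)" using ab by (auto simp: inversions_def)
    ultimately have "?w a = k \<and> ?w b = k + 1"
      by (auto simp: k Transposition.transpose_def split: if_splits)
    then show "a = inv' ?w k \<and> b = inv' ?w (k + 1)"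
      by (metis w permutes_inverses(2))
  qed
  then have "card (inversions {1..n} (s \<circ> ?w)) \<le> card (insert (inv' ?w k, inv' ?w (k + 1)) (inversions {1..n} ?w))"
    by (intro card_mono) (auto simp: finite_inversions)
  also have "\<dots> \<le> Suc (card (inversions {1..n} ?w))" by (simp add: card_insert_if finite_inversions)
  also have "\<dots> \<le> Suc (length ss)" using Cons.IH Cons.prems by (metis Suc_le_mono insert_subset list.simps(15))
  finally show ?case by (simp only: foldr_comp_Cons length_Cons)
qed

lemma permutes_ascending_eq_id:
  fixes w :: "nat \<Rightarrow> nat"
  assumes w: "w permutes {a..b}" and asc: "\<And>k. k \<in> {a..<b} \<Longrightarrow> w k < w (Suc k)"
  shows "w = id"
proof -
  have in_ab: "w i \<in> {a..b}" if "i \<in> {a..b}" for i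
    using permutes_in_image[OF w] that by blast
  have low: "i \<in> {a..b} \<Longrightarrow> i \<le> w i" for i
  proof (induction i)
    case 0
    then show ?case by simp
  next
    case (Suc i)
    show ?case
    proof (cases "Suc i = a")
      case True
      then show ?thesis using in_ab[OF Suc.prems] by simp
    next
      case False
      then have "i \<in> {a..<b}" using Suc.prems by auto
      with Suc.IH asc[of i] show ?thesis by auto
    qed
  qed
  have "i + d = b \<Longrightarrow> a \<le> i \<Longrightarrow> w i \<le> i" for d i
  proof (induction d arbitrary: i)
    case 0
    then show ?case using in_ab[of i] by simp
  next
    case (Suc d)
    then have "w i < w (Suc i)" by (intro asc) auto
    with Suc.IH[of "Suc i"] Suc.prems show ?case by auto
  qed
  then have high: "i \<in> {a..b} \<Longrightarrow> w i \<le> i" for i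
    by (metis atLeastAtMost_iff le_add_diff_inverse)
  show ?thesis
  proof
    fix i show "w i = id i"
      using low[of i] high[of i] permutes_not_in[OF w, of i] by (cases "i \<in> {a..b}") auto
  qed
qed

text \<open>
  Sorting by adjacent swaps. The interval \<open>{a..b}\<close> is a parameter so that the statement yields both the
  Coxeter length and generators for the parabolic subgroups fixing \<open>1\<close> or \<open>n\<close>.
\<close>

lemma reduced_word_exists:
  assumes w: "w permutes {a..b}" and ab: "1 \<le> a" "b \<le> n"
  shows "\<exists>ss. set ss \<subseteq> simple_refl ` {a..<b} \<and> foldr (\<circ>) ss id = w \<and>
           length ss \<le> card (inversions {1..n} w)"
  using w
proof (induction "card (inversions {1..n} w)" arbitrary: w rule: less_induct)
  case less
  show ?case
  proof (cases "w = id")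
    case True
    then show ?thesis by (intro exI[of _ "[]"]) auto
  next
    case False
    with permutes_ascending_eq_id[OF less.prems] obtain k where
      k: "k \<in> {a..<b}" "\<not> w k < w (Suc k)" by blast
    moreover have "w k \<noteq> w (Suc k)" using permutes_inj[OF less.prems] by (simp add: inj_eq)
    ultimately have desc: "w (Suc k) < w k" by simp
    let ?s = "trp k (Suc k)"
    have "?s permutes {a..b}" using k by (intro permutes_swap_id) auto
    then have p: "w \<circ> ?s permutes {a..b}" by (rule permutes_compose) (rule less.prems)
    have "card (inversions {1..n} (w \<circ> ?s)) < card (inversions {1..n} (w \<circ> ?s \<circ> ?s))"
      using k ab desc by (intro card_inversions_swap) auto
    then have less': "card (inversions {1..n} (w \<circ> ?s)) < card (inversions {1..n} w)"
      by (simp add: comp_assoc)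
    from less.hyps[OF this p] obtain ss where
      ss: "set ss \<subseteq> simple_refl ` {a..<b}" "foldr (\<circ>) ss id = w \<circ> ?s"
        "length ss \<le> card (inversions {1..n} (w \<circ> ?s))" by blast
    have "foldr (\<circ>) (ss @ [?s]) id = w"
      by (simp only: foldr_comp_append ss(2)) (simp add: comp_assoc)
    then show ?thesis using ss less' k
      by (intro exI[of _ "ss @ [?s]"]) (auto simp: simple_refl_def)
  qed
qed

lemma coxeter_length_eq_card_inversions:
  assumes "w permutes {1..n}"
  shows "coxeter_length n w = card (inversions {1..n} w)"
  unfolding coxeter_length_def
proof (rule Least_equality)
  have eq: "simple_refl ` {1..<n} = simple_refls n"
    by (cases n) (auto simp: simple_refls_def)
  obtain ss where ss: "set ss \<subseteq> simple_refls n" "foldr (\<circ>) ss id = w"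
      "length ss \<le> card (inversions {1..n} w)"
    using reduced_word_exists[OF assms, of n] unfolding eq by auto
  with card_inversions_foldr_le[OF ss(1)]
  show "\<exists>ss. length ss = card (inversions {1..n} w) \<and> set ss \<subseteq> simple_refls n \<and> foldr (\<circ>) ss id = w"
    by (intro exI[of _ ss]) auto
next
  fix k assume "\<exists>ss. length ss = k \<and> set ss \<subseteq> simple_refls n \<and> foldr (\<circ>) ss id = w"
  then show "card (inversions {1..n} w) \<le> k" using card_inversions_foldr_le by blast
qed

lemma transpose_comp_permutes:
  assumes "x permutes S"
  shows "trp p q \<circ> x = x \<circ> trp (inv' x p) (inv' x q)"
  by (rule transpose_comp_eq) (rule permutes_bij[OF assms])

text \<open>
  All later arguments use this description, in which reflections act on positions and the comparison
  of lengths has become the comparison of two entries.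
\<close>

lemma bruhat_edge_iff:
  "bruhat_edge n x y \<longleftrightarrow> x permutes {1..n} \<and>
     (\<exists>a b. 1 \<le> a \<and> a < b \<and> b \<le> n \<and> x a < x b \<and> y = x \<circ> trp a b)"
proof
  assume e: "bruhat_edge n x y"
  then obtain p q where pq: "p \<in> {1..n}" "q \<in> {1..n}" "p \<noteq> q" "y = trp p q \<circ> x"
    and x: "x permutes {1..n}" and y: "y permutes {1..n}"
    and l: "coxeter_length n x < coxeter_length n y"
    by (auto simp: bruhat_edge_def refls_def sym_group_carrier)
  define a where "a = min (inv' x p) (inv' x q)"
  define b where "b = max (inv' x p) (inv' x q)"
  have "inv' x p \<noteq> inv' x q" using pq(3) permutes_inverses(1)[OF x] by metis
  moreover have "inv' x p \<in> {1..n}" "inv' x q \<in> {1..n}"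
    using pq permutes_in_image[OF permutes_inv[OF x]] by blast+
  ultimately have ab: "a \<in> {1..n}" "b \<in> {1..n}" "a < b" by (auto simp: a_def b_def min_def max_def)
  have y': "y = x \<circ> trp a b"
    unfolding pq(4) transpose_comp_permutes[OF x]
    by (auto simp: a_def b_def min_def max_def transpose_commute)
  have "x a < x b"
  proof (rule ccontr)
    assume "\<not> x a < x b"
    moreover have "x a \<noteq> x b" using ab permutes_inj[OF x] by (simp add: inj_eq)
    ultimately have "y a < y b" by (simp add: y')
    then have "card (inversions {1..n} y) < card (inversions {1..n} (y \<circ> trp a b))"
      by (intro card_inversions_swap) (use ab in auto)
    then have "card (inversions {1..n} y) < card (inversions {1..n} x)" by (simp add: y' comp_assoc)
    with l show False using coxeter_length_eq_card_inversions[OF x] coxeter_length_eq_card_inversions[OF y] by simp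
  qed
  with x ab y' show "x permutes {1..n} \<and>
     (\<exists>a b. 1 \<le> a \<and> a < b \<and> b \<le> n \<and> x a < x b \<and> y = x \<circ> trp a b)" by auto
next
  assume "x permutes {1..n} \<and> (\<exists>a b. 1 \<le> a \<and> a < b \<and> b \<le> n \<and> x a < x b \<and> y = x \<circ> trp a b)"
  then obtain a b where x: "x permutes {1..n}" and
    ab: "1 \<le> a" "a < b" "b \<le> n" "x a < x b" "y = x \<circ> trp a b" by blast
  have "trp a b permutes {1..n}" using ab by (intro permutes_swap_id) auto
  then have y: "y permutes {1..n}" unfolding ab(5) by (rule permutes_compose) (rule x)
  have "y = trp (x a) (x b) \<circ> x"
    by (simp add: transpose_comp_permutes[OF x] ab(5) permutes_inverses(2)[OF x])
  moreover have "trp (x a) (x b) \<in> refls n"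
    unfolding refls_def mem_Collect_eq
    using ab permutes_in_image[OF x, of a] permutes_in_image[OF x, of b]
    by (intro exI[of _ "x a"] exI[of _ "x b"]) auto
  moreover have "card (inversions {1..n} x) < card (inversions {1..n} y)"
    unfolding ab(5) using ab by (intro card_inversions_swap) auto
  ultimately show "bruhat_edge n x y"
    using x y by (auto simp: bruhat_edge_def sym_group_carrier coxeter_length_eq_card_inversions)
qed

section \<open>Bruhat order, paths and distance\<close>

lemma bruhat_edge_permutes:
  assumes "bruhat_edge n x y"
  shows "x permutes {1..n}" "y permutes {1..n}"
  using assms by (simp_all add: bruhat_edge_def sym_group_carrier)

lemma relpowp_bruhat_edge_permutes:
  "(bruhat_edge n ^^ r) x y \<Longrightarrow> x permutes {1..n} \<Longrightarrow> y permutes {1..n}"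
  by (induction r arbitrary: y) (auto dest: bruhat_edge_permutes)

lemma bruhat_le_iff_relpowp:
  "bruhat_le n x y \<longleftrightarrow> x permutes {1..n} \<and> (\<exists>r. (bruhat_edge n ^^ r) x y)"
  using relpowp_bruhat_edge_permutes
  by (auto simp: bruhat_le_def sym_group_carrier rtranclp_power simp del: One_nat_def)

lemma bruhat_le_permutes:
  assumes "bruhat_le n x y"
  shows "x permutes {1..n}" "y permutes {1..n}"
  using assms by (simp_all add: bruhat_le_def sym_group_carrier)

lemma bruhat_le_refl: "x permutes {1..n} \<Longrightarrow> bruhat_le n x x"
  by (simp add: bruhat_le_def sym_group_carrier)

lemma bruhat_le_trans: "bruhat_le n x y \<Longrightarrow> bruhat_le n y z \<Longrightarrow> bruhat_le n x z"
  by (auto simp: bruhat_le_def)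

lemma bruhat_edge_imp_le: "bruhat_edge n x y \<Longrightarrow> bruhat_le n x y"
  using bruhat_edge_permutes[of n x y] by (simp add: bruhat_le_def sym_group_carrier r_into_rtranclp)

lemma relpowp_bruhat_edge_length:
  "(bruhat_edge n ^^ r) x y \<Longrightarrow> coxeter_length n x + r \<le> coxeter_length n y"
proof (induction r arbitrary: y)
  case (Suc r)
  then obtain w where "(bruhat_edge n ^^ r) x w" "bruhat_edge n w y" by auto
  moreover from this(2) have "coxeter_length n w < coxeter_length n y" by (simp add: bruhat_edge_def)
  ultimately show ?case using Suc.IH[of w] by simp
qed auto

lemma bruhat_le_antisym:
  assumes "bruhat_le n x y" "bruhat_le n y x"
  shows "x = y"
proof -
  obtain r s where r: "(bruhat_edge n ^^ r) x y" and s: "(bruhat_edge n ^^ s) y x"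
    using assms by (auto simp: bruhat_le_iff_relpowp)
  from relpowp_bruhat_edge_length[OF r] relpowp_bruhat_edge_length[OF s] have "r = 0" by simp
  with r show ?thesis by simp
qed

lemma bruhat_min_eq:
  assumes "m \<in> A" "\<And>x. x \<in> A \<Longrightarrow> bruhat_le n m x"
  shows "bruhat_min n A = m"
  unfolding bruhat_min_def by (rule the_equality) (use assms bruhat_le_antisym in blast)+

text \<open>
  Together with the next lemmas, this trades lists of vertices for iterates of the edge relation:
  \<open>x\<close> lies on a path of length \<open>r\<close> from \<open>u\<close> to \<open>p\<close> iff \<open>r\<close> splits as \<open>i + j\<close> with \<open>i\<close> steps from \<open>u\<close> to \<open>x\<close> and \<open>j\<close>
  steps from \<open>x\<close> to \<open>p\<close>.
\<close>

lemma relpowp_imp_bruhat_path: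
  assumes "(bruhat_edge n ^^ r) u p" "u permutes {1..n}"
  shows "\<exists>xs. bruhat_path n u xs p \<and> length xs = Suc r"
  using assms
proof (induction r arbitrary: u)
  case 0
  then show ?case
    by (intro exI[of _ "[u]"]) (auto simp: bruhat_path_def sym_group_carrier)
next
  case (Suc r)
  then obtain w where w: "bruhat_edge n u w" "(bruhat_edge n ^^ r) w p"
    by (metis relpowp_Suc_D2)
  with Suc.IH[of w] bruhat_edge_permutes[OF w(1)] obtain xs where
    xs: "bruhat_path n w xs p" "length xs = Suc r" by blast
  with w(1) bruhat_edge_permutes[OF w(1)] show ?case
    by (intro exI[of _ "u # xs"])
       (auto simp: bruhat_path_def sym_group_carrier successively_Cons)
qed

lemma bruhat_path_vertex_split:
  assumes "bruhat_path n u xs p" "x \<in> set xs"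
  shows "\<exists>i j. (bruhat_edge n ^^ i) u x \<and> (bruhat_edge n ^^ j) x p \<and> i + j = length xs - 1"
  using assms
proof (induction xs arbitrary: u x)
  case Nil
  then show ?case by (simp add: bruhat_path_def)
next
  case (Cons y ys)
  show ?case
  proof (cases "ys = []")
    case True
    with Cons.prems have "x = u" "p = u" by (auto simp: bruhat_path_def)
    with True show ?thesis by (intro exI[of _ 0]) auto
  next
    case False
    with Cons.prems have y: "y = u" and e: "bruhat_edge n u (hd ys)"
      and path: "bruhat_path n (hd ys) ys p"
      by (auto simp: bruhat_path_def successively_Cons)
    have l: "length ys \<ge> 1" using False by (cases ys) auto
    show ?thesis
    proof (cases "x \<in> set ys")
      case True
      from Cons.IH[OF path True] obtain i j where
        ij: "(bruhat_edge n ^^ i) (hd ys) x" "(bruhat_edge n ^^ j) x p" "i + j = length ys - 1"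
        by blast
      have "(bruhat_edge n ^^ Suc i) u x" by (rule relpowp_Suc_I2[of "bruhat_edge n", OF e ij(1)])
      moreover have "Suc i + j = length (y # ys) - 1" using ij(3) l by simp
      ultimately show ?thesis using ij(2) by blast
    next
      case False
      with Cons.prems y have "x = u" by auto
      moreover have "hd ys \<in> set ys" using \<open>ys \<noteq> []\<close> by simp
      from Cons.IH[OF path this] obtain i j where
        "(bruhat_edge n ^^ i) (hd ys) (hd ys)" "(bruhat_edge n ^^ j) (hd ys) p"
        "i + j = length ys - 1" by blast
      then have "(bruhat_edge n ^^ (i + j)) (hd ys) p" by (blast intro: relpowp_trans)
      with e \<open>i + j = length ys - 1\<close> l have "(bruhat_edge n ^^ length ys) u p"
        by (metis Suc_diff_1 relpowp_Suc_I2 less_eq_Suc_le One_nat_def)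
      ultimately show ?thesis by (intro exI[of _ 0] exI[of _ "length ys"]) auto
    qed
  qed
qed

lemma bruhat_path_append:
  assumes "bruhat_path n u xs x" "bruhat_path n x ys p"
  shows "bruhat_path n u (xs @ tl ys) p"
proof -
  obtain zs where ys: "ys = x # zs" using assms(2) by (cases ys) (auto simp: bruhat_path_def)
  show ?thesis using assms unfolding ys
    by (auto simp: bruhat_path_def successively_append_iff successively_Cons last_append)
qed

lemma ex_bruhat_path_iff:
  assumes "u permutes {1..n}"
  shows "(\<exists>xs. bruhat_path n u xs p \<and> length xs - 1 = r) \<longleftrightarrow> (bruhat_edge n ^^ r) u p"
proof
  assume "\<exists>xs. bruhat_path n u xs p \<and> length xs - 1 = r"
  then obtain xs where xs: "bruhat_path n u xs p" "length xs - 1 = r" by blast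
  moreover have "u \<in> set xs" using xs by (auto simp: bruhat_path_def)
  ultimately obtain i j where
    "(bruhat_edge n ^^ i) u u" "(bruhat_edge n ^^ j) u p" "i + j = r"
    using bruhat_path_vertex_split by metis
  then show "(bruhat_edge n ^^ r) u p" by (metis relpowp_trans)
next
  assume "(bruhat_edge n ^^ r) u p"
  from relpowp_imp_bruhat_path[OF this assms]
  show "\<exists>xs. bruhat_path n u xs p \<and> length xs - 1 = r" by auto
qed

lemma bruhat_dist_eq_Least:
  "u permutes {1..n} \<Longrightarrow> bruhat_dist n u p = (LEAST r. (bruhat_edge n ^^ r) u p)"
  unfolding bruhat_dist_def by (simp only: ex_bruhat_path_iff)

lemma bruhat_dist_eqI:
  assumes "u permutes {1..n}" "(bruhat_edge n ^^ r) u p"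
    and "\<And>s. (bruhat_edge n ^^ s) u p \<Longrightarrow> r \<le> s"
  shows "bruhat_dist n u p = r"
  unfolding bruhat_dist_eq_Least[OF assms(1)] by (rule Least_equality) (use assms in auto)

lemma relpowp_bruhat_dist:
  assumes "bruhat_le n u p"
  shows "(bruhat_edge n ^^ bruhat_dist n u p) u p"
  using assms LeastI_ex[of "\<lambda>r. (bruhat_edge n ^^ r) u p"]
  by (auto simp: bruhat_le_iff_relpowp bruhat_dist_eq_Least)

section \<open>Shortcuts relative to a statistic\<close>

definition level :: "nat \<Rightarrow> ((nat \<Rightarrow> nat) \<Rightarrow> 'a) \<Rightarrow> (nat \<Rightarrow> nat) \<Rightarrow> (nat \<Rightarrow> nat) \<Rightarrow> (nat \<Rightarrow> nat) set" where
  "level n f u v = {x \<in> bruhat_interval n u v. f x = f v}"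

text \<open>
  The two properties through which a standard decomposition enters the definition of double shortcuts.
  The first says that the level of \<open>v\<close> is closed upwards inside every interval \<open>[u,v]\<close>; with the second,
  it makes that level an interval \<open>[z,v]\<close>.
\<close>

definition hypercube_statistic :: "nat \<Rightarrow> ((nat \<Rightarrow> nat) \<Rightarrow> 'a) \<Rightarrow> bool" where
  "hypercube_statistic n f \<longleftrightarrow>
     (\<forall>x y z. bruhat_le n x y \<and> bruhat_le n y z \<and> f x = f z \<longrightarrow> f y = f z) \<and>
     (\<forall>u v. bruhat_le n u v \<longrightarrow> (\<exists>m\<in>level n f u v. \<forall>x\<in>level n f u v. bruhat_le n m x))"

text \<open>
  The shortcuts from \<open>u\<close> with respect to all levels of \<open>f\<close> at once. Referring to the level of \<open>p\<close> instead
  of a level set of \<open>[u,v]\<close> removes \<open>v\<close> from the notion.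
\<close>

definition entry_points :: "nat \<Rightarrow> ((nat \<Rightarrow> nat) \<Rightarrow> 'a) \<Rightarrow> (nat \<Rightarrow> nat) \<Rightarrow> (nat \<Rightarrow> nat) set" where
  "entry_points n f u = {p. bruhat_le n u p \<and>
     (\<forall>x i j. (bruhat_edge n ^^ i) u x \<and> (bruhat_edge n ^^ j) x p \<and>
        i + j = bruhat_dist n u p \<and> f x = f p \<longrightarrow> x = p)}"

lemma entry_pointsD:
  "p \<in> entry_points n f u \<Longrightarrow> (bruhat_edge n ^^ i) u x \<Longrightarrow> (bruhat_edge n ^^ j) x p \<Longrightarrow>
     i + j = bruhat_dist n u p \<Longrightarrow> f x = f p \<Longrightarrow> x = p"
  unfolding entry_points_def by blast

lemma bruhat_interval_min_level:
  assumes f: "hypercube_statistic n f" and uv: "bruhat_le n u v"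
  shows "bruhat_interval n (bruhat_min n (level n f u v)) v = level n f u v"
proof -
  obtain m where m: "m \<in> level n f u v" "\<And>x. x \<in> level n f u v \<Longrightarrow> bruhat_le n m x"
    using f uv unfolding hypercube_statistic_def by blast
  have min: "bruhat_min n (level n f u v) = m" by (rule bruhat_min_eq[OF m])
  have "f x = f v" if "bruhat_le n m x" "bruhat_le n x v" for x
  proof -
    have "f m = f v" using m(1) by (simp add: level_def)
    with f that show ?thesis unfolding hypercube_statistic_def by metis
  qed
  moreover have "bruhat_le n u x" if "bruhat_le n m x" for x
    using m(1) that bruhat_le_trans by (auto simp: level_def bruhat_interval_def)
  ultimately show ?thesis
    unfolding min using m(2) unfolding level_def bruhat_interval_def by blast
qed

text \<open>
  The join \<open>z \<or> p\<close> is again a standard decomposition of the same kind, now for \<open>[p,v]\<close>.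
\<close>

lemma hd_join_min_level:
  assumes "hypercube_statistic n f" "bruhat_le n u p" "bruhat_le n p v"
  shows "hd_join n v (bruhat_min n (level n f u v)) p = bruhat_min n (level n f p v)"
proof -
  have "level n f u v \<inter> bruhat_interval n p v = level n f p v"
    using bruhat_le_trans[OF assms(2)] by (auto simp: level_def bruhat_interval_def)
  then show ?thesis
    by (simp add: hd_join_def bruhat_interval_min_level[OF assms(1) bruhat_le_trans[OF assms(2,3)]])
qed

lemma shortcuts_min_level:
  assumes f: "hypercube_statistic n f" and uv: "bruhat_le n u v"
  shows "shortcuts n u v (bruhat_min n (level n f u v)) =
    {p \<in> entry_points n f u. bruhat_le n p v \<and> f p = f v}"
proof -
  have mem: "p \<in> shortcuts n u v (bruhat_min n (level n f u v)) \<longleftrightarrow> p \<in> level n f u v \<and>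
      (\<forall>xs. bruhat_path n u xs p \<and> length xs - 1 = bruhat_dist n u p \<longrightarrow>
         set xs \<inter> level n f u v = {p})" for p
    unfolding shortcuts_def bruhat_interval_min_level[OF f uv] by simp
  show ?thesis
  proof (intro Set.set_eqI iffI)
    note u = bruhat_le_permutes(1)[OF uv]
    fix p assume "p \<in> shortcuts n u v (bruhat_min n (level n f u v))"
    then have p: "bruhat_le n u p" "bruhat_le n p v" "f p = f v"
      and sc: "\<And>xs. bruhat_path n u xs p \<Longrightarrow> length xs - 1 = bruhat_dist n u p \<Longrightarrow>
        set xs \<inter> level n f u v = {p}"
      unfolding mem by (simp_all add: level_def bruhat_interval_def)
    have "x = p" if x: "(bruhat_edge n ^^ i) u x" "(bruhat_edge n ^^ j) x p"
      "i + j = bruhat_dist n u p" "f x = f p" for x i j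
    proof -
      have px: "x permutes {1..n}" by (rule relpowp_bruhat_edge_permutes[OF x(1) u])
      obtain xs where xs: "bruhat_path n u xs x" "length xs = Suc i"
        using relpowp_imp_bruhat_path[OF x(1) u] by blast
      obtain ys where ys: "bruhat_path n x ys p" "length ys = Suc j"
        using relpowp_imp_bruhat_path[OF x(2) px] by blast
      have "set (xs @ tl ys) \<inter> level n f u v = {p}"
        by (rule sc[OF bruhat_path_append[OF xs(1) ys(1)]]) (use xs ys x(3) in simp)
      moreover have "x \<in> set xs" using xs(1) unfolding bruhat_path_def by (metis last_in_set)
      moreover have "x \<in> level n f u v"
      proof -
        have "bruhat_le n u x" "bruhat_le n x p"
          using x px u by (auto simp: bruhat_le_iff_relpowp)
        with p x(4) show ?thesis
          by (auto simp: level_def bruhat_interval_def intro: bruhat_le_trans[of n x p v])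
      qed
      ultimately show ?thesis by auto
    qed
    with p show "p \<in> {p \<in> entry_points n f u. bruhat_le n p v \<and> f p = f v}"
      by (auto simp: entry_points_def)
  next
    fix p assume "p \<in> {p \<in> entry_points n f u. bruhat_le n p v \<and> f p = f v}"
    then have p: "bruhat_le n u p" "bruhat_le n p v" "f p = f v" and ent: "p \<in> entry_points n f u"
      by (simp_all add: entry_points_def)
    have plev: "p \<in> level n f u v" using p by (auto simp: level_def bruhat_interval_def)
    have "set xs \<inter> level n f u v = {p}"
      if xs: "bruhat_path n u xs p" "length xs - 1 = bruhat_dist n u p" for xs
    proof -
      have "p \<in> set xs" using xs(1) unfolding bruhat_path_def by (metis last_in_set)
      moreover have "x = p" if x: "x \<in> set xs" "x \<in> level n f u v" for x
      proof -
        obtain i j where ij: "(bruhat_edge n ^^ i) u x" "(bruhat_edge n ^^ j) x p" "i + j = length xs - 1"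
          using bruhat_path_vertex_split[OF xs(1) x(1)] by blast
        have "i + j = bruhat_dist n u p" using ij(3) xs(2) by (rule trans)
        moreover have "f x = f p" using x(2) unfolding level_def p(3) by blast
        ultimately show ?thesis by (rule entry_pointsD[OF ent ij(1,2)])
      qed
      ultimately show ?thesis using plev by blast
    qed
    with plev show "p \<in> shortcuts n u v (bruhat_min n (level n f u v))"
      unfolding mem by blast
  qed
qed

lemma finite_entry_points: "finite (entry_points n f u)"
  by (rule finite_subset[OF _ finite_permutations[of "{1..n}"]])
     (auto simp: entry_points_def dest: bruhat_le_permutes)

text \<open>
  Monadic bind for multisets: a double shortcut is a shortcut followed by a shortcut.
\<close>

definition mbind :: "('a \<Rightarrow> 'b multiset) \<Rightarrow> 'a multiset \<Rightarrow> 'b multiset" where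
  "mbind F M = (\<Sum>x\<in>#M. F x)"

lemma mbind_simps [simp]:
  "mbind F {#} = {#}" "mbind F (add_mset x M) = F x + mbind F M"
  "mbind F (M + N) = mbind F M + mbind F N"
  by (simp_all add: mbind_def)

lemma mbind_cong: "(\<And>x. x \<in># M \<Longrightarrow> F x = G x) \<Longrightarrow> mbind F M = mbind G M"
  unfolding mbind_def by (metis image_mset_cong)

lemma set_mbind: "set_mset (mbind F M) = (\<Union>x\<in>set_mset M. set_mset (F x))"
  by (induction M) auto

lemma filter_mbind: "filter_mset P (mbind F M) = mbind (\<lambda>x. filter_mset P (F x)) M"
  by (induction M) auto

lemma image_mbind: "image_mset h (mbind F M) = mbind (\<lambda>x. image_mset h (F x)) M"
  by (induction M) auto

lemma mbind_image: "mbind F (image_mset h M) = mbind (\<lambda>x. F (h x)) M"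
  by (induction M) auto

lemma mset_set_Sigma:
  assumes "finite A" "\<And>a. a \<in> A \<Longrightarrow> finite (B a)"
  shows "mset_set (Sigma A B) = mbind (\<lambda>a. image_mset (Pair a) (mset_set (B a))) (mset_set A)"
  using assms
proof (induction A rule: finite_induct)
  case empty
  then show ?case by simp
next
  case (insert a A)
  have "Sigma (insert a A) B = Pair a ` B a \<union> Sigma A B" by auto
  moreover have "Pair a ` B a \<inter> Sigma A B = {}" using insert by auto
  ultimately have "mset_set (Sigma (insert a A) B) = mset_set (Pair a ` B a) + mset_set (Sigma A B)"
    using insert by (simp add: mset_set_Union finite_SigmaI)
  also have "mset_set (Pair a ` B a) = image_mset (Pair a) (mset_set (B a))"
    by (rule image_mset_mset_set[symmetric]) (simp add: inj_on_def)
  finally show ?case using insert by simp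
qed

definition entry_mset :: "nat \<Rightarrow> ((nat \<Rightarrow> nat) \<Rightarrow> 'a) \<Rightarrow> nat \<times> (nat \<Rightarrow> nat) \<Rightarrow>
    (nat \<times> (nat \<Rightarrow> nat)) multiset" where
  "entry_mset n f = (\<lambda>(d, u). image_mset (\<lambda>p. (d + bruhat_dist n u p, p)) (mset_set (entry_points n f u)))"

text \<open>
  The level condition on the intermediate \<open>p\<close> has to be imposed before the second step, but \<open>p \<le> v\<close>
  follows from \<open>b \<le> v\<close>. Filtering only the endpoints by \<open>v\<close> leaves a composition of two maps that do not
  mention \<open>v\<close>.
\<close>

definition double_entry_mset :: "nat \<Rightarrow> ((nat \<Rightarrow> nat) \<Rightarrow> 'a) \<Rightarrow> ((nat \<Rightarrow> nat) \<Rightarrow> 'b) \<Rightarrow> (nat \<Rightarrow> nat) \<Rightarrow> (nat \<Rightarrow> nat) \<Rightarrow>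
    (nat \<times> (nat \<Rightarrow> nat)) multiset" where
  "double_entry_mset n f g u v = filter_mset (\<lambda>(d, b). bruhat_le n b v \<and> f b = f v \<and> g b = g v)
     (mbind (entry_mset n g) (filter_mset (\<lambda>(d, p). f p = f v) (entry_mset n f (0, u))))"

lemma double_shortcuts_eq_double_entry_mset:
  assumes f: "hypercube_statistic n f" and g: "hypercube_statistic n g" and uv: "bruhat_le n u v"
  shows "double_shortcuts n u v (bruhat_min n (level n f u v)) (bruhat_min n (level n g u v)) =
    double_entry_mset n f g u v"
proof -
  define A where "A = {p \<in> entry_points n f u. f p = f v}"
  define B where "B = (\<lambda>p. {b \<in> entry_points n g p. bruhat_le n b v \<and> f b = f v \<and> g b = g v})"
  let ?zf = "bruhat_min n (level n f u v)" and ?zg = "bruhat_min n (level n g u v)"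
  have fin: "finite A" "finite (B p)" for p
    by (simp_all add: A_def B_def finite_entry_points)
  have "(SIGMA p : shortcuts n u v ?zf. shortcuts n p v (hd_join n v ?zg p)) = Sigma A B"
  proof (intro Set.set_eqI iffI; clarify)
    fix p b assume p: "p \<in> shortcuts n u v ?zf" and b: "b \<in> shortcuts n p v (hd_join n v ?zg p)"
    from p have p': "p \<in> entry_points n f u" "bruhat_le n u p" "bruhat_le n p v" "f p = f v"
      by (auto simp: shortcuts_min_level[OF f uv] entry_points_def)
    from b have b': "b \<in> entry_points n g p" "bruhat_le n p b" "bruhat_le n b v" "g b = g v"
      using shortcuts_min_level[OF g p'(3)]
      by (auto simp: hd_join_min_level[OF g p'(2,3)] entry_points_def)
    have "f b = f v"
      using f p'(4) b'(2,3) unfolding hypercube_statistic_def by metis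
    with p' b' show "p \<in> A \<and> b \<in> B p" by (auto simp: A_def B_def)
  next
    fix p b assume p: "p \<in> A" and b: "b \<in> B p"
    then have *: "bruhat_le n u p" "bruhat_le n p b" "bruhat_le n b v"
      by (auto simp: A_def B_def entry_points_def)
    then have pv: "bruhat_le n p v" by (blast intro: bruhat_le_trans)
    with p b show "p \<in> shortcuts n u v ?zf \<and> b \<in> shortcuts n p v (hd_join n v ?zg p)"
      by (auto simp: hd_join_min_level[OF g *(1) pv] shortcuts_min_level[OF f uv]
          shortcuts_min_level[OF g pv] A_def B_def)
  qed
  then have "double_shortcuts n u v ?zf ?zg =
      mbind (\<lambda>p. image_mset (\<lambda>b. (bruhat_dist n u p + bruhat_dist n p b, b)) (mset_set (B p))) (mset_set A)"
    by (simp add: double_shortcuts_def mset_set_Sigma fin image_mbind image_mset.compositionality o_def)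
  also have "\<dots> = double_entry_mset n f g u v"
  proof -
    have "mset_set A = filter_mset (\<lambda>p. f p = f v) (mset_set (entry_points n f u))"
      by (simp add: A_def filter_mset_mset_set finite_entry_points)
    moreover have "mset_set (B p) = filter_mset (\<lambda>b. bruhat_le n b v \<and> f b = f v \<and> g b = g v)
        (mset_set (entry_points n g p))" for p
      by (simp add: B_def filter_mset_mset_set finite_entry_points)
    ultimately show ?thesis
      by (simp add: double_entry_mset_def entry_mset_def filter_mbind filter_mset_image_mset mbind_image
          o_def)
  qed
  finally show ?thesis .
qed

section \<open>Symmetries of the Bruhat graph\<close>

definition bruhat_symmetry :: "nat \<Rightarrow> ((nat \<Rightarrow> nat) \<Rightarrow> (nat \<Rightarrow> nat)) \<Rightarrow> bool" where
  "bruhat_symmetry n \<sigma> \<longleftrightarrow>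
     (\<forall>x. x permutes {1..n} \<longrightarrow> \<sigma> x permutes {1..n} \<and> \<sigma> (\<sigma> x) = x) \<and>
     (\<forall>x y. bruhat_edge n x y \<longrightarrow> bruhat_edge n (\<sigma> x) (\<sigma> y))"

lemma bruhat_symmetryD:
  assumes "bruhat_symmetry n \<sigma>"
  shows "x permutes {1..n} \<Longrightarrow> \<sigma> x permutes {1..n}" "x permutes {1..n} \<Longrightarrow> \<sigma> (\<sigma> x) = x"
    "bruhat_edge n x y \<Longrightarrow> bruhat_edge n (\<sigma> x) (\<sigma> y)"
  using assms unfolding bruhat_symmetry_def by blast+

text \<open>
  An edge that swaps the entries at positions \<open>a < b\<close> swaps, in the inverse, the entries at positions
  \<open>x a < x b\<close>.
\<close>

lemma bruhat_symmetry_inv: "bruhat_symmetry n inv'"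
  unfolding bruhat_symmetry_def
proof (intro conjI allI impI)
  fix x assume x: "x permutes {1..n}"
  show "inv' x permutes {1..n}" "inv' (inv' x) = x"
    using permutes_inv[OF x] permutes_inv_inv[OF x] by auto
next
  fix x y assume "bruhat_edge n x y"
  then obtain a b where x: "x permutes {1..n}"
    and ab: "1 \<le> a" "a < b" "b \<le> n" "x a < x b" "y = x \<circ> trp a b"
    by (auto simp: bruhat_edge_iff)
  have "inv' y = trp a b \<circ> inv' x"
    by (simp add: ab(5) o_inv_distrib permutes_bij[OF x])
  also have "\<dots> = inv' x \<circ> trp (x a) (x b)"
    using transpose_comp_permutes[OF permutes_inv[OF x], of a b] permutes_inv_inv[OF x] by simp
  finally have "inv' y = inv' x \<circ> trp (x a) (x b)" .
  moreover have "x a \<in> {1..n}" "x b \<in> {1..n}"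
    unfolding permutes_in_image[OF x] using ab by simp_all
  ultimately show "bruhat_edge n (inv' x) (inv' y)"
    unfolding bruhat_edge_iff
    using ab permutes_inv[OF x] permutes_inverses(2)[OF x]
    by (intro conjI exI[of _ "x a"] exI[of _ "x b"]) auto
qed

definition flip :: "nat \<Rightarrow> nat \<Rightarrow> nat" where
  "flip n i = (if i \<in> {1..n} then n + 1 - i else i)"

lemma flip_flip [simp]: "flip n (flip n i) = i"
  by (auto simp: flip_def)

lemma flip_permutes: "flip n permutes {1..n}"
proof (rule bij_imp_permutes)
  show "bij_betw (flip n) {1..n} {1..n}"
    by (rule bij_betw_byWitness[where f' = "flip n"]) (auto simp: flip_def)
qed (auto simp: flip_def)

lemma flip_less_iff: "i \<in> {1..n} \<Longrightarrow> j \<in> {1..n} \<Longrightarrow> flip n i < flip n j \<longleftrightarrow> j < i"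
  by (auto simp: flip_def)

text \<open>
  Conjugation by the longest element; it rotates the permutation matrix by a half turn.
\<close>

definition rot180 :: "nat \<Rightarrow> (nat \<Rightarrow> nat) \<Rightarrow> nat \<Rightarrow> nat" where
  "rot180 n x = flip n \<circ> x \<circ> flip n"

lemma rot180_comp: "rot180 n (x \<circ> y) = rot180 n x \<circ> rot180 n y"
  by (auto simp: rot180_def fun_eq_iff)

lemma rot180_rot180 [simp]: "rot180 n (rot180 n x) = x"
  by (auto simp: rot180_def fun_eq_iff)

lemma rot180_transpose: "rot180 n (trp a b) = trp (flip n a) (flip n b)"
proof
  fix c
  show "rot180 n (trp a b) c = trp (flip n a) (flip n b) c"
    by (cases "c = flip n a"; cases "c = flip n b")
       (auto simp: rot180_def Transposition.transpose_def)
qed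

lemma rot180_permutes: "x permutes {1..n} \<Longrightarrow> rot180 n x permutes {1..n}"
  unfolding rot180_def by (intro permutes_compose flip_permutes)

lemma bruhat_symmetry_rot180: "bruhat_symmetry n (rot180 n)"
  unfolding bruhat_symmetry_def
proof (intro conjI allI impI)
  fix x y assume "bruhat_edge n x y"
  then obtain a b where x: "x permutes {1..n}"
    and ab: "1 \<le> a" "a < b" "b \<le> n" "x a < x b" "y = x \<circ> trp a b"
    by (auto simp: bruhat_edge_iff)
  have "rot180 n y = rot180 n x \<circ> trp (flip n b) (flip n a)"
    by (simp add: ab(5) rot180_comp rot180_transpose transpose_commute)
  moreover have "x a \<in> {1..n}" "x b \<in> {1..n}"
    unfolding permutes_in_image[OF x] using ab by simp_all
  then have "rot180 n x (flip n b) < rot180 n x (flip n a)"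
    using ab by (simp add: rot180_def flip_less_iff)
  moreover have "1 \<le> flip n b" "flip n b < flip n a" "flip n a \<le> n"
    using ab by (auto simp: flip_def)
  ultimately show "bruhat_edge n (rot180 n x) (rot180 n y)"
    unfolding bruhat_edge_iff using rot180_permutes[OF x] by blast
qed (simp_all only: rot180_permutes rot180_rot180)

lemma inv_rot180:
  assumes "x permutes {1..n}"
  shows "inv' (rot180 n x) = rot180 n (inv' x)"
proof (rule inv_unique_comp)
  show "rot180 n x \<circ> rot180 n (inv' x) = id" "rot180 n (inv' x) \<circ> rot180 n x = id"
    by (simp_all add: rot180_comp[symmetric] permutes_inv_o[OF assms])
       (simp_all add: rot180_def fun_eq_iff)
qed

lemma relpowp_symmetry:
  assumes "bruhat_symmetry n \<sigma>"
  shows "(bruhat_edge n ^^ r) x y \<Longrightarrow> (bruhat_edge n ^^ r) (\<sigma> x) (\<sigma> y)"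
  by (induction r arbitrary: y) (auto dest: bruhat_symmetryD(3)[OF assms])

lemma relpowp_symmetry_iff:
  assumes "bruhat_symmetry n \<sigma>" "x permutes {1..n}" "y permutes {1..n}"
  shows "(bruhat_edge n ^^ r) (\<sigma> x) (\<sigma> y) \<longleftrightarrow> (bruhat_edge n ^^ r) x y"
  using relpowp_symmetry[OF assms(1), of r x y] relpowp_symmetry[OF assms(1), of r "\<sigma> x" "\<sigma> y"]
    bruhat_symmetryD(2)[OF assms(1)] assms(2,3) by auto

lemma bruhat_le_symmetry:
  assumes "bruhat_symmetry n \<sigma>" "bruhat_le n x y"
  shows "bruhat_le n (\<sigma> x) (\<sigma> y)"
  using assms(2) relpowp_symmetry[OF assms(1)] bruhat_symmetryD(1)[OF assms(1)]
  unfolding bruhat_le_iff_relpowp by blast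

lemma bruhat_le_symmetry_iff:
  assumes "bruhat_symmetry n \<sigma>" "x permutes {1..n}" "y permutes {1..n}"
  shows "bruhat_le n (\<sigma> x) (\<sigma> y) \<longleftrightarrow> bruhat_le n x y"
  using bruhat_le_symmetry[OF assms(1), of x y] bruhat_le_symmetry[OF assms(1), of "\<sigma> x" "\<sigma> y"]
    bruhat_symmetryD(2)[OF assms(1)] assms(2,3) by auto

lemma bruhat_dist_symmetry:
  assumes "bruhat_symmetry n \<sigma>" "x permutes {1..n}" "y permutes {1..n}"
  shows "bruhat_dist n (\<sigma> x) (\<sigma> y) = bruhat_dist n x y"
  using bruhat_symmetryD(1)[OF assms(1,2)] assms(2)
  by (simp only: bruhat_dist_eq_Least relpowp_symmetry_iff[OF assms])

lemma level_symmetry: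
  assumes s: "bruhat_symmetry n \<sigma>" and uv: "bruhat_le n u v"
  shows "level n (\<lambda>x. f (\<sigma> x)) u v = \<sigma> ` level n f (\<sigma> u) (\<sigma> v)"
proof -
  note W = bruhat_le_permutes[OF uv]
  show ?thesis
  proof (intro subset_antisym subsetI)
    fix x assume x: "x \<in> level n (\<lambda>x. f (\<sigma> x)) u v"
    then have "x permutes {1..n}"
      by (auto simp: level_def bruhat_interval_def dest: bruhat_le_permutes)
    then have "x = \<sigma> (\<sigma> x)" using bruhat_symmetryD(2)[OF s] by simp
    moreover have "\<sigma> x \<in> level n f (\<sigma> u) (\<sigma> v)"
      using x bruhat_le_symmetry[OF s] by (auto simp: level_def bruhat_interval_def)
    ultimately show "x \<in> \<sigma> ` level n f (\<sigma> u) (\<sigma> v)" by blast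
  next
    fix x assume "x \<in> \<sigma> ` level n f (\<sigma> u) (\<sigma> v)"
    then obtain y where y: "x = \<sigma> y" "bruhat_le n (\<sigma> u) y" "bruhat_le n y (\<sigma> v)" "f y = f (\<sigma> v)"
      by (auto simp: level_def bruhat_interval_def)
    have "bruhat_le n u x" "bruhat_le n x v"
      using bruhat_le_symmetry[OF s y(2)] bruhat_le_symmetry[OF s y(3)] W y(1)
        bruhat_symmetryD(2)[OF s] by auto
    moreover have "\<sigma> x = y"
      using y(1) bruhat_symmetryD(2)[OF s] bruhat_le_permutes[OF y(2)] by simp
    ultimately show "x \<in> level n (\<lambda>x. f (\<sigma> x)) u v"
      using y(4) by (simp add: level_def bruhat_interval_def)
  qed
qed

text \<open>
  This lemma and the transport lemmas for \<open>entry_points\<close>, \<open>entry_mset\<close> and \<open>double_entry_mset\<close> reduce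
  the four statistics to \<open>x \<mapsto> x n\<close>.
\<close>

lemma hypercube_statistic_symmetry:
  assumes s: "bruhat_symmetry n \<sigma>" and f: "hypercube_statistic n f"
  shows "hypercube_statistic n (\<lambda>x. f (\<sigma> x))"
  unfolding hypercube_statistic_def
proof (intro conjI allI impI)
  fix x y z assume "bruhat_le n x y \<and> bruhat_le n y z \<and> f (\<sigma> x) = f (\<sigma> z)"
  then show "f (\<sigma> y) = f (\<sigma> z)"
    using f bruhat_le_symmetry[OF s] unfolding hypercube_statistic_def by metis
next
  fix u v assume uv: "bruhat_le n u v"
  obtain m where m: "m \<in> level n f (\<sigma> u) (\<sigma> v)"
    "\<And>x. x \<in> level n f (\<sigma> u) (\<sigma> v) \<Longrightarrow> bruhat_le n m x"
    using f bruhat_le_symmetry[OF s uv] unfolding hypercube_statistic_def by blast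
  then show "\<exists>m\<in>level n (\<lambda>x. f (\<sigma> x)) u v. \<forall>x\<in>level n (\<lambda>x. f (\<sigma> x)) u v. bruhat_le n m x"
    unfolding level_symmetry[OF s uv] using bruhat_le_symmetry[OF s] by blast
qed

lemma entry_points_permutes: "p \<in> entry_points n f u \<Longrightarrow> p permutes {1..n}"
  by (auto simp: entry_points_def dest: bruhat_le_permutes)

lemma entry_points_symmetry_subset:
  assumes s: "bruhat_symmetry n \<sigma>" and u: "u permutes {1..n}"
    and p: "p \<in> entry_points n f (\<sigma> u)"
  shows "\<sigma> p \<in> entry_points n (\<lambda>x. f (\<sigma> x)) u"
proof -
  have le: "bruhat_le n (\<sigma> u) p" using p by (simp add: entry_points_def)
  note pW = bruhat_le_permutes(2)[OF le]
  note D = bruhat_symmetryD[OF s]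
  have "bruhat_le n u (\<sigma> p)"
    using bruhat_le_symmetry[OF s le] D(2)[OF u] by simp
  moreover have "x = \<sigma> p" if x: "(bruhat_edge n ^^ i) u x" "(bruhat_edge n ^^ j) x (\<sigma> p)"
    "i + j = bruhat_dist n u (\<sigma> p)" "f (\<sigma> x) = f (\<sigma> (\<sigma> p))" for x i j
  proof -
    have xW: "x permutes {1..n}" by (rule relpowp_bruhat_edge_permutes[OF x(1) u])
    have "\<sigma> x = p"
    proof (rule entry_pointsD[OF p])
      show "(bruhat_edge n ^^ i) (\<sigma> u) (\<sigma> x)" by (rule relpowp_symmetry[OF s x(1)])
      show "(bruhat_edge n ^^ j) (\<sigma> x) p" using relpowp_symmetry[OF s x(2)] D(2)[OF pW] by simp
      show "i + j = bruhat_dist n (\<sigma> u) p"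
        using x(3) bruhat_dist_symmetry[OF s u D(1)[OF pW]] D(2)[OF pW] by simp
      show "f (\<sigma> x) = f p" using x(4) D(2)[OF pW] by simp
    qed
    then show ?thesis using D(2)[OF xW] by auto
  qed
  ultimately show ?thesis unfolding entry_points_def by blast
qed

lemma entry_points_cong:
  assumes fg: "\<And>x. x permutes {1..n} \<Longrightarrow> f x = g x"
  shows "entry_points n f u = entry_points n g u"
proof -
  have "p \<in> entry_points n g u"
    if p: "p \<in> entry_points n f u" and fg: "\<And>x. x permutes {1..n} \<Longrightarrow> f x = g x" for p f g
  proof -
    have le: "bruhat_le n u p" using p by (simp add: entry_points_def)
    note W = bruhat_le_permutes[OF le]
    have "x = p" if x: "(bruhat_edge n ^^ i) u x" "(bruhat_edge n ^^ j) x p"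
      "i + j = bruhat_dist n u p" "g x = g p" for x i j
    proof -
      have "f x = f p"
        using fg[OF W(2)] fg[OF relpowp_bruhat_edge_permutes[OF x(1) W(1)]] x(4) by simp
      from entry_pointsD[OF p x(1-3) this] show ?thesis .
    qed
    with le show ?thesis unfolding entry_points_def by blast
  qed
  from this[of _ f g] this[of _ g f] fg show ?thesis by auto
qed

lemma entry_points_symmetry:
  assumes s: "bruhat_symmetry n \<sigma>" and u: "u permutes {1..n}"
  shows "entry_points n (\<lambda>x. f (\<sigma> x)) u = \<sigma> ` entry_points n f (\<sigma> u)"
proof (intro subset_antisym subsetI)
  note D = bruhat_symmetryD[OF s]
  fix p assume p: "p \<in> entry_points n (\<lambda>x. f (\<sigma> x)) u"
  have pW: "p permutes {1..n}" by (rule entry_points_permutes[OF p])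
  have "\<sigma> p \<in> entry_points n (\<lambda>x. f (\<sigma> (\<sigma> x))) (\<sigma> u)"
    using entry_points_symmetry_subset[OF s D(1)[OF u], of p "\<lambda>x. f (\<sigma> x)"] p D(2)[OF u] by simp
  also have "entry_points n (\<lambda>x. f (\<sigma> (\<sigma> x))) (\<sigma> u) = entry_points n f (\<sigma> u)"
    by (rule entry_points_cong) (simp add: D(2))
  finally show "p \<in> \<sigma> ` entry_points n f (\<sigma> u)" using D(2)[OF pW] by (metis image_eqI)
next
  fix p assume "p \<in> \<sigma> ` entry_points n f (\<sigma> u)"
  then show "p \<in> entry_points n (\<lambda>x. f (\<sigma> x)) u"
    using entry_points_symmetry_subset[OF s u] by blast
qed

lemma entry_mset_symmetry:
  assumes s: "bruhat_symmetry n \<sigma>" and u: "u permutes {1..n}"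
  shows "entry_mset n (\<lambda>x. f (\<sigma> x)) (d, u) = image_mset (map_prod id \<sigma>) (entry_mset n f (d, \<sigma> u))"
proof -
  note D = bruhat_symmetryD[OF s]
  have "inj_on \<sigma> (entry_points n f (\<sigma> u))"
    by (rule inj_on_inverseI[of _ \<sigma>]) (use D(2) entry_points_permutes in blast)
  then have "mset_set (entry_points n (\<lambda>x. f (\<sigma> x)) u) = image_mset \<sigma> (mset_set (entry_points n f (\<sigma> u)))"
    by (simp add: entry_points_symmetry[OF s u] image_mset_mset_set)
  moreover have "bruhat_dist n u (\<sigma> p) = bruhat_dist n (\<sigma> u) p" if "p \<in> entry_points n f (\<sigma> u)" for p
    using bruhat_dist_symmetry[OF s D(1)[OF u] entry_points_permutes[OF that]] D(2)[OF u] by simp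
  ultimately show ?thesis
    by (auto simp: entry_mset_def image_mset.compositionality o_def finite_entry_points
        intro!: image_mset_cong)
qed

lemma double_entry_mset_symmetry:
  assumes s: "bruhat_symmetry n \<sigma>" and u: "u permutes {1..n}" and v: "v permutes {1..n}"
  shows "double_entry_mset n (\<lambda>x. f (\<sigma> x)) (\<lambda>x. g (\<sigma> x)) u v =
    image_mset (map_prod id \<sigma>) (double_entry_mset n f g (\<sigma> u) (\<sigma> v))"
proof -
  note D = bruhat_symmetryD[OF s]
  let ?M = "entry_mset n f (0, \<sigma> u)"
  have M: "y permutes {1..n}" if "(d, y) \<in># filter_mset P ?M" for d y P
    using that by (auto simp: entry_mset_def finite_entry_points dest: entry_points_permutes)
  have E: "y permutes {1..n}" if "(d, y) \<in># entry_mset n g (e, p)" for d y e p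
    using that by (auto simp: entry_mset_def finite_entry_points dest: entry_points_permutes)
  have "mbind (entry_mset n (\<lambda>x. g (\<sigma> x)))
      (filter_mset (\<lambda>(d, p). f (\<sigma> p) = f (\<sigma> v)) (entry_mset n (\<lambda>x. f (\<sigma> x)) (0, u))) =
    mbind (\<lambda>x. entry_mset n (\<lambda>x. g (\<sigma> x)) (map_prod id \<sigma> x))
      (filter_mset (\<lambda>x. f (\<sigma> (\<sigma> (snd x))) = f (\<sigma> v)) ?M)"
    by (simp add: entry_mset_symmetry[OF s u] filter_mset_image_mset mbind_image case_prod_beta o_def)
  also have "filter_mset (\<lambda>x. f (\<sigma> (\<sigma> (snd x))) = f (\<sigma> v)) ?M =
      filter_mset (\<lambda>(d, p). f p = f (\<sigma> v)) ?M" (is "?L = ?R")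
  proof (rule filter_mset_cong[OF refl])
    fix x assume "x \<in># ?M"
    then have "snd x permutes {1..n}" using M[of "fst x" "snd x" "\<lambda>_. True"] by simp
    then show "(f (\<sigma> (\<sigma> (snd x))) = f (\<sigma> v)) = (case x of (d, p) \<Rightarrow> f p = f (\<sigma> v))"
      using D(2) by (simp add: case_prod_beta)
  qed
  also have "mbind (\<lambda>x. entry_mset n (\<lambda>x. g (\<sigma> x)) (map_prod id \<sigma> x)) ?R =
      mbind (\<lambda>x. image_mset (map_prod id \<sigma>) (entry_mset n g x)) ?R"
  proof (rule mbind_cong)
    fix x assume "x \<in># ?R"
    then have "snd x permutes {1..n}" using M[of "fst x" "snd x"] by simp
    then show "entry_mset n (\<lambda>x. g (\<sigma> x)) (map_prod id \<sigma> x) =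
        image_mset (map_prod id \<sigma>) (entry_mset n g x)"
      using entry_mset_symmetry[OF s D(1), of "snd x" g "fst x"] D(2)[of "snd x"]
      by (cases x) simp
  qed
  also have "\<dots> = image_mset (map_prod id \<sigma>) (mbind (entry_mset n g) ?R)"
    by (simp add: image_mbind)
  finally have eq: "mbind (entry_mset n (\<lambda>x. g (\<sigma> x)))
      (filter_mset (\<lambda>(d, p). f (\<sigma> p) = f (\<sigma> v)) (entry_mset n (\<lambda>x. f (\<sigma> x)) (0, u))) =
    image_mset (map_prod id \<sigma>) (mbind (entry_mset n g) ?R)" .
  have "bruhat_le n (\<sigma> b) v \<longleftrightarrow> bruhat_le n b (\<sigma> v)" "\<sigma> (\<sigma> b) = b"
    if "(d, b) \<in># mbind (entry_mset n g) ?R" for d b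
  proof -
    from that have b: "b permutes {1..n}" unfolding set_mbind using E by fastforce
    show "bruhat_le n (\<sigma> b) v \<longleftrightarrow> bruhat_le n b (\<sigma> v)" "\<sigma> (\<sigma> b) = b"
      using bruhat_le_symmetry_iff[OF s b D(1)[OF v]] D(2)[OF v] D(2)[OF b] by simp_all
  qed
  then show ?thesis
    unfolding double_entry_mset_def eq filter_mset_image_mset
    by (intro arg_cong[where f = "image_mset _"] filter_mset_cong) auto
qed

section \<open>Standard decompositions as minima of levels\<close>

lemma inj_simple_refl: "inj simple_refl"
proof (rule injI)
  fix i j assume "simple_refl i = simple_refl j"
  then have "simple_refl i i = simple_refl j i" "simple_refl i j = simple_refl j j" by simp_all
  then show "i = j" by (auto simp: simple_refl_def Transposition.transpose_def split: if_splits)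
qed

lemma generate_simple_refls:
  assumes "1 \<le> a" "b \<le> n"
  shows "generate (sym_group n) (simple_refl ` {a..<b}) = {w. w permutes {a..b}}"
proof (intro subset_antisym subsetI)
  interpret G: group "sym_group n" by (rule sym_group_is_group)
  fix w assume "w \<in> generate (sym_group n) (simple_refl ` {a..<b})"
  then show "w \<in> {w. w permutes {a..b}}"
  proof induction
    case one
    then show ?case unfolding sym_group_one mem_Collect_eq by (rule permutes_id)
  next
    case (incl h)
    then show ?case by (auto simp: simple_refl_def intro!: permutes_swap_id)
  next
    case (inv h)
    then obtain k where k: "h = trp k (k + 1)" "k \<in> {a..<b}" by (auto simp: simple_refl_def)
    then have h: "h permutes {a..b}" by (auto intro!: permutes_swap_id)
    then have "h \<in> carrier (sym_group n)"
      unfolding sym_group_carrier by (rule permutes_subset) (use assms in auto)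
    moreover have "h \<otimes>\<^bsub>sym_group n\<^esub> h = \<one>\<^bsub>sym_group n\<^esub>"
      by (simp add: sym_group_mult sym_group_one k(1))
    ultimately have "inv\<^bsub>sym_group n\<^esub> h = h" by (intro G.inv_equality) auto
    with h show ?case by simp
  next
    case (eng h1 h2)
    then show ?case unfolding sym_group_mult mem_Collect_eq by (intro permutes_compose)
  qed
next
  fix w assume "w \<in> {w. w permutes {a..b}}"
  then obtain ss where ss: "set ss \<subseteq> simple_refl ` {a..<b}" "foldr (\<circ>) ss id = w"
    using reduced_word_exists[of w a b n] assms by auto
  have "foldr (\<circ>) ss id \<in> generate (sym_group n) (simple_refl ` {a..<b})"
    using ss(1)
  proof (induction ss)
    case Nil
    show ?case using generate.one[of "sym_group n"] by (simp add: sym_group_one id_def)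
  next
    case (Cons s ss)
    then have "s \<in> generate (sym_group n) (simple_refl ` {a..<b})"
      by (auto intro: generate.incl)
    moreover have "foldr (\<circ>) ss id \<in> generate (sym_group n) (simple_refl ` {a..<b})"
      by (rule Cons.IH) (use Cons.prems in simp)
    ultimately have "s \<otimes>\<^bsub>sym_group n\<^esub> foldr (\<circ>) ss id \<in> generate (sym_group n) (simple_refl ` {a..<b})"
      by (rule generate.eng)
    then show ?case unfolding foldr_comp_Cons sym_group_mult .
  qed
  with ss(2) show "w \<in> generate (sym_group n) (simple_refl ` {a..<b})" by simp
qed

lemma parabolic_delete_last:
  assumes "n \<ge> 2"
  shows "parabolic n (simple_refls n - {simple_refl (n - 1)}) = {w. w permutes {1..n} \<and> w n = n}"
proof -
  have "{1..n - 1} - {n - 1} = {1..<n - 1}" using assms by auto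
  then have "simple_refls n - {simple_refl (n - 1)} = simple_refl ` {1..<n - 1}"
    using image_set_diff[OF inj_simple_refl, of "{1..n - 1}" "{n - 1}"] by (simp add: simple_refls_def)
  moreover have "w permutes {1..n - 1} \<longleftrightarrow> w permutes {1..n} \<and> w n = n" for w
  proof
    assume w: "w permutes {1..n - 1}"
    have "w n = n" using permutes_not_in[OF w, of n] assms by simp
    moreover have "w permutes {1..n}" by (rule permutes_subset[OF w]) auto
    ultimately show "w permutes {1..n} \<and> w n = n" by blast
  next
    assume *: "w permutes {1..n} \<and> w n = n"
    have "{1..n} - {1..n - 1} = {n}" using assms by auto
    with * have "w permutes {1..n}" "\<forall>x\<in>{1..n} - {1..n - 1}. w x = x" by auto
    then show "w permutes {1..n - 1}" by (auto intro: permutes_superset)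
  qed
  ultimately show ?thesis
    by (simp add: parabolic_def generate_simple_refls)
qed

lemma parabolic_delete_first:
  assumes "n \<ge> 2"
  shows "parabolic n (simple_refls n - {simple_refl 1}) = {w. w permutes {1..n} \<and> w 1 = 1}"
proof -
  have "{1..n - 1} - {1} = {2..<n}" using assms by auto
  then have "simple_refls n - {simple_refl 1} = simple_refl ` {2..<n}"
    using image_set_diff[OF inj_simple_refl, of "{1..n - 1}" "{1}"] by (simp add: simple_refls_def)
  moreover have "w permutes {2..n} \<longleftrightarrow> w permutes {1..n} \<and> w 1 = 1" for w
  proof
    assume w: "w permutes {2..n}"
    have "w 1 = 1" using permutes_not_in[OF w, of 1] assms by simp
    moreover have "w permutes {1..n}" by (rule permutes_subset[OF w]) auto
    ultimately show "w permutes {1..n} \<and> w 1 = 1" by blast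
  next
    assume *: "w permutes {1..n} \<and> w 1 = 1"
    have "{1..n} - {2..n} = {1}" using assms by auto
    with * have "w permutes {1..n}" "\<forall>x\<in>{1..n} - {2..n}. w x = x" by auto
    then show "w permutes {2..n}" by (auto intro: permutes_superset)
  qed
  ultimately show ?thesis
    by (simp add: parabolic_def generate_simple_refls)
qed

lemma l_coset_stabilizer_iff:
  assumes "v permutes {1..n}" "x permutes {1..n}"
  shows "x \<in> v <#\<^bsub>sym_group n\<^esub> {w. w permutes {1..n} \<and> w i = i} \<longleftrightarrow> x i = v i"
proof
  assume "x i = v i"
  then have "x = v \<circ> (inv' v \<circ> x)" "inv' v \<circ> x permutes {1..n}" "(inv' v \<circ> x) i = i"
    using assms by (auto simp: fun_eq_iff permutes_inverses permutes_inv intro: permutes_compose)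
  then show "x \<in> v <#\<^bsub>sym_group n\<^esub> {w. w permutes {1..n} \<and> w i = i}"
    unfolding l_coset_def sym_group_mult by blast
qed (auto simp: l_coset_def sym_group_mult)

lemma r_coset_stabilizer_iff:
  assumes "v permutes {1..n}" "x permutes {1..n}"
  shows "x \<in> {w. w permutes {1..n} \<and> w i = i} #>\<^bsub>sym_group n\<^esub> v \<longleftrightarrow> inv' x i = inv' v i"
proof
  assume *: "inv' x i = inv' v i"
  then have "(x \<circ> inv' v) i = i" by (metis o_apply assms(2) permutes_inverses(1))
  moreover have "x = (x \<circ> inv' v) \<circ> v" "x \<circ> inv' v permutes {1..n}"
    using assms by (auto simp: fun_eq_iff permutes_inverses permutes_inv intro: permutes_compose)
  ultimately show "x \<in> {w. w permutes {1..n} \<and> w i = i} #>\<^bsub>sym_group n\<^esub> v"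
    unfolding r_coset_def sym_group_mult by blast
next
  assume "x \<in> {w. w permutes {1..n} \<and> w i = i} #>\<^bsub>sym_group n\<^esub> v"
  then obtain w where w: "x = w \<circ> v" "w i = i" by (auto simp: r_coset_def sym_group_mult)
  then have "x (inv' v i) = i" using assms(1) by (simp add: permutes_inverses)
  then show "inv' x i = inv' v i" using assms(2) by (metis permutes_inverses(2))
qed

text \<open>
  The statistic obtained from \<open>x n\<close> by symmetry is \<open>n + 1 - x 1\<close>. It has the same levels as \<open>x 1\<close>.
\<close>

lemma rot180_last_eq_iff:
  assumes "1 \<le> n" "x permutes {1..n}" "v permutes {1..n}"
  shows "rot180 n x n = rot180 n v n \<longleftrightarrow> x 1 = v 1"
proof -
  have "flip n n = 1" using assms(1) by (simp add: flip_def)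
  moreover have "flip n i = flip n j \<longleftrightarrow> i = j" for i j by (metis flip_flip)
  ultimately show ?thesis by (simp add: rot180_def)
qed

lemma std_eq_min_level:
  assumes n: "n \<ge> 2" and uv: "bruhat_le n u v"
  shows "upper_std n (n - 1) u v = bruhat_min n (level n (\<lambda>x. x n) u v)"
    and "upper_std n 1 u v = bruhat_min n (level n (\<lambda>x. rot180 n x n) u v)"
    and "lower_std n (n - 1) u v = bruhat_min n (level n (\<lambda>x. inv' x n) u v)"
    and "lower_std n 1 u v = bruhat_min n (level n (\<lambda>x. rot180 n (inv' x) n) u v)"
proof -
  note v = bruhat_le_permutes(2)[OF uv]
  have eq: "bruhat_interval n u v \<inter> C = level n f u v"
    if "\<And>x. x permutes {1..n} \<Longrightarrow> x \<in> C \<longleftrightarrow> f x = f v" for C and f :: "_ \<Rightarrow> nat"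
    using that by (auto simp: level_def bruhat_interval_def dest: bruhat_le_permutes)
  have "rot180 n x n = rot180 n v n \<longleftrightarrow> x 1 = v 1" if "x permutes {1..n}" for x
    using rot180_last_eq_iff[OF _ that v] n by simp
  moreover have "rot180 n (inv' x) n = rot180 n (inv' v) n \<longleftrightarrow> inv' x 1 = inv' v 1"
    if "x permutes {1..n}" for x
    using rot180_last_eq_iff[OF _ permutes_inv[OF that] permutes_inv[OF v]] n by simp
  ultimately show "upper_std n (n - 1) u v = bruhat_min n (level n (\<lambda>x. x n) u v)"
    and "upper_std n 1 u v = bruhat_min n (level n (\<lambda>x. rot180 n x n) u v)"
    and "lower_std n (n - 1) u v = bruhat_min n (level n (\<lambda>x. inv' x n) u v)"
    and "lower_std n 1 u v = bruhat_min n (level n (\<lambda>x. rot180 n (inv' x) n) u v)"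
    unfolding upper_std_def lower_std_def parabolic_delete_first[OF n] parabolic_delete_last[OF n]
    using l_coset_stabilizer_iff[OF v] r_coset_stabilizer_iff[OF v]
    by (intro arg_cong[where f = "bruhat_min n"] eq; simp)+
qed

section \<open>The last entry is a hypercube statistic\<close>

lemma bruhat_edgeI:
  "x permutes {1..n} \<Longrightarrow> 1 \<le> a \<Longrightarrow> a < b \<Longrightarrow> b \<le> n \<Longrightarrow> x a < x b \<Longrightarrow>
     bruhat_edge n x (x \<circ> trp a b)"
  unfolding bruhat_edge_iff by blast

lemma bruhat_edge_last_le: "bruhat_edge n x y \<Longrightarrow> y n \<le> x n"
  unfolding bruhat_edge_iff by (auto simp: Transposition.transpose_def)

lemma relpowp_bruhat_edge_last_le: "(bruhat_edge n ^^ r) x y \<Longrightarrow> y n \<le> x n"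
  by (induction r arbitrary: y) (auto dest!: bruhat_edge_last_le intro: le_trans)

lemma bruhat_le_last_le: "bruhat_le n x y \<Longrightarrow> y n \<le> x n"
  unfolding bruhat_le_iff_relpowp using relpowp_bruhat_edge_last_le by blast

definition simple_lmul :: "nat \<Rightarrow> (nat \<Rightarrow> nat) \<Rightarrow> nat \<Rightarrow> nat" where
  "simple_lmul c x = trp c (Suc c) \<circ> x"

lemma simple_lmul_simple_lmul [simp]: "simple_lmul c (simple_lmul c x) = x"
  by (auto simp: simple_lmul_def fun_eq_iff)

lemma simple_lmul_permutes:
  "1 \<le> c \<Longrightarrow> c < n \<Longrightarrow> x permutes {1..n} \<Longrightarrow> simple_lmul c x permutes {1..n}"
  unfolding simple_lmul_def by (intro permutes_compose permutes_swap_id) auto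

lemma simple_lmul_eq_comp:
  assumes "x permutes {1..n}" "x a = c" "x b = Suc c"
  shows "simple_lmul c x = x \<circ> trp a b"
proof -
  have "inv' x c = a" "inv' x (Suc c) = b" using assms by (metis permutes_inverses(2))+
  then show ?thesis unfolding simple_lmul_def transpose_comp_permutes[OF assms(1)] by simp
qed

text \<open>
  A simple reflection acting on values reverses the order of one pair of entries only, so it can spoil
  only the edge that swaps this very pair. The lifting properties below follow by moving a path along.
\<close>

lemma simple_lmul_edge:
  assumes e: "bruhat_edge n x y" and c: "1 \<le> c" "c < n" and ne: "y \<noteq> simple_lmul c x"
  shows "bruhat_edge n (simple_lmul c x) (simple_lmul c y)"
proof -
  obtain a b where x: "x permutes {1..n}"
    and ab: "1 \<le> a" "a < b" "b \<le> n" "x a < x b" "y = x \<circ> trp a b"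
    using e by (auto simp: bruhat_edge_iff)
  have "\<not> (x a = c \<and> x b = Suc c)" using simple_lmul_eq_comp[OF x] ab(5) ne by auto
  then have "simple_lmul c x a < simple_lmul c x b"
    using ab(4) by (auto simp: simple_lmul_def Transposition.transpose_def)
  moreover have "simple_lmul c y = simple_lmul c x \<circ> trp a b" by (simp add: simple_lmul_def ab(5) comp_assoc)
  ultimately show ?thesis
    unfolding bruhat_edge_iff using simple_lmul_permutes[OF c x] ab by blast
qed

lemma simple_lmul_comparable:
  assumes x: "x permutes {1..n}" and c: "1 \<le> c" "c < n"
  shows "bruhat_edge n x (simple_lmul c x) \<or> bruhat_edge n (simple_lmul c x) x"
proof -
  define a where "a = min (inv' x c) (inv' x (Suc c))"
  define b where "b = max (inv' x c) (inv' x (Suc c))"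
  have "inv' x c \<in> {1..n}" "inv' x (Suc c) \<in> {1..n}"
    unfolding permutes_in_image[OF permutes_inv[OF x]] using c by auto
  moreover have "inv' x c \<noteq> inv' x (Suc c)" using permutes_inverses(1)[OF x] by (metis n_not_Suc_n)
  ultimately have ab: "1 \<le> a" "a < b" "b \<le> n" by (auto simp: a_def b_def)
  have eq: "simple_lmul c x = x \<circ> trp a b"
    unfolding simple_lmul_def transpose_comp_permutes[OF x] a_def b_def
    by (auto simp: min_def max_def transpose_commute)
  show ?thesis
  proof (cases "x a < x b")
    case True
    then show ?thesis unfolding bruhat_edge_iff eq using x ab by blast
  next
    case False
    moreover have "x a \<noteq> x b" using ab permutes_inj[OF x] by (simp add: inj_eq)
    ultimately have "simple_lmul c x a < simple_lmul c x b" by (simp add: eq)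
    moreover have "x = simple_lmul c x \<circ> trp a b" by (simp add: eq comp_assoc)
    ultimately show ?thesis
      unfolding bruhat_edge_iff using simple_lmul_permutes[OF c x] ab by blast
  qed
qed

text \<open>
  If the translated path breaks, it does so at an edge from \<open>x\<close> to its own translate; from there the
  original path reaches \<open>y\<close>.
\<close>

lemma simple_lmul_le_simple_lmul:
  assumes c: "1 \<le> c" "c < n" and xy: "bruhat_le n x y" and e: "bruhat_edge n y (simple_lmul c y)"
  shows "bruhat_le n (simple_lmul c x) (simple_lmul c y)"
proof -
  note W = bruhat_le_permutes[OF xy]
  have "bruhat_le n (simple_lmul c x) (simple_lmul c y)"
    if "(bruhat_edge n ^^ r) x y" "x permutes {1..n}" for r x
    using that
  proof (induction r arbitrary: x)
    case 0
    then show ?case using simple_lmul_permutes[OF c W(2)] by (simp add: bruhat_le_refl)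
  next
    case (Suc r)
    then obtain w where w: "bruhat_edge n x w" "(bruhat_edge n ^^ r) w y"
      by (metis relpowp_Suc_D2)
    note wW = bruhat_edge_permutes(2)[OF w(1)]
    show ?case
    proof (cases "w = simple_lmul c x")
      case True
      have "bruhat_le n w y" using w(2) wW by (auto simp: bruhat_le_iff_relpowp)
      with True show ?thesis using bruhat_edge_imp_le[OF e] bruhat_le_trans by blast
    next
      case False
      from simple_lmul_edge[OF w(1) c False] Suc.IH[OF w(2) wW] show ?thesis
        using bruhat_edge_imp_le bruhat_le_trans by blast
    qed
  qed
  then show ?thesis using xy by (auto simp: bruhat_le_iff_relpowp)
qed

definition lower_of :: "nat \<Rightarrow> nat \<Rightarrow> (nat \<Rightarrow> nat) \<Rightarrow> (nat \<Rightarrow> nat)" where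
  "lower_of n c x = (if bruhat_edge n (simple_lmul c x) x then simple_lmul c x else x)"

lemma lower_of_le: "x permutes {1..n} \<Longrightarrow> bruhat_le n (lower_of n c x) x"
  by (simp add: lower_of_def bruhat_edge_imp_le bruhat_le_refl)

text \<open>
  The lifting property, with both cases (whether or not \<open>x\<close> has the descent) put together.
\<close>

lemma lower_of_le_simple_lmul:
  assumes c: "1 \<le> c" "c < n" and xy: "bruhat_le n x y" and e: "bruhat_edge n (simple_lmul c y) y"
  shows "bruhat_le n (lower_of n c x) (simple_lmul c y)"
proof -
  note W = bruhat_le_permutes[OF xy]
  have "bruhat_le n (lower_of n c x) (simple_lmul c y)"
    if "(bruhat_edge n ^^ r) x y" "bruhat_edge n (simple_lmul c y) y" for r y
    using that
  proof (induction r arbitrary: y)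
    case 0
    then have "x = y" by simp
    with 0(2) W(1) show ?case
      using bruhat_edge_permutes(1)[OF 0(2)] by (auto simp: lower_of_def bruhat_le_refl)
  next
    case (Suc r)
    then obtain w where w: "(bruhat_edge n ^^ r) x w" "bruhat_edge n w y" by auto
    note wW = bruhat_edge_permutes(1)[OF w(2)]
    have "bruhat_le n x w" using w(1) W(1) by (auto simp: bruhat_le_iff_relpowp)
    then have xw: "bruhat_le n (lower_of n c x) w"
      using lower_of_le[OF W(1)] bruhat_le_trans by blast
    show ?case
    proof (cases "y = simple_lmul c w")
      case True
      with xw show ?thesis by simp
    next
      case False
      have le: "bruhat_le n (simple_lmul c w) (simple_lmul c y)"
        by (rule bruhat_edge_imp_le[OF simple_lmul_edge[OF w(2) c False]])
      have "bruhat_le n (lower_of n c x) (simple_lmul c w)"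
        using simple_lmul_comparable[OF wW c]
      proof
        assume "bruhat_edge n w (simple_lmul c w)"
        with xw show ?thesis using bruhat_edge_imp_le bruhat_le_trans by blast
      next
        assume "bruhat_edge n (simple_lmul c w) w"
        from Suc.IH[OF w(1) this] show ?thesis .
      qed
      with le show ?thesis using bruhat_le_trans by blast
    qed
  qed
  then show ?thesis using xy e by (auto simp: bruhat_le_iff_relpowp)
qed

lemma edge_simple_lmul_last:
  assumes x: "x permutes {1..n}" and c: "1 \<le> c" "x n = Suc c"
  shows "bruhat_edge n x (simple_lmul c x)"
proof -
  have n: "n \<in> {1..n}"
  proof (rule ccontr)
    assume "n \<notin> {1..n}"
    then have "n = 0" "x n = n" using permutes_not_in[OF x] by auto
    with c show False by simp
  qed
  then have "Suc c \<le> n" using permutes_in_image[OF x, of n] c(2) by simp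
  then have "inv' x c \<in> {1..n}" unfolding permutes_in_image[OF permutes_inv[OF x]] using c by simp
  moreover have xc: "x (inv' x c) = c" using x by (simp add: permutes_inverses)
  then have "inv' x c \<noteq> n" using c(2) by auto
  ultimately show ?thesis
    unfolding bruhat_edge_iff simple_lmul_eq_comp[OF x xc c(2)] using x xc c(2)
    by (intro conjI exI[of _ "inv' x c"] exI[of _ n]) auto
qed

text \<open>
  Induction on the distance from \<open>u n\<close> down to the prescribed value \<open>c\<close>. Swapping the values \<open>c\<close> and
  \<open>c + 1\<close> takes an \<open>x\<close> with \<open>x n = c\<close> down to some \<open>x'\<close> with last entry \<open>c + 1\<close>. If \<open>w\<close> is the lower one of \<open>u\<close>
  and its image under this swap, then lifting shows that \<open>x \<ge> u\<close> iff \<open>x' \<ge> w\<close>. Hence the minimum for \<open>w\<close> and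
  \<open>c + 1\<close>, with \<open>c\<close> and \<open>c + 1\<close> swapped back, is the one sought.
\<close>

lemma ex_min_last_value:
  assumes "u permutes {1..n}" "1 \<le> c" "c \<le> u n"
  shows "\<exists>m. bruhat_le n u m \<and> m n = c \<and> (\<forall>x. bruhat_le n u x \<and> x n = c \<longrightarrow> bruhat_le n m x)"
  using assms
proof (induction "u n - c" arbitrary: u c)
  case 0
  then show ?case by (intro exI[of _ u]) (auto intro: bruhat_le_refl)
next
  case (Suc d)
  have un: "c < u n" using Suc.hyps(2) by simp
  have "n \<in> {1..n}"
  proof (rule ccontr)
    assume "n \<notin> {1..n}"
    then have "n = 0" "u n = n" using permutes_not_in[OF Suc.prems(1)] by auto
    with un show False by simp
  qed
  then have "u n \<le> n" using permutes_in_image[OF Suc.prems(1), of n] by simp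
  with un have c: "1 \<le> c" "c < n" using Suc.prems(2) by auto
  define w where "w = lower_of n c u"
  have wW: "w permutes {1..n}"
    using lower_of_le[OF Suc.prems(1), of c] unfolding w_def by (rule bruhat_le_permutes)
  have wn: "w n = u n"
  proof (cases "u n = Suc c")
    case True
    from edge_simple_lmul_last[OF Suc.prems(1) c(1) True] have "\<not> bruhat_edge n (simple_lmul c u) u"
      by (auto simp: bruhat_edge_def)
    then show ?thesis by (simp add: w_def lower_of_def)
  next
    case False
    then show ?thesis using un by (simp add: w_def lower_of_def simple_lmul_def)
  qed
  have dw: "d = w n - Suc c" using Suc.hyps(2) wn by simp
  obtain m where m: "bruhat_le n w m" "m n = Suc c"
    "\<And>x. bruhat_le n w x \<Longrightarrow> x n = Suc c \<Longrightarrow> bruhat_le n m x"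
    using Suc.hyps(1)[OF dw wW] wn un by auto
  note mW = bruhat_le_permutes(2)[OF m(1)]
  have em: "bruhat_edge n m (simple_lmul c m)" by (rule edge_simple_lmul_last[OF mW c(1) m(2)])
  have "bruhat_le n (simple_lmul c w) (simple_lmul c m)" by (rule simple_lmul_le_simple_lmul[OF c m(1) em])
  moreover have "bruhat_le n w (simple_lmul c m)"
    using m(1) bruhat_edge_imp_le[OF em] by (rule bruhat_le_trans)
  moreover have "u = w \<or> u = simple_lmul c w" by (auto simp: w_def lower_of_def)
  ultimately have "bruhat_le n u (simple_lmul c m)" by auto
  moreover have "simple_lmul c m n = c" by (simp add: simple_lmul_def m(2))
  moreover have "bruhat_le n (simple_lmul c m) x" if x: "bruhat_le n u x" "x n = c" for x
  proof -
    have x'W: "simple_lmul c x permutes {1..n}" by (rule simple_lmul_permutes[OF c bruhat_le_permutes(2)[OF x(1)]])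
    have x'n: "simple_lmul c x n = Suc c" by (simp add: simple_lmul_def x(2))
    have e: "bruhat_edge n (simple_lmul c x) x" using edge_simple_lmul_last[OF x'W c(1) x'n] by simp
    have "bruhat_le n w (simple_lmul c x)" unfolding w_def by (rule lower_of_le_simple_lmul[OF c x(1) e])
    then have "bruhat_le n m (simple_lmul c x)" using x'n by (rule m(3))
    from simple_lmul_le_simple_lmul[OF c this] e show ?thesis by simp
  qed
  ultimately show ?case by blast
qed

lemma hypercube_statistic_last:
  assumes "1 \<le> n"
  shows "hypercube_statistic n (\<lambda>x. x n)"
  unfolding hypercube_statistic_def
proof (intro conjI allI impI)
  fix x y z assume "bruhat_le n x y \<and> bruhat_le n y z \<and> x n = z n"
  then show "y n = z n" using bruhat_le_last_le[of n x y] bruhat_le_last_le[of n y z] by simp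
next
  fix u v assume uv: "bruhat_le n u v"
  note W = bruhat_le_permutes[OF uv]
  have "v n \<in> {1..n}" unfolding permutes_in_image[OF W(2)] using assms by simp
  then obtain m where m: "bruhat_le n u m" "m n = v n"
    "\<And>x. bruhat_le n u x \<Longrightarrow> x n = v n \<Longrightarrow> bruhat_le n m x"
    using ex_min_last_value[OF W(1), of "v n"] bruhat_le_last_le[OF uv] by auto
  then show "\<exists>m\<in>level n (\<lambda>x. x n) u v. \<forall>x\<in>level n (\<lambda>x. x n) u v. bruhat_le n m x"
    using m(3)[OF uv] by (intro bexI[of _ m]) (auto simp: level_def bruhat_interval_def)
qed

section \<open>Rotations along increasing sets of positions\<close>

text \<open>
  The next larger element of \<open>K \<union> {n}\<close>; at \<open>0\<close> it is the least element of \<open>K \<union> {n}\<close>, as \<open>K\<close> consists of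
  positive numbers.
\<close>

definition nxt :: "nat \<Rightarrow> nat set \<Rightarrow> nat \<Rightarrow> nat" where
  "nxt n K x = (LEAST y. y \<in> insert n K \<and> x < y)"

lemma nxtI: "x < n \<Longrightarrow> nxt n K x \<in> insert n K \<and> x < nxt n K x"
  unfolding nxt_def by (rule LeastI[of _ n]) simp

lemma nxt_le: "y \<in> insert n K \<Longrightarrow> x < y \<Longrightarrow> nxt n K x \<le> y"
  unfolding nxt_def by (rule Least_le) simp

lemma nxt_eqI:
  assumes "y \<in> insert n K" "x < y" "\<And>z. z \<in> insert n K \<Longrightarrow> x < z \<Longrightarrow> y \<le> z"
  shows "nxt n K x = y"
  unfolding nxt_def by (rule Least_equality) (use assms in auto)

definition rising :: "nat \<Rightarrow> (nat \<Rightarrow> nat) \<Rightarrow> nat set \<Rightarrow> bool" where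
  "rising n u K \<longleftrightarrow> K \<subseteq> {1..<n} \<and> (\<forall>a\<in>insert n K. \<forall>b\<in>insert n K. a < b \<longrightarrow> u a < u b)"

text \<open>
  The effect on the word \<open>u\<close> of swapping position \<open>n\<close> with the elements of \<open>K\<close> in decreasing order: the
  entry at the least position goes to position \<open>n\<close>, all others move one place to the left within
  \<open>K \<union> {n}\<close>.
\<close>

definition rotate_along :: "nat \<Rightarrow> nat set \<Rightarrow> (nat \<Rightarrow> nat) \<Rightarrow> nat \<Rightarrow> nat" where
  "rotate_along n K u x = (if x = n then u (nxt n K 0) else if x \<in> K then u (nxt n K x) else u x)"

lemma rotate_along_empty: "1 \<le> n \<Longrightarrow> rotate_along n {} u = u"
proof
  fix x assume "1 \<le> n"
  then have "nxt n {} 0 = n" by (intro nxt_eqI) auto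
  then show "rotate_along n {} u x = u x" by (simp add: rotate_along_def)
qed

text \<open>
  The first of two recursions: a new least position is the last swap to be performed, a new greatest
  position the first one. Operators are applied in the first form, paths are analysed in the second.
\<close>

lemma rotate_along_insert_low:
  assumes K: "K \<subseteq> {1..<n}" and j: "1 \<le> j" "j < n" "\<And>k. k \<in> K \<Longrightarrow> j < k"
  shows "rotate_along n (insert j K) u = rotate_along n K u \<circ> trp j n"
proof
  fix x
  have jK: "j \<notin> K" using j(3) by auto
  have 1: "nxt n (insert j K) 0 = j"
    by (rule nxt_eqI) (use j in \<open>auto intro: less_imp_le\<close>)
  have 2: "nxt n (insert j K) k = nxt n K k" if "j \<le> k" for k
    unfolding nxt_def using that by (intro arg_cong[where f = Least]) auto
  have "j < y \<longleftrightarrow> 0 < y" if "y \<in> insert n K" for y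
    using that j(1,2) j(3)[of y] by auto
  then have 3: "nxt n K j = nxt n K 0"
    unfolding nxt_def by (intro arg_cong[where f = Least] ext) blast
  consider "x = n" | "x = j" | "x \<in> K" "x \<noteq> n" "x \<noteq> j" | "x \<notin> K" "x \<noteq> n" "x \<noteq> j" by blast
  then show "rotate_along n (insert j K) u x = (rotate_along n K u \<circ> trp j n) x"
  proof cases
    case 1
    then show ?thesis using j jK \<open>nxt n (insert j K) 0 = j\<close> by (simp add: rotate_along_def)
  next
    case 2
    then show ?thesis using j \<open>nxt n K j = nxt n K 0\<close> 
      by (simp add: rotate_along_def \<open>\<And>k. j \<le> k \<Longrightarrow> nxt n (insert j K) k = nxt n K k\<close>)
  next
    case 3
    then show ?thesis using less_imp_le[OF j(3)]
      by (simp add: rotate_along_def \<open>\<And>k. j \<le> k \<Longrightarrow> nxt n (insert j K) k = nxt n K k\<close>)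
  qed (simp add: rotate_along_def)
qed

lemma rising_insert_low:
  assumes K: "K \<subseteq> {1..<n}" and j: "1 \<le> j" "j < n" "\<And>k. k \<in> K \<Longrightarrow> j < k"
  shows "rising n u (insert j K) \<longleftrightarrow> rising n u K \<and> u j < rotate_along n K u n"
proof -
  have n: "nxt n K 0 \<in> insert n K" using nxtI[of 0 n K] j by auto
  have le: "nxt n K 0 \<le> y" if "y \<in> insert n K" for y
    using nxt_le[of y n K 0] that K j by auto
  show ?thesis
  proof
    assume r: "rising n u (insert j K)"
    have "j < nxt n K 0" using n j by auto
    with r n show "rising n u K \<and> u j < rotate_along n K u n" by (auto simp: rising_def rotate_along_def)
  next
    assume r: "rising n u K \<and> u j < rotate_along n K u n"
    have "u j < u y" if "y \<in> insert n K" for y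
    proof -
      have "u (nxt n K 0) \<le> u y"
        using r le[OF that] that n unfolding rising_def by (metis le_neq_implies_less less_imp_le order_refl)
      with r show ?thesis by (simp add: rotate_along_def)
    qed
    moreover have "\<not> y < j" if "y \<in> insert n K" for y using that j(2) j(3)[of y] by auto
    ultimately show "rising n u (insert j K)"
      using r j by (auto simp: rising_def)
  qed
qed

lemma rotate_along_insert_high:
  assumes K: "K \<subseteq> {1..<n}" and j: "1 \<le> j" "j < n" "\<And>k. k \<in> K \<Longrightarrow> k < j"
  shows "rotate_along n (insert j K) u = rotate_along n K (u \<circ> trp j n)"
proof
  fix x
  have jK: "j \<notin> K" using j(3) by auto
  have A: "nxt n (insert j K) k = trp j n (nxt n K k)" if k: "k < j" for k
  proof -
    have *: "nxt n K k \<in> insert n K" "k < nxt n K k" using nxtI[of k n K] k j by auto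
    show ?thesis
    proof (cases "nxt n K k = n")
      case True
      have "z \<notin> K" if "k < z" for z
        using nxt_le[of z n K k] that True K by force
      then show ?thesis unfolding True using k j by (intro nxt_eqI) (auto intro: less_imp_le)
    next
      case False
      then have "nxt n K k \<in> K" using * by auto
      moreover from this have "trp j n (nxt n K k) = nxt n K k" using jK False by (metis transpose_apply_other)
      ultimately show ?thesis using * nxt_le[of _ n K k] j(3)
        by (simp only:) (rule nxt_eqI, auto intro: less_imp_le)
    qed
  qed
  have B: "nxt n (insert j K) j = n" by (rule nxt_eqI) (use j in \<open>auto dest: j(3)\<close>)
  show "rotate_along n (insert j K) u x = rotate_along n K (u \<circ> trp j n) x"
    using j A[of 0] A[of x] B jK by (auto simp: rotate_along_def)
qed

lemma rising_insert_high:
  assumes K: "K \<subseteq> {1..<n}" and j: "1 \<le> j" "j < n" "\<And>k. k \<in> K \<Longrightarrow> k < j"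
  shows "rising n u (insert j K) \<longleftrightarrow> u j < u n \<and> rising n (u \<circ> trp j n) K"
proof -
  have u: "(u \<circ> trp j n) k = u k" if "k \<in> K" for k using that K j(3)[OF that] by auto
  have nK: "k < n" "k \<noteq> n" if "k \<in> K" for k using K that by auto
  show ?thesis
  proof
    assume r: "rising n u (insert j K)"
    then have "u j < u n" using j by (auto simp: rising_def)
    moreover have "(u \<circ> trp j n) a < (u \<circ> trp j n) b" if "a \<in> insert n K" "b \<in> insert n K" "a < b" for a b
    proof -
      have aK: "a \<in> K" using that nK by (metis insertE less_asym)
      show ?thesis
      proof (cases "b = n")
        case True
        then show ?thesis using r aK u[OF aK] j(3)[OF aK] by (auto simp: rising_def)
      next
        case False
        then show ?thesis using r aK u that by (auto simp: rising_def)
      qed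
    qed
    ultimately show "u j < u n \<and> rising n (u \<circ> trp j n) K" using K unfolding rising_def by blast
  next
    assume r: "u j < u n \<and> rising n (u \<circ> trp j n) K"
    have 1: "u a < u j" if "a \<in> K" for a
      using r that u[OF that] nK[OF that] by (fastforce simp: rising_def)
    have 2: "u a < u b" if "a \<in> K" "b \<in> K" "a < b" for a b
      using r that u by (force simp: rising_def)
    have "u a < u b" if "a \<in> insert n (insert j K)" "b \<in> insert n (insert j K)" "a < b" for a b
    proof -
      have "a \<noteq> n" using that(2,3) nK(1)[of b] j(2) by auto
      moreover have "\<not> (a = j \<and> b \<in> K)" using that(3) j(3)[of b] by auto
      ultimately have "a = j \<and> b = n \<or> a \<in> K \<and> b \<in> insert n (insert j K)"
        using that by auto
      then show ?thesis using 1[of a] 2[of a b] r that(3) by auto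
    qed
    then show "rising n u (insert j K)" using K j unfolding rising_def by auto
  qed
qed

lemma rising_finite: "rising n u K \<Longrightarrow> finite K"
  unfolding rising_def by (meson finite_atLeastLessThan finite_subset)

lemma rotate_along_reachable:
  assumes u: "u permutes {1..n}" and n: "1 \<le> n" and K: "rising n u K"
  shows "(bruhat_edge n ^^ card K) u (rotate_along n K u)"
  using rising_finite[OF K] K
proof (induction K rule: finite_linorder_min_induct)
  case empty
  then show ?case using n by (simp add: rotate_along_empty)
next
  case (insert j K)
  have j: "1 \<le> j" "j < n" and K: "K \<subseteq> {1..<n}" using insert.prems by (auto simp: rising_def)
  have jK: "j \<notin> K" "\<And>k. k \<in> K \<Longrightarrow> j < k" using insert.hyps by auto
  have r: "rising n u K" "u j < rotate_along n K u n"
    using insert.prems rising_insert_low[OF K j jK(2)] by auto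
  note IH = insert.IH[OF r(1)]
  have "rotate_along n K u j = u j" using jK j by (simp add: rotate_along_def)
  then have "bruhat_edge n (rotate_along n K u) (rotate_along n (insert j K) u)"
    using bruhat_edgeI[of "rotate_along n K u" n j n] rotate_along_insert_low[OF K j jK(2)]
      relpowp_bruhat_edge_permutes[OF IH u] r(2) j by simp
  with IH show ?case using insert.hyps(1) jK by (auto intro: relpowp_Suc_I)
qed

section \<open>Shortcuts for the last entry are rotations\<close>

lemma comp_transpose_disjoint:
  assumes "j \<noteq> a" "j \<noteq> b" "n \<noteq> a" "n \<noteq> b"
  shows "u \<circ> trp a b \<circ> trp j n = u \<circ> trp j n \<circ> trp a b"
  using assms by (auto simp: fun_eq_iff Transposition.transpose_def)

lemma comp_transpose_conj:
  assumes "a \<noteq> b" "b \<noteq> c" "a \<noteq> c"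
  shows "u \<circ> trp a b \<circ> trp a c = u \<circ> trp b c \<circ> trp a b"
    and "u \<circ> trp a b \<circ> trp a c = u \<circ> trp a c \<circ> trp b c"
    and "u \<circ> trp a b \<circ> trp b c = u \<circ> trp a c \<circ> trp a b"
    and "u \<circ> trp a b \<circ> trp b c = u \<circ> trp b c \<circ> trp a c"
    and "u \<circ> trp a c \<circ> trp b c = u \<circ> trp b c \<circ> trp a b"
  using assms by (auto simp: fun_eq_iff Transposition.transpose_def)

text \<open>
  The rank two exchange. A step away from position \<open>n\<close>, followed by a step that involves \<open>n\<close>, can be
  replaced by another pair of steps with the same composite whose first step involves \<open>n\<close>. If the two
  transpositions overlap, this takes place among three positions, where each interval of rank two
  consists of exactly two paths.
\<close>

lemma last_move_first_pair:
  assumes e1: "bruhat_edge n u w" and wn: "w n = u n"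
    and j: "1 \<le> j" "j < n" "w j < w n"
  shows "\<exists>i. 1 \<le> i \<and> i < n \<and> u i < u n \<and> bruhat_edge n (u \<circ> trp i n) (w \<circ> trp j n)"
proof -
  obtain a b where u: "u permutes {1..n}"
    and ab: "1 \<le> a" "a < b" "b \<le> n" "u a < u b" "w = u \<circ> trp a b"
    using e1 by (auto simp: bruhat_edge_iff)
  have bn: "b < n"
    using wn ab by (cases "b = n") auto
  have an: "a < n" using ab(2) bn by simp
  have up: "bruhat_edge n (u \<circ> trp i n) (u \<circ> trp i n \<circ> trp c d)"
    if "1 \<le> i" "i < n" "1 \<le> c" "c < d" "d \<le> n" "(u \<circ> trp i n) c < (u \<circ> trp i n) d" for i c d
    by (rule bruhat_edgeI) (use that u in \<open>auto intro!: permutes_compose permutes_swap_id\<close>)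
  consider "j \<noteq> a" "j \<noteq> b" | "j = a" | "j = b" "u b < u n" | "j = b" "\<not> u b < u n" by blast
  then show ?thesis
  proof cases
    case 1
    then have "w j = u j" by (simp add: ab(5))
    moreover have "bruhat_edge n (u \<circ> trp j n) (u \<circ> trp j n \<circ> trp a b)"
      by (rule up) (use 1 j ab an bn in auto)
    moreover have "w \<circ> trp j n = u \<circ> trp j n \<circ> trp a b"
      unfolding ab(5) by (rule comp_transpose_disjoint) (use 1 an bn in auto)
    ultimately show ?thesis using j wn by (intro exI[of _ j]) auto
  next
    case 2
    have ub: "u b < u n" using j(3) wn by (simp add: 2 ab(5))
    have "bruhat_edge n (u \<circ> trp b n) (u \<circ> trp b n \<circ> trp a b)"
      by (rule up) (use ab an bn ub in auto)
    moreover have "w \<circ> trp j n = u \<circ> trp b n \<circ> trp a b"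
      unfolding ab(5) 2 by (rule comp_transpose_conj) (use ab an bn in auto)
    ultimately show ?thesis using ab bn ub by (intro exI[of _ b]) auto
  next
    case 3
    have "bruhat_edge n (u \<circ> trp b n) (u \<circ> trp b n \<circ> trp a n)"
      by (rule up) (use ab an bn in auto)
    moreover have "w \<circ> trp j n = u \<circ> trp b n \<circ> trp a n"
      unfolding ab(5) 3(1) by (rule comp_transpose_conj) (use ab an bn in auto)
    ultimately show ?thesis using ab bn 3 by (intro exI[of _ b]) auto
  next
    case 4
    have ua: "u a < u n" using j(3) wn by (simp add: 4 ab(5))
    have "u b \<noteq> u n" using permutes_inj[OF u] bn by (simp add: inj_eq)
    then have "bruhat_edge n (u \<circ> trp a n) (u \<circ> trp a n \<circ> trp a b)"
      by (intro up) (use ab an bn 4 in auto)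
    moreover have "w \<circ> trp j n = u \<circ> trp a n \<circ> trp a b"
      unfolding ab(5) 4(1) by (rule comp_transpose_conj) (use ab an bn in auto)
    ultimately show ?thesis using ab an ua by (intro exI[of _ a]) auto
  qed
qed

lemma last_move_first:
  assumes "(bruhat_edge n ^^ r) u p" "u n \<noteq> p n"
  shows "\<exists>s j. r = Suc s \<and> 1 \<le> j \<and> j < n \<and> u j < u n \<and> (bruhat_edge n ^^ s) (u \<circ> trp j n) p"
  using assms
proof (induction r arbitrary: u)
  case 0
  then show ?case by simp
next
  case (Suc r)
  then obtain w where w: "bruhat_edge n u w" "(bruhat_edge n ^^ r) w p"
    by (metis relpowp_Suc_D2)
  show ?case
  proof (cases "w n = u n")
    case True
    with Suc.prems(2) have "w n \<noteq> p n" by simp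
    from Suc.IH[OF w(2) this] obtain s j where
      s: "r = Suc s" "1 \<le> j" "j < n" "w j < w n" "(bruhat_edge n ^^ s) (w \<circ> trp j n) p" by blast
    from last_move_first_pair[OF w(1) True s(2-4)] obtain i where
      i: "1 \<le> i" "i < n" "u i < u n" "bruhat_edge n (u \<circ> trp i n) (w \<circ> trp j n)" by blast
    have "(bruhat_edge n ^^ r) (u \<circ> trp i n) p"
      unfolding s(1) by (rule relpowp_Suc_I2[of "bruhat_edge n", OF i(4) s(5)])
    with i show ?thesis by blast
  next
    case False
    obtain a b where ab: "1 \<le> a" "a < b" "b \<le> n" "u a < u b" "w = u \<circ> trp a b"
      using w(1) by (auto simp: bruhat_edge_iff)
    then have "b = n" using False by (cases "b = n") auto
    with ab w(2) show ?thesis by blast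
  qed
qed

text \<open>
  Among the first steps that swap \<open>n\<close> with some \<open>j\<close> and still allow a path of the given length, take the
  one with \<open>j\<close> maximal, and rearrange the rest by induction. If the rest began with a swap at a position
  \<open>i \<ge> j\<close>, then \<open>i \<noteq> j\<close>, and an exchange among \<open>j < i < n\<close> would produce an admissible first step at \<open>i\<close>.
\<close>

lemma path_through_rotation:
  assumes "(bruhat_edge n ^^ r) u p" "u permutes {1..n}" "1 \<le> n"
  shows "\<exists>K. rising n u K \<and> card K \<le> r \<and> rotate_along n K u n = p n \<and>
           (bruhat_edge n ^^ (r - card K)) (rotate_along n K u) p"
  using assms(1,2)
proof (induction r arbitrary: u)
  case 0
  have "rising n u {}" by (simp add: rising_def)
  with 0 assms(3) show ?case by (intro exI[of _ "{}"]) (auto simp: rotate_along_empty)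
next
  case (Suc r)
  show ?case
  proof (cases "u n = p n")
    case True
    have "rising n u {}" by (simp add: rising_def)
    with True Suc.prems assms(3) show ?thesis
      by (intro exI[of _ "{}"]) (auto simp: rotate_along_empty)
  next
    case False
    \<comment> \<open>The possible first steps at position \<open>n\<close> that do not lengthen the path.\<close>
    define J where "J = {j. 1 \<le> j \<and> j < n \<and> u j < u n \<and> (bruhat_edge n ^^ r) (u \<circ> trp j n) p}"
    have "J \<noteq> {}" using last_move_first[OF Suc.prems(1) False] by (auto simp: J_def)
    moreover have "finite J" by (rule finite_subset[of _ "{..<n}"]) (auto simp: J_def)
    ultimately obtain j where jJ: "j \<in> J" and jmax: "\<And>i. i \<in> J \<Longrightarrow> i \<le> j"
      using Max_in Max_ge by metis
    then have j: "1 \<le> j" "j < n" "u j < u n" "(bruhat_edge n ^^ r) (u \<circ> trp j n) p"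
      by (auto simp: J_def)
    define w where "w = u \<circ> trp j n"
    have wW: "w permutes {1..n}" unfolding w_def
      by (rule permutes_compose[OF permutes_swap_id Suc.prems(2)]) (use j in auto)
    obtain K where K: "rising n w K" "card K \<le> r" "rotate_along n K w n = p n"
      "(bruhat_edge n ^^ (r - card K)) (rotate_along n K w) p"
      using Suc.IH[of w] j(4) wW unfolding w_def by blast
    have Kn: "K \<subseteq> {1..<n}" using K(1) by (simp add: rising_def)
    note finK = rising_finite[OF K(1)]
    have below: "k < j" if kK: "k \<in> K" for k
    proof (rule ccontr)
      assume "\<not> k < j"
      define i where "i = Max K"
      have "K \<noteq> {}" using kK by blast
      then have iK: "i \<in> K" and ki: "\<And>k. k \<in> K \<Longrightarrow> k \<le> i"
        unfolding i_def using finK by simp_all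
      with kK \<open>\<not> k < j\<close> have "j \<le> i" by fastforce
      \<comment> \<open>The first swap of the rotation \<open>K\<close> of \<open>w\<close> is the one at \<open>i\<close>; it is exchanged with the swap at \<open>j\<close>.\<close>
      define L where "L = K - {i}"
      have L: "L \<subseteq> {1..<n}" "\<And>k. k \<in> L \<Longrightarrow> k < i" "K = insert i L" "i \<notin> L"
        using Kn ki iK by (auto simp: L_def le_less)
      have i: "1 \<le> i" "i < n" using Kn iK by auto
      from rising_insert_high[OF L(1) i L(2), of w] K(1) L(3)
      have wi: "w i < w n" and Lr: "rising n (w \<circ> trp i n) L" by auto
      have ij: "j < i" using wi \<open>j \<le> i\<close> j(3) by (cases "i = j") (auto simp: w_def)
      then have ui: "u i < u j" using wi i by (simp add: w_def)
      have wiW: "w \<circ> trp i n permutes {1..n}"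
        by (rule permutes_compose[OF permutes_swap_id wW]) (use i in auto)
      have "bruhat_edge n (u \<circ> trp i n) (u \<circ> trp i n \<circ> trp j i)"
        by (rule bruhat_edgeI)
           (use i j ij ui Suc.prems(2) in \<open>auto intro!: permutes_compose permutes_swap_id\<close>)
      also have "u \<circ> trp i n \<circ> trp j i = w \<circ> trp i n"
        unfolding w_def by (rule comp_transpose_conj(5)[symmetric]) (use i j ij in auto)
      finally have e: "bruhat_edge n (u \<circ> trp i n) (w \<circ> trp i n)" .
      have "(bruhat_edge n ^^ card L) (w \<circ> trp i n) (rotate_along n K w)"
        using rotate_along_reachable[OF wiW assms(3) Lr]
          rotate_along_insert_high[OF L(1) i L(2), of w] L(3) by simp
      from relpowp_Suc_I2[of "bruhat_edge n", OF e this]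
      have "(bruhat_edge n ^^ card K) (u \<circ> trp i n) (rotate_along n K w)"
        using L(3,4) finK by simp
      from relpowp_trans[OF this K(4)] K(2) have "(bruhat_edge n ^^ r) (u \<circ> trp i n) p" by simp
      then have "i \<in> J" using i ui j(3) by (simp add: J_def)
      with jmax[of i] ij show False by simp
    qed
    have jK: "j \<notin> K" using below by blast
    have "rising n u (insert j K)"
      using rising_insert_high[OF Kn j(1,2) below, of u] K(1) j(3) by (simp add: w_def)
    moreover have "rotate_along n (insert j K) u = rotate_along n K w"
      using rotate_along_insert_high[OF Kn j(1,2) below, of u] by (simp add: w_def)
    ultimately show ?thesis
      using K(2-4) finK jK by (intro exI[of _ "insert j K"]) simp
  qed
qed

text \<open>
  A Bruhat edge that swaps two positions of the same colour. Colours stand for the connected components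
  of the graph on positions formed by the transpositions used so far.
\<close>

definition coloured_edge :: "nat \<Rightarrow> (nat \<Rightarrow> nat) \<Rightarrow> (nat \<Rightarrow> nat) \<Rightarrow> (nat \<Rightarrow> nat) \<Rightarrow> bool" where
  "coloured_edge n c x y \<longleftrightarrow>
     (\<exists>a b. 1 \<le> a \<and> a < b \<and> b \<le> n \<and> x a < x b \<and> y = x \<circ> trp a b \<and> c a = c b)"

lemma coloured_edge_mono:
  assumes "coloured_edge n c x y" "\<And>a b. c a = c b \<Longrightarrow> c' a = c' b"
  shows "coloured_edge n c' x y"
  using assms unfolding coloured_edge_def by blast

text \<open>
  Each step merges at most two colours. Starting from an arbitrary colouring \<open>c\<close> allows the two halves of
  a path to be treated one after the other.
\<close>

lemma path_colouring:
  fixes c :: "nat \<Rightarrow> nat"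
  assumes "(bruhat_edge n ^^ r) u p"
  shows "\<exists>c'. (\<forall>a b. c a = c b \<longrightarrow> c' a = c' b) \<and>
           card (c ` {1..n}) \<le> card (c' ` {1..n}) + r \<and> (coloured_edge n c' ^^ r) u p"
  using assms
proof (induction r arbitrary: p)
  case 0
  then have "u = p" by simp
  then show ?case by (intro exI[of _ c]) simp
next
  case (Suc r)
  then obtain w where w: "(bruhat_edge n ^^ r) u w" "bruhat_edge n w p" by auto
  from Suc.IH[OF w(1)] obtain c1 where c1: "\<And>a b. c a = c b \<Longrightarrow> c1 a = c1 b"
    "card (c ` {1..n}) \<le> card (c1 ` {1..n}) + r" "(coloured_edge n c1 ^^ r) u w" by blast
  obtain a b where ab: "1 \<le> a" "a < b" "b \<le> n" "w a < w b" "p = w \<circ> trp a b"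
    using w(2) by (auto simp: bruhat_edge_iff)
  define c2 where "c2 = (\<lambda>x. if c1 x = c1 b then c1 a else c1 x)"
  have c12: "c2 x = c2 y" if "c1 x = c1 y" for x y using that by (simp add: c2_def)
  have "c1 ` {1..n} \<subseteq> insert (c1 b) (c2 ` {1..n})" by (auto simp: c2_def)
  then have "card (c1 ` {1..n}) \<le> card (insert (c1 b) (c2 ` {1..n}))" by (intro card_mono) auto
  also have "\<dots> \<le> Suc (card (c2 ` {1..n}))" by (simp add: card_insert_if)
  finally have "card (c ` {1..n}) \<le> card (c2 ` {1..n}) + Suc r" using c1(2) by simp
  moreover have "(coloured_edge n c2 ^^ r) u w"
    by (rule relpowp_mono[OF _ c1(3)]) (rule coloured_edge_mono, assumption, rule c12)
  moreover have "coloured_edge n c2 w p"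
    using ab by (auto simp: coloured_edge_def c2_def)
  ultimately have "card (c ` {1..n}) \<le> card (c2 ` {1..n}) + Suc r \<and> (coloured_edge n c2 ^^ Suc r) u p"
    by (auto intro: relpowp_Suc_I)
  then show ?case using c1(1) c12 by (intro exI[of _ c2]) blast
qed

lemma coloured_path_permutes_within_colour:
  assumes "(coloured_edge n c ^^ r) u p"
  shows "\<exists>a. p b = u a \<and> c a = c b"
  using assms
proof (induction r arbitrary: p b)
  case 0
  then show ?case by auto
next
  case (Suc r)
  then obtain w where w: "(coloured_edge n c ^^ r) u w" "coloured_edge n c w p" by auto
  then obtain i j where ij: "p = w \<circ> trp i j" "c i = c j" by (auto simp: coloured_edge_def)
  obtain a where "w (trp i j b) = u a" "c a = c (trp i j b)" using Suc.IH[OF w(1)] by blast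
  moreover have "c (trp i j b) = c b" using ij(2) by (auto simp: Transposition.transpose_def)
  ultimately show ?case using ij(1) by auto
qed

lemma nxt_chain_constant:
  assumes K: "K \<subseteq> {1..<n}" and step: "\<And>k. k \<in> K \<Longrightarrow> c (nxt n K k) = c k" and k: "k \<in> K"
  shows "c k = c n"
  using k
proof (induction "n - k" arbitrary: k rule: less_induct)
  case less
  have "k < n" using less.prems K by auto
  from nxtI[OF this, of K] have *: "nxt n K k \<in> insert n K" "k < nxt n K k" by auto
  show ?case
  proof (cases "nxt n K k = n")
    case True
    with step[OF less.prems] show ?thesis by simp
  next
    case False
    then have "nxt n K k \<in> K" using * by simp
    from less.hyps[OF _ this] * \<open>k < n\<close> step[OF less.prems] show ?thesis by simp
  qed
qed

text \<open>
  The rotation permutes \<open>K \<union> {n}\<close> cyclically, hence this set lies in a single component.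
\<close>

lemma rotation_path_colouring:
  assumes u: "u permutes {1..n}" and n: "1 \<le> n" and K: "rising n u K"
    and c: "(coloured_edge n c ^^ r) u (rotate_along n K u)" and k: "k \<in> K"
  shows "c k = c n"
proof (rule nxt_chain_constant[OF _ _ k])
  show Kn: "K \<subseteq> {1..<n}" using K by (simp add: rising_def)
  fix k assume k: "k \<in> K"
  obtain a where a: "rotate_along n K u k = u a" "c a = c k"
    using coloured_path_permutes_within_colour[OF c] by blast
  have "k \<noteq> n" using k Kn by auto
  with a(1) k have "u a = u (nxt n K k)" by (simp add: rotate_along_def)
  then have "a = nxt n K k" using permutes_inj[OF u] by (simp add: inj_eq)
  with a(2) show "c (nxt n K k) = c k" by simp
qed

text \<open>
  A path with \<open>r\<close> steps leaves at least \<open>n - r\<close> colours, while \<open>n - card K\<close> is the most that is possible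
  with \<open>K \<union> {n}\<close> monochromatic.
\<close>

lemma rotation_path_length:
  assumes u: "u permutes {1..n}" and n: "1 \<le> n" and K: "rising n u K"
    and r: "(bruhat_edge n ^^ r) u (rotate_along n K u)"
  shows "card K \<le> r"
proof -
  have Kn: "K \<subseteq> {1..<n}" using K by (simp add: rising_def)
  obtain c where c: "card (id ` {1..n}) \<le> card (c ` {1..n}) + r"
    "(coloured_edge n c ^^ r) u (rotate_along n K u)"
    using path_colouring[OF r, of id] by blast
  have "c ` {1..n} = c ` (insert n ({1..<n} - K)) \<union> c ` K"
    using n Kn by (subst image_Un[symmetric], intro arg_cong[where f = "image c"]) auto
  moreover have "c ` K \<subseteq> {c n}" using rotation_path_colouring[OF u n K c(2)] by auto
  ultimately have "c ` {1..n} \<subseteq> c ` (insert n ({1..<n} - K))" by auto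
  then have "card (c ` {1..n}) \<le> card (insert n ({1..<n} - K))"
    by (intro surj_card_le) auto
  also have "\<dots> = n - card K"
    using Kn n card_mono[OF _ Kn] by (simp add: card_Diff_subset finite_subset[OF Kn])
  finally show ?thesis using c(1) card_mono[OF _ Kn] by simp
qed

lemma coloured_path_inversions:
  assumes S: "finite S" and cS: "\<And>a b. a \<in> {1..n} \<Longrightarrow> b \<in> {1..n} \<Longrightarrow> a < b \<Longrightarrow> c a = c b \<Longrightarrow> a \<in> S \<and> b \<in> S"
    and p: "(coloured_edge n c ^^ r) x p"
  shows "card (inversions S x) + r \<le> card (inversions S p)"
  using p
proof (induction r arbitrary: p)
  case 0
  then show ?case by simp
next
  case (Suc r)
  then obtain w where w: "(coloured_edge n c ^^ r) x w" "coloured_edge n c w p" by auto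
  then obtain a b where ab: "1 \<le> a" "a < b" "b \<le> n" "w a < w b" "p = w \<circ> trp a b" "c a = c b"
    by (auto simp: coloured_edge_def)
  have "a \<in> S \<and> b \<in> S" by (rule cS) (use ab in auto)
  then have "card (inversions S w) < card (inversions S p)"
    unfolding ab(5) using S ab by (intro card_inversions_swap) auto
  with Suc.IH[OF w(1)] show ?case by simp
qed

lemma rotate_along_inversions:
  assumes n: "1 \<le> n" and K: "rising n u K"
  shows "inversions (insert n K) (rotate_along n K u) = K \<times> {n}"
proof -
  have Kn: "K \<subseteq> {1..<n}" using K by (simp add: rising_def)
  have mono: "u a < u b" if "a \<in> insert n K" "b \<in> insert n K" "a < b" for a b
    using K that by (auto simp: rising_def)
  have lt: "k < n" "k \<noteq> n" "0 < k" if "k \<in> K" for k using that Kn by auto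
  have 1: "rotate_along n K u n < rotate_along n K u k" if "k \<in> K" for k
  proof -
    have "nxt n K 0 \<le> k" by (rule nxt_le) (use that lt in auto)
    also have "k < nxt n K k" using nxtI[of k n K] lt that by auto
    finally show ?thesis
      using mono nxtI[of 0 n K] nxtI[of k n K] lt that n by (simp add: rotate_along_def)
  qed
  have 2: "rotate_along n K u a < rotate_along n K u b" if "a \<in> K" "b \<in> K" "a < b" for a b
  proof -
    have "nxt n K a \<le> b" by (rule nxt_le) (use that in auto)
    also have "b < nxt n K b" using nxtI[of b n K] lt that by auto
    finally show ?thesis
      using mono nxtI[of a n K] nxtI[of b n K] lt that by (simp add: rotate_along_def)
  qed
  show ?thesis
  proof (intro subset_antisym subrelI)
    fix a b assume "(a, b) \<in> inversions (insert n K) (rotate_along n K u)"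
    then have ab: "a \<in> insert n K" "b \<in> insert n K" "a < b"
      "rotate_along n K u b < rotate_along n K u a" by (simp_all add: inversions_def)
    then have aK: "a \<in> K" using lt(1)[of b] by auto
    moreover have "b \<notin> K" using 2[OF aK _ ab(3)] ab(4) by auto
    ultimately show "(a, b) \<in> K \<times> {n}" using ab(2) by simp
  next
    fix a b assume "(a, b) \<in> K \<times> {n}"
    with 1[of a] lt(1)[of a] show "(a, b) \<in> inversions (insert n K) (rotate_along n K u)"
      by (simp add: inversions_def)
  qed
qed

text \<open>
  On a path of length \<open>card K\<close> the count of colours is sharp, which forces every step to swap two
  positions of \<open>K \<union> {n}\<close>. On these positions \<open>u\<close> has no inversion and the rotation has \<open>card K\<close> of them,
  so each step adds exactly one. But as soon as the last entry is the final one, it is smaller than all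
  other entries on \<open>K\<close>, and already accounts for \<open>card K\<close> inversions: no step can be left.
\<close>

lemma rotation_geodesic_entry:
  assumes u: "u permutes {1..n}" and n: "1 \<le> n" and K: "rising n u K"
    and i: "(bruhat_edge n ^^ i) u x" and j: "(bruhat_edge n ^^ j) x (rotate_along n K u)"
    and ij: "i + j = card K" and xn: "x n = rotate_along n K u n"
  shows "x = rotate_along n K u"
proof -
  let ?p = "rotate_along n K u" and ?S = "insert n K"
  have Kn: "K \<subseteq> {1..<n}" using K by (simp add: rising_def)
  note finK = rising_finite[OF K]
  obtain c1 where c1: "card (id ` {1..n}) \<le> card (c1 ` {1..n}) + i" "(coloured_edge n c1 ^^ i) u x"
    using path_colouring[OF i, of id] by blast
  obtain c where c: "\<And>a b. c1 a = c1 b \<Longrightarrow> c a = c b"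
    "card (c1 ` {1..n}) \<le> card (c ` {1..n}) + j" "(coloured_edge n c ^^ j) x ?p"
    using path_colouring[OF j, of c1] by blast
  have ux: "(coloured_edge n c ^^ i) u x"
    by (rule relpowp_mono[OF _ c1(2)]) (rule coloured_edge_mono, assumption, rule c(1))
  have colK: "c k = c n" if "k \<in> K" for k
    by (rule rotation_path_colouring[OF u n K relpowp_trans[OF ux c(3)] that])
  have card_col: "n \<le> card (c ` {1..n}) + card K" using c1(1) c(2) ij by simp
  \<comment> \<open>Colours outside \<open>K \<union> {n}\<close> are pairwise distinct and differ from that of \<open>n\<close>: one more coincidence would leave fewer than \<open>n - card K\<close> colours.\<close>
  have outside: "c a \<noteq> c b" if a: "a \<in> {1..n}" "a \<notin> ?S" and b: "b \<in> {1..n}" "a \<noteq> b" for a b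
  proof
    assume "c a = c b"
    have "c ` {1..n} \<subseteq> c ` (insert n ({1..<n} - K - {a}))"
    proof (rule image_subsetI)
      fix x assume "x \<in> {1..n}"
      then consider "x = a" | "x \<in> ?S" | "x \<in> {1..<n} - K - {a}" by fastforce
      then show "c x \<in> c ` (insert n ({1..<n} - K - {a}))"
      proof cases
        case 1
        have "c b \<in> c ` (insert n ({1..<n} - K - {a}))"
        proof (cases "b \<in> ?S")
          case True
          then have "c b = c n" using colK by auto
          then show ?thesis by simp
        next
          case False
          then have "b \<in> {1..<n} - K - {a}" using b by auto
          then show ?thesis by blast
        qed
        with 1 \<open>c a = c b\<close> show ?thesis by simp
      next
        case 2
        then have "c x = c n" using colK by auto
        then show ?thesis by simp
      qed blast
    qed
    then have "card (c ` {1..n}) \<le> card (insert n ({1..<n} - K - {a}))"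
      by (intro surj_card_le) auto
    also have "\<dots> \<le> Suc (card ({1..<n} - K - {a}))" by (simp add: card_insert_if)
    also have "card ({1..<n} - K - {a}) < card ({1..<n} - K)"
      using a by (intro card_Diff1_less) auto
    also have "card ({1..<n} - K) = n - 1 - card K"
      using Kn by (simp add: card_Diff_subset finK)
    finally have "card (c ` {1..n}) \<le> n - 1 - card K" by simp
    moreover have "card K \<le> n - 1" using card_mono[OF _ Kn] by simp
    ultimately show False using card_col n by simp
  qed
  have cS: "a \<in> ?S \<and> b \<in> ?S" if "a \<in> {1..n}" "b \<in> {1..n}" "a < b" "c a = c b" for a b
    using outside[of a b] outside[of b a] that by fastforce
  have "card (inversions ?S x) + j \<le> card (inversions ?S ?p)"
    by (rule coloured_path_inversions[OF _ cS c(3)]) (use finK in auto)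
  also have "\<dots> = card K" by (simp add: rotate_along_inversions[OF n K] card_cartesian_product)
  finally have le: "card (inversions ?S x) + j \<le> card K" .
  have "K \<times> {n} \<subseteq> inversions ?S x"
  proof clarify
    fix k assume k: "k \<in> K"
    then have kn: "k < n" "1 \<le> k" using Kn by auto
    obtain a where a: "x k = u a" "c a = c k"
      using coloured_path_permutes_within_colour[OF ux] by blast
    have xW: "x permutes {1..n}" by (rule relpowp_bruhat_edge_permutes[OF i u])
    have "u a \<in> {1..n}" unfolding a(1)[symmetric] permutes_in_image[OF xW] using kn by simp
    then have "a \<in> {1..n}" unfolding permutes_in_image[OF u] .
    moreover have "c a = c n" using a(2) colK[OF k] by simp
    ultimately have aS: "a \<in> ?S" using outside[of a n] n by auto
    have a0: "nxt n K 0 \<le> a" by (rule nxt_le) (use aS Kn n in auto)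
    have "u (nxt n K 0) \<noteq> u a"
    proof
      assume "u (nxt n K 0) = u a"
      then have "x n = x k" using xn a(1) by (simp add: rotate_along_def)
      then show False using permutes_inj[OF xW] kn by (simp add: inj_eq)
    qed
    with a0 have "nxt n K 0 < a" by (metis le_neq_implies_less)
    then have "u (nxt n K 0) < u a"
      using K aS nxtI[of 0 n K] n unfolding rising_def by auto
    then have "x n < x k" using xn a(1) by (simp add: rotate_along_def)
    with k kn show "(k, n) \<in> inversions ?S x" by (auto simp: inversions_def)
  qed
  then have "card (K \<times> {n}) \<le> card (inversions ?S x)"
    by (intro card_mono finite_inversions) (use finK in auto)
  then have "card K \<le> card (inversions ?S x)" by (simp add: card_cartesian_product)
  with le have "j = 0" by simp
  with j show ?thesis by simp
qed

lemma bruhat_dist_rotate_along: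
  assumes "u permutes {1..n}" "1 \<le> n" "rising n u K"
  shows "bruhat_dist n u (rotate_along n K u) = card K"
  by (rule bruhat_dist_eqI) (use assms rotate_along_reachable rotation_path_length in blast)+

text \<open>
  For an arbitrary entry point, a geodesic rearranged to pass through a rotation in the same level must
  already end there.
\<close>

lemma entry_points_last:
  assumes u: "u permutes {1..n}" and n: "1 \<le> n"
  shows "entry_points n (\<lambda>x. x n) u = (\<lambda>K. rotate_along n K u) ` {K. rising n u K}"
proof (intro subset_antisym subsetI)
  fix p assume p: "p \<in> entry_points n (\<lambda>x. x n) u"
  then have "bruhat_le n u p" by (simp add: entry_points_def)
  from path_through_rotation[OF relpowp_bruhat_dist[OF this] u n] obtain K where
    K: "rising n u K" "card K \<le> bruhat_dist n u p" "rotate_along n K u n = p n"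
    "(bruhat_edge n ^^ (bruhat_dist n u p - card K)) (rotate_along n K u) p" by blast
  from entry_pointsD[OF p rotate_along_reachable[OF u n K(1)] K(4)] K(2,3)
  have "rotate_along n K u = p" by simp
  with K(1) show "p \<in> (\<lambda>K. rotate_along n K u) ` {K. rising n u K}" by blast
next
  fix p assume "p \<in> (\<lambda>K. rotate_along n K u) ` {K. rising n u K}"
  then obtain K where K: "rising n u K" "p = rotate_along n K u" by blast
  have "bruhat_le n u p"
    unfolding bruhat_le_iff_relpowp K(2) using u rotate_along_reachable[OF u n K(1)] by blast
  moreover have "x = p" if "(bruhat_edge n ^^ i) u x" "(bruhat_edge n ^^ j) x p"
    "i + j = bruhat_dist n u p" "x n = p n" for x i j
    using that unfolding K(2) bruhat_dist_rotate_along[OF u n K(1)]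
    by (rule rotation_geodesic_entry[OF u n K(1)])
  ultimately show "p \<in> entry_points n (\<lambda>x. x n) u"
    unfolding entry_points_def by blast
qed

lemma inj_on_rotate_along:
  assumes u: "u permutes {1..n}"
  shows "inj_on (\<lambda>K. rotate_along n K u) {K. rising n u K}"
proof (rule inj_on_inverseI[of _ "\<lambda>p. {x \<in> {1..<n}. p x \<noteq> u x}"], clarify)
  fix K assume "rising n u K"
  then have Kn: "K \<subseteq> {1..<n}" by (simp add: rising_def)
  have "rotate_along n K u k \<noteq> u k" if "k \<in> K" for k
  proof -
    have "k < n" using that Kn by auto
    then have "k \<noteq> n" "nxt n K k \<noteq> k" using nxtI[of k n K] by auto
    then show ?thesis using that permutes_inj[OF u] by (simp add: rotate_along_def inj_eq)
  qed
  moreover have "rotate_along n K u x = u x" if "x \<in> {1..<n}" "x \<notin> K" for x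
    using that by (simp add: rotate_along_def)
  ultimately show "{x \<in> {1..<n}. rotate_along n K u x \<noteq> u x} = K" using Kn by auto
qed

lemma entry_mset_last:
  assumes u: "u permutes {1..n}" and n: "1 \<le> n"
  shows "entry_mset n (\<lambda>x. x n) (d, u) =
    image_mset (\<lambda>K. (d + card K, rotate_along n K u)) (mset_set {K. rising n u K})"
proof -
  have fin: "finite {K. rising n u K}"
    by (rule finite_subset[of _ "Pow {1..<n}"]) (auto simp: rising_def)
  have "mset_set (entry_points n (\<lambda>x. x n) u) =
      image_mset (\<lambda>K. rotate_along n K u) (mset_set {K. rising n u K})"
    unfolding entry_points_last[OF u n] by (rule image_mset_mset_set[OF inj_on_rotate_along[OF u], symmetric])
  then show ?thesis
    using fin bruhat_dist_rotate_along[OF u n]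
    by (auto simp: entry_mset_def image_mset.compositionality o_def intro!: image_mset_cong)
qed

section \<open>Shortcuts as products of branching operators\<close>

text \<open>
  Operators on multisets of pairs (distance, permutation) that are determined by their values on
  singletons; identities between them need only be checked there.
\<close>

definition additive :: "('a multiset \<Rightarrow> 'b multiset) \<Rightarrow> bool" where
  "additive F \<longleftrightarrow> F {#} = {#} \<and> (\<forall>M N. F (M + N) = F M + F N)"

lemma additive_mbind: "additive (mbind F)"
  by (simp add: additive_def)

lemma additive_fold: "(\<And>j. additive (A j)) \<Longrightarrow> additive (fold A js)"
  by (induction js) (simp_all add: additive_def)

lemma additive_eqI:
  assumes "additive F" "additive G" "\<And>z. z \<in># M \<Longrightarrow> F {#z#} = G {#z#}"
  shows "F M = G M"
  using assms(3)
proof (induction M)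
  case empty
  then show ?case using assms(1,2) by (simp add: additive_def)
next
  case (add z M)
  have "F (add_mset z M) = F {#z#} + F M" "G (add_mset z M) = G {#z#} + G M"
    using assms(1,2) unfolding additive_def by (metis add_mset_add_single union_commute)+
  with add show ?case by simp
qed

text \<open>
  Keep every \<open>(d, x)\<close>, and add \<open>(d + 1, h x)\<close> when \<open>P x\<close> holds. Discarding what is not a permutation of
  \<open>{1..n}\<close> makes the operator identities below hold for all multisets, without side conditions on
  their elements.
\<close>

definition branch :: "nat \<Rightarrow> ((nat \<Rightarrow> nat) \<Rightarrow> bool) \<Rightarrow> ((nat \<Rightarrow> nat) \<Rightarrow> (nat \<Rightarrow> nat)) \<Rightarrow>
    (nat \<times> (nat \<Rightarrow> nat)) multiset \<Rightarrow> (nat \<times> (nat \<Rightarrow> nat)) multiset" where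
  "branch n P h = mbind (\<lambda>(d, x). if x permutes {1..n}
     then add_mset (d, x) (if P x then {#(Suc d, h x)#} else {#}) else {#})"

lemma additive_branch: "additive (branch n P h)"
  unfolding branch_def by (rule additive_mbind)

lemma branch_simps:
  "branch n P h {#} = {#}"
  "branch n P h (M + N) = branch n P h M + branch n P h N"
  "branch n P h (add_mset (d, x) M) = (if x permutes {1..n}
     then add_mset (d, x) (if P x then {#(Suc d, h x)#} else {#}) else {#}) + branch n P h M"
  unfolding branch_def by (simp_all only: mbind_simps case_prod_conv)

lemma branch_cong:
  assumes "\<And>x. x permutes {1..n} \<Longrightarrow> P x \<longleftrightarrow> Q x"
  shows "branch n P h = branch n Q h"
  unfolding branch_def using assms by (intro ext mbind_cong) auto

definition supported :: "nat \<Rightarrow> (nat \<times> (nat \<Rightarrow> nat)) multiset \<Rightarrow> bool" where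
  "supported n M \<longleftrightarrow> (\<forall>z\<in>#M. snd z permutes {1..n})"

lemma supported_branch:
  assumes "\<And>x. x permutes {1..n} \<Longrightarrow> h x permutes {1..n}"
  shows "supported n (branch n P h M)"
  unfolding supported_def branch_def set_mbind using assms by (auto split: if_splits)

text \<open>
  A separate constant, so that composites of swaps stay folded and can be normalised by
  \<open>swap_positions_relations\<close>.
\<close>

definition swap_positions :: "(nat \<Rightarrow> nat) \<Rightarrow> nat \<Rightarrow> nat \<Rightarrow> nat \<Rightarrow> nat" where
  "swap_positions x a b = x \<circ> trp a b"

lemma swap_positions_apply: "swap_positions x a b c = x (trp a b c)"
  by (simp add: swap_positions_def)

lemma swap_positions_permutes:
  assumes "x permutes {1..n}" "a \<in> {1..n}" "b \<in> {1..n}"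
  shows "swap_positions x a b permutes {1..n}"
  unfolding swap_positions_def by (rule permutes_compose[OF permutes_swap_id]) (rule assms)+

definition right_branch :: "nat \<Rightarrow> nat \<Rightarrow> nat \<Rightarrow> (nat \<times> (nat \<Rightarrow> nat)) multiset \<Rightarrow> (nat \<times> (nat \<Rightarrow> nat)) multiset" where
  "right_branch n a b = branch n (\<lambda>x. x a < x b) (\<lambda>x. swap_positions x a b)"

lemma additive_right_branch: "additive (right_branch n a b)"
  unfolding right_branch_def by (rule additive_branch)

lemma supported_right_branch: "a \<in> {1..n} \<Longrightarrow> b \<in> {1..n} \<Longrightarrow> supported n (right_branch n a b M)"
  unfolding right_branch_def by (intro supported_branch swap_positions_permutes)

lemma supported_fold:
  "supported n M \<Longrightarrow> (\<And>j M. j \<in> set js \<Longrightarrow> supported n (A j M)) \<Longrightarrow> supported n (fold A js M)"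
  by (induction js arbitrary: M) auto

lemma mbind_optional:
  "mbind (\<lambda>x. add_mset (f x) (if P x then {#g x#} else {#})) M = image_mset f M + image_mset g (filter_mset P M)"
  by (induction M) auto

text \<open>
  The rotation for \<open>K\<close> arises by taking the branch at each \<open>j \<in> K\<close> and declining it elsewhere; the guard
  \<open>u j < rotate_along n K u n\<close> is the condition for \<open>{j} \<union> K\<close> to be increasing again.
\<close>

lemma fold_right_branch_rotations:
  assumes u: "u permutes {1..n}" and j: "1 \<le> j" "j \<le> n"
  shows "fold (\<lambda>j. right_branch n j n) (rev [j..<n]) {#(d, u)#} =
    image_mset (\<lambda>K. (d + card K, rotate_along n K u)) (mset_set {K. rising n u K \<and> K \<subseteq> {j..<n}})"
  using j(2,1)
proof (induction rule: inc_induct)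
  case base
  have "{K. rising n u K \<and> K \<subseteq> {n..<n}} = {{}}" by (auto simp: rising_def)
  with base show ?case by (simp add: rotate_along_empty)
next
  case (step j)
  define S where "S = {K. rising n u K \<and> K \<subseteq> {Suc j..<n}}"
  have fin: "finite S" by (rule finite_subset[of _ "Pow {Suc j..<n}"]) (auto simp: S_def)
  have SD: "K \<subseteq> {1..<n}" "j \<notin> K" "finite K" "\<And>k. k \<in> K \<Longrightarrow> j < k" if "K \<in> S" for K
    using that by (auto simp: S_def rising_def intro: finite_subset)
  have j1: "1 \<le> j" "j < n" using step by auto
  note low = rising_insert_low[OF SD(1) j1 SD(4)] rotate_along_insert_low[OF SD(1) j1 SD(4)]
  define T where "T = {K \<in> S. u j < rotate_along n K u n}"
  have "{K. rising n u K \<and> K \<subseteq> {j..<n}} = S \<union> insert j ` T"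
  proof (intro subset_antisym subsetI)
    fix K assume K: "K \<in> {K. rising n u K \<and> K \<subseteq> {j..<n}}"
    show "K \<in> S \<union> insert j ` T"
    proof (cases "j \<in> K")
      case False
      with K have "K \<subseteq> {Suc j..<n}" by (auto simp: Suc_le_eq le_less)
      with K show ?thesis by (simp add: S_def)
    next
      case True
      define L where "L = K - {j}"
      have KL: "K = insert j L" using True by (auto simp: L_def)
      have "L \<subseteq> {Suc j..<n}" using K by (auto simp: L_def Suc_le_eq le_less)
      moreover from this have "rising n u L \<and> u j < rotate_along n L u n"
        using K KL j1 by (subst rising_insert_low[symmetric]) auto
      ultimately have "L \<in> T" by (simp add: S_def T_def)
      with KL show ?thesis by blast
    qed
  next
    fix K assume "K \<in> S \<union> insert j ` T"
    then show "K \<in> {K. rising n u K \<and> K \<subseteq> {j..<n}}"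
    proof
      assume "K \<in> insert j ` T"
      then obtain L where L: "L \<in> S" "u j < rotate_along n L u n" "K = insert j L"
        by (auto simp: T_def)
      with low(1)[OF L(1) L(1), of u] j1 show ?thesis by (auto simp: S_def)
    qed (auto simp: S_def)
  qed
  moreover have "S \<inter> insert j ` T = {}" using SD(2) by auto
  moreover have "mset_set (insert j ` T) = image_mset (insert j) (mset_set T)"
  proof (rule image_mset_mset_set[symmetric])
    show "inj_on (insert j) T"
    proof (rule inj_onI)
      fix K L assume "K \<in> T" "L \<in> T" "insert j K = insert j L"
      moreover from this have "j \<notin> K" "j \<notin> L" using SD(2) by (auto simp: T_def)
      ultimately show "K = L" by (simp add: insert_ident)
    qed
  qed
  moreover have "mset_set T = filter_mset (\<lambda>K. u j < rotate_along n K u n) (mset_set S)"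
    by (simp add: T_def filter_mset_mset_set fin)
  ultimately have eq: "mset_set {K. rising n u K \<and> K \<subseteq> {j..<n}} = mset_set S +
      image_mset (insert j) (filter_mset (\<lambda>K. u j < rotate_along n K u n) (mset_set S))"
    using fin by (simp add: mset_set_Union T_def)
  have W: "rotate_along n K u permutes {1..n}" "rotate_along n K u j = u j" if "K \<in> S" for K
  proof -
    have "rising n u K" using that by (simp add: S_def)
    moreover have "1 \<le> n" using j1 by simp
    ultimately show "rotate_along n K u permutes {1..n}"
      using relpowp_bruhat_edge_permutes[OF rotate_along_reachable[OF u] u] by blast
    show "rotate_along n K u j = u j" using SD(2)[OF that] j1 by (simp add: rotate_along_def)
  qed
  have "rev [j..<n] = rev [Suc j..<n] @ [j]" using j1 by (simp add: upt_conv_Cons)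
  then have "fold (\<lambda>j. right_branch n j n) (rev [j..<n]) {#(d, u)#} =
      right_branch n j n (image_mset (\<lambda>K. (d + card K, rotate_along n K u)) (mset_set S))"
    using step.IH j1 by (simp add: S_def)
  also have "\<dots> = mbind (\<lambda>K. add_mset (d + card K, rotate_along n K u)
      (if u j < rotate_along n K u n then {#(Suc (d + card K), swap_positions (rotate_along n K u) j n)#} else {#}))
      (mset_set S)"
    unfolding right_branch_def branch_def mbind_image
    by (rule mbind_cong) (use W fin in auto)
  also have "\<dots> = image_mset (\<lambda>K. (d + card K, rotate_along n K u)) (mset_set {K. rising n u K \<and> K \<subseteq> {j..<n}})"
    unfolding mbind_optional eq image_mset_union image_mset.compositionality
    using SD low(2) fin by (auto simp: swap_positions_def o_def intro!: image_mset_cong)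
  finally show ?case .
qed

lemma entry_mset_last_fold:
  assumes "u permutes {1..n}" "1 \<le> n"
  shows "entry_mset n (\<lambda>x. x n) (d, u) = fold (\<lambda>j. right_branch n j n) (rev [1..<n]) {#(d, u)#}"
proof -
  have "{K. rising n u K \<and> K \<subseteq> {1..<n}} = {K. rising n u K}" by (auto simp: rising_def)
  with fold_right_branch_rotations[OF assms(1), of 1] assms show ?thesis
    by (simp only: entry_mset_last)
qed

lemma fold_conjugate:
  assumes "\<And>j M. j \<in> set js \<Longrightarrow> supported n M \<Longrightarrow> B j (I M) = I (A j M)"
    and "\<And>j M. j \<in> set js \<Longrightarrow> supported n (A j M)" and "supported n M"
  shows "fold B js (I M) = I (fold A js M)"
  using assms by (induction js arbitrary: M) auto

lemma branch_conjugate: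
  assumes M: "supported n M"
    and \<sigma>: "\<And>x. x permutes {1..n} \<Longrightarrow> \<sigma> x permutes {1..n}"
    and P: "\<And>x. x permutes {1..n} \<Longrightarrow> P (\<sigma> x) \<longleftrightarrow> Q x"
    and h: "\<And>x. x permutes {1..n} \<Longrightarrow> h (\<sigma> x) = \<sigma> (k x)"
  shows "branch n P h (image_mset (map_prod id \<sigma>) M) = image_mset (map_prod id \<sigma>) (branch n Q k M)"
  unfolding branch_def mbind_image image_mbind
  by (rule mbind_cong) (use assms in \<open>auto simp: supported_def\<close>)

text \<open>
  Symmetries carry the product of operators for \<open>x n\<close> to products for the other statistics.
\<close>

lemma entry_mset_conjugate_fold:
  assumes s: "bruhat_symmetry n \<sigma>" and u: "u permutes {1..n}" and n: "1 \<le> n"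
    and B: "\<And>j M. j \<in> {1..<n} \<Longrightarrow> supported n M \<Longrightarrow>
      B j (image_mset (map_prod id \<sigma>) M) = image_mset (map_prod id \<sigma>) (right_branch n j n M)"
  shows "entry_mset n (\<lambda>x. \<sigma> x n) (d, u) = fold B (rev [1..<n]) {#(d, u)#}"
proof -
  note D = bruhat_symmetryD[OF s]
  have "entry_mset n (\<lambda>x. \<sigma> x n) (d, u) =
      image_mset (map_prod id \<sigma>) (fold (\<lambda>j. right_branch n j n) (rev [1..<n]) {#(d, \<sigma> u)#})"
    using entry_mset_symmetry[OF s u, of "\<lambda>x. x n" d] entry_mset_last_fold[OF D(1)[OF u] n, of d]
    by (simp only:)
  also have "\<dots> = fold B (rev [1..<n]) (image_mset (map_prod id \<sigma>) {#(d, \<sigma> u)#})"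
  proof (rule fold_conjugate[symmetric, where n = n])
    show "supported n {#(d, \<sigma> u)#}" using D(1)[OF u] by (simp add: supported_def)
    show "supported n (right_branch n j n M)" if "j \<in> set (rev [1..<n])" for j M
      by (rule supported_right_branch) (use that in auto)
    show "B j (image_mset (map_prod id \<sigma>) M) = image_mset (map_prod id \<sigma>) (right_branch n j n M)"
      if "j \<in> set (rev [1..<n])" "supported n M" for j M
      by (rule B) (use that in auto)
  qed
  finally show ?thesis using D(2)[OF u] by simp
qed

lemma entry_mset_first_fold:
  assumes u: "u permutes {1..n}" and n: "1 \<le> n"
  shows "entry_mset n (\<lambda>x. rot180 n x n) (d, u) = fold (\<lambda>j. right_branch n 1 j) [2..<Suc n] {#(d, u)#}"
proof -
  have fn: "flip n n = 1" and f1: "flip n 1 = n" using n by (simp_all add: flip_def)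
  have "map (flip n) (rev [1..<n]) = [2..<Suc n]"
    by (rule nth_equalityI) (auto simp: flip_def rev_nth simp del: upt_Suc)
  then have "fold (\<lambda>j. right_branch n 1 j) [2..<Suc n] = fold (\<lambda>j. right_branch n 1 (flip n j)) (rev [1..<n])"
    using fold_map[of "\<lambda>j. right_branch n 1 j" "flip n" "rev [1..<n]"] by (simp only: o_def)
  moreover have "entry_mset n (\<lambda>x. rot180 n x n) (d, u) =
      fold (\<lambda>j. right_branch n 1 (flip n j)) (rev [1..<n]) {#(d, u)#}"
  proof (rule entry_mset_conjugate_fold[OF bruhat_symmetry_rot180 u n])
    fix j M assume j: "j \<in> {1..<n}" and M: "supported n M"
    show "right_branch n 1 (flip n j) (image_mset (map_prod id (rot180 n)) M) =
        image_mset (map_prod id (rot180 n)) (right_branch n j n M)"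
      unfolding right_branch_def
    proof (rule branch_conjugate[OF M rot180_permutes])
      fix x assume x: "x permutes {1..n}"
      have "x n \<in> {1..n}" "x j \<in> {1..n}" unfolding permutes_in_image[OF x] using j by auto
      then show "rot180 n x 1 < rot180 n x (flip n j) \<longleftrightarrow> x j < x n"
        by (simp add: rot180_def f1 flip_less_iff del: One_nat_def)
      show "swap_positions (rot180 n x) 1 (flip n j) = rot180 n (swap_positions x j n)"
        by (simp only: swap_positions_def rot180_comp rot180_transpose fn transpose_commute)
    qed
  qed
  ultimately show ?thesis by simp
qed

definition left_branch :: "nat \<Rightarrow> nat \<Rightarrow> nat \<Rightarrow> (nat \<times> (nat \<Rightarrow> nat)) multiset \<Rightarrow> (nat \<times> (nat \<Rightarrow> nat)) multiset" where
  "left_branch n a b = branch n (\<lambda>x. inv' x a < inv' x b) (\<lambda>x. trp a b \<circ> x)"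

lemma entry_mset_value_fold:
  assumes u: "u permutes {1..n}" and n: "1 \<le> n"
  shows "entry_mset n (\<lambda>x. inv' x n) (d, u) = fold (\<lambda>j. left_branch n j n) (rev [1..<n]) {#(d, u)#}"
proof (rule entry_mset_conjugate_fold[OF bruhat_symmetry_inv u n])
  fix j M assume j: "j \<in> {1..<n}" and M: "supported n M"
  show "left_branch n j n (image_mset (map_prod id inv') M) = image_mset (map_prod id inv') (right_branch n j n M)"
    unfolding right_branch_def left_branch_def
  proof (rule branch_conjugate[OF M permutes_inv])
    fix x assume x: "x permutes {1..n}"
    show "inv' (inv' x) j < inv' (inv' x) n \<longleftrightarrow> x j < x n"
      by (simp add: permutes_inv_inv[OF x])
    show "trp j n \<circ> inv' x = inv' (swap_positions x j n)"
      by (simp add: swap_positions_def o_inv_distrib permutes_bij[OF x])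
  qed
qed

lemma mbind_entry_mset_fold:
  assumes "\<And>d u. u permutes {1..n} \<Longrightarrow> entry_mset n f (d, u) = fold A js {#(d, u)#}"
    and "\<And>j. additive (A j)" and "supported n M"
  shows "mbind (entry_mset n f) M = fold A js M"
  by (rule additive_eqI[OF additive_mbind additive_fold])
     (use assms in \<open>auto simp: supported_def\<close>)

lemma fold_commute_fold:
  assumes "\<And>i j M. i \<in> set is \<Longrightarrow> j \<in> set js \<Longrightarrow> a i (b j M) = b j (a i M)"
  shows "fold a is (fold b js M) = fold b js (fold a is M)"
proof -
  have 1: "a i (fold b js M) = fold b js (a i M)" if "i \<in> set is" for i M
    using assms[OF that] by (induction js arbitrary: M) auto
  show ?thesis using 1 by (induction "is" arbitrary: M) auto
qed

text \<open>
  The passage between two reflection orders with the same initial section: once the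
  smaller indices have been treated by induction, \<open>a\<^sub>m\<close> and \<open>b\<^sub>m\<close> for the last index \<open>m\<close> move inwards past the
  other operators until they enclose \<open>c\<close>, and this block is reversed.
\<close>

lemma fold_reverse_order:
  assumes "distinct js"
    and braid: "\<And>j M. j \<in> set js \<Longrightarrow> b j (c (a j M)) = a j (c (b j M))"
    and comm: "\<And>i j M. i \<in> set js \<Longrightarrow> j \<in> set js \<Longrightarrow> i \<noteq> j \<Longrightarrow> a i (b j M) = b j (a i M)"
  shows "fold b js (c (fold a (rev js) M)) = fold a (rev js) (c (fold b js M))"
  using assms
proof (induction js arbitrary: M rule: rev_induct)
  case Nil
  then show ?case by simp
next
  case (snoc m js)
  have 1: "a m (fold b js M) = fold b js (a m M)" for M
  proof -
    have "fold a [m] (fold b js M) = fold b js (fold a [m] M)"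
    proof (rule fold_commute_fold)
      fix i j M assume "i \<in> set [m]" "j \<in> set js"
      with snoc.prems(1) show "a i (b j M) = b j (a i M)" by (intro snoc.prems(3)) auto
    qed
    then show ?thesis by simp
  qed
  have 2: "b m (fold a (rev js) M) = fold a (rev js) (b m M)" for M
  proof -
    have "fold a (rev js) (fold b [m] M) = fold b [m] (fold a (rev js) M)"
    proof (rule fold_commute_fold)
      fix i j M assume "i \<in> set (rev js)" "j \<in> set [m]"
      with snoc.prems(1) show "a i (b j M) = b j (a i M)" by (intro snoc.prems(3)) auto
    qed
    then show ?thesis by simp
  qed
  have "fold b (js @ [m]) (c (fold a (rev (js @ [m])) M)) =
      b m (fold b js (c (fold a (rev js) (a m M))))" by simp
  also have "\<dots> = b m (fold a (rev js) (c (fold b js (a m M))))"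
    using snoc.IH snoc.prems by simp
  also have "\<dots> = fold a (rev js) (b m (c (a m (fold b js M))))"
    by (simp add: 1 2)
  also have "\<dots> = fold a (rev js) (a m (c (b m (fold b js M))))"
    using snoc.prems(2)[of m] by simp
  also have "\<dots> = fold a (rev (js @ [m])) (c (fold b (js @ [m]) M))"
    using 2 by (simp add: snoc.prems)
  finally show ?case .
qed

section \<open>The last and the first entry\<close>

lemma additive_comp_intros:
  "additive (\<lambda>M. M)"
  "additive G \<Longrightarrow> additive (\<lambda>M. branch n P h (G M))"
  "additive G \<Longrightarrow> additive (\<lambda>M. filter_mset R (G M))"
  using additive_branch[of n P h] by (simp_all add: additive_def)

text \<open>
  Rewrite rules bringing the products of two transpositions of \<open>{a, b, c}\<close> to a normal form.
\<close>

lemma swap_positions_relations: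
  assumes "a \<noteq> b" "b \<noteq> c" "a \<noteq> c"
  shows "swap_positions (swap_positions x b c) a c = swap_positions (swap_positions x a c) a b"
    and "swap_positions (swap_positions x a b) b c = swap_positions (swap_positions x a c) a b"
    and "swap_positions (swap_positions x b c) a b = swap_positions (swap_positions x a c) b c"
    and "swap_positions (swap_positions x a b) a c = swap_positions (swap_positions x a c) b c"
    and "swap_positions (swap_positions x a b) a b = x" "swap_positions (swap_positions x b c) b c = x"
  using assms by (auto simp: swap_positions_def fun_eq_iff Transposition.transpose_def)

text \<open>
  Both sides enumerate the increasing paths in a dihedral group of order six for the two reflection
  orders. Only the relative order of the three entries matters, which leaves six cases.
\<close>

lemma right_branch_braid:
  assumes "a \<in> {1..n}" "b \<in> {1..n}" "c \<in> {1..n}" "a \<noteq> b" "b \<noteq> c" "a \<noteq> c"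
  shows "right_branch n a b (right_branch n a c (right_branch n b c M)) = right_branch n b c (right_branch n a c (right_branch n a b M))"
proof (rule additive_eqI[of "\<lambda>M. right_branch n a b (right_branch n a c (right_branch n b c M))"
      "\<lambda>M. right_branch n b c (right_branch n a c (right_branch n a b M))"])
  fix z :: "nat \<times> (nat \<Rightarrow> nat)"
  obtain d x where z: "z = (d, x)" by (cases z)
  have W: "swap_positions y i j permutes {1..n}" if "y permutes {1..n}" "i \<in> {a, b, c}" "j \<in> {a, b, c}" for y i j
    using that assms by (intro swap_positions_permutes) auto
  show "right_branch n a b (right_branch n a c (right_branch n b c {#z#})) = right_branch n b c (right_branch n a c (right_branch n a b {#z#}))"
  proof (cases "x permutes {1..n}")
    case False
    then show ?thesis unfolding z right_branch_def by (simp add: branch_simps)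
  next
    case True
    have ne: "x a \<noteq> x b" "x b \<noteq> x c" "x a \<noteq> x c"
      using assms permutes_inj[OF True] by (simp_all add: inj_eq)
    note r = swap_positions_relations[OF assms(4-6)]
    have t: "swap_positions y a b a = y b" "swap_positions y a b b = y a" "swap_positions y a b c = y c"
      "swap_positions y a c a = y c" "swap_positions y a c c = y a" "swap_positions y a c b = y b"
      "swap_positions y b c b = y c" "swap_positions y b c c = y b" "swap_positions y b c a = y a" for y
      using assms(4-6) by (simp_all add: swap_positions_apply)
    have step: "right_branch n i j (add_mset (e, y) M) =
        (if y i < y j then add_mset (e, y) (add_mset (Suc e, swap_positions y i j) (right_branch n i j M))
         else add_mset (e, y) (right_branch n i j M))" if "y permutes {1..n}" for e y i j M
      unfolding right_branch_def using that by (simp add: branch_simps)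
    have zero: "right_branch n i j {#} = {#}" for i j by (simp add: right_branch_def branch_simps)
    \<comment> \<open>The guards of all branches depend on these three comparisons only.\<close>
    define A B C where "A = (x a < x b)" and "B = (x b < x c)" and "C = (x a < x c)"
    have cmp: "x a < x b \<longleftrightarrow> A" "x b < x a \<longleftrightarrow> \<not> A" "x b < x c \<longleftrightarrow> B" "x c < x b \<longleftrightarrow> \<not> B"
      "x a < x c \<longleftrightarrow> C" "x c < x a \<longleftrightarrow> \<not> C"
      using ne by (auto simp: A_def B_def C_def)
    have "A \<Longrightarrow> B \<Longrightarrow> C" "\<not> A \<Longrightarrow> \<not> B \<Longrightarrow> \<not> C"
      using ne unfolding A_def B_def C_def by linarith+
    then show ?thesis
      unfolding z
      by (cases A; cases B; cases C)
         (simp_all add: step zero W True t r cmp add_mset_commute del: One_nat_def)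
  qed
qed (unfold right_branch_def, (intro additive_comp_intros)+)

lemma branch_commute:
  assumes W: "\<And>x. x permutes {1..n} \<Longrightarrow> h x permutes {1..n}" "\<And>x. x permutes {1..n} \<Longrightarrow> k x permutes {1..n}"
    and P: "\<And>x. x permutes {1..n} \<Longrightarrow> P (k x) \<longleftrightarrow> P x" and Q: "\<And>x. x permutes {1..n} \<Longrightarrow> Q (h x) \<longleftrightarrow> Q x"
    and hk: "\<And>x. x permutes {1..n} \<Longrightarrow> h (k x) = k (h x)"
  shows "branch n P h (branch n Q k M) = branch n Q k (branch n P h M)"
proof (rule additive_eqI[of "\<lambda>M. branch n P h (branch n Q k M)" "\<lambda>M. branch n Q k (branch n P h M)"])
  fix z :: "nat \<times> (nat \<Rightarrow> nat)"
  obtain d x where z: "z = (d, x)" by (cases z)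
  show "branch n P h (branch n Q k {#z#}) = branch n Q k (branch n P h {#z#})"
    using W P Q hk by (cases "x permutes {1..n}") (simp_all add: z branch_simps)
qed (intro additive_comp_intros)+

lemma right_branch_commute:
  assumes "{a, b, c, d} \<subseteq> {1..n}" "a \<noteq> c" "a \<noteq> d" "b \<noteq> c" "b \<noteq> d"
  shows "right_branch n a b (right_branch n c d M) = right_branch n c d (right_branch n a b M)"
  unfolding right_branch_def
proof (rule branch_commute)
  fix x
  show "swap_positions (swap_positions x c d) a b = swap_positions (swap_positions x a b) c d"
    using assms by (auto simp: swap_positions_def fun_eq_iff Transposition.transpose_def)
qed (use assms in \<open>auto simp: swap_positions_apply intro!: swap_positions_permutes simp del: One_nat_def\<close>)

lemma filter_branch_commute:
  assumes "\<And>x. x permutes {1..n} \<Longrightarrow> R (h x) \<longleftrightarrow> R x"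
  shows "filter_mset (\<lambda>(d, x). R x) (branch n P h M) = branch n P h (filter_mset (\<lambda>(d, x). R x) M)"
proof (rule additive_eqI[of "\<lambda>M. filter_mset (\<lambda>(d, x). R x) (branch n P h M)"
      "\<lambda>M. branch n P h (filter_mset (\<lambda>(d, x). R x) M)"])
  fix z :: "nat \<times> (nat \<Rightarrow> nat)"
  obtain d x where z: "z = (d, x)" by (cases z)
  show "filter_mset (\<lambda>(d, x). R x) (branch n P h {#z#}) = branch n P h (filter_mset (\<lambda>(d, x). R x) {#z#})"
    using assms by (cases "x permutes {1..n}") (simp_all add: z branch_simps)
qed (intro additive_comp_intros)+

text \<open>
  A branch that always leaves the level \<open>R\<close> is invisible between two filters for \<open>R\<close>. It is applied to the
  swap of positions \<open>1\<close> and \<open>n\<close>, which occurs in both products but cannot be used in the one applied second.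
\<close>

lemma filter_branch_absorb:
  assumes "supported n M" "\<And>x. x permutes {1..n} \<Longrightarrow> R x \<Longrightarrow> \<not> R (h x)"
  shows "filter_mset (\<lambda>(d, x). R x) (branch n P h (filter_mset (\<lambda>(d, x). R x) M)) =
    filter_mset (\<lambda>(d, x). R x) M"
proof (rule additive_eqI[of "\<lambda>M. filter_mset (\<lambda>(d, x). R x) (branch n P h (filter_mset (\<lambda>(d, x). R x) M))"
      "\<lambda>M. filter_mset (\<lambda>(d, x). R x) M"])
  fix z :: "nat \<times> (nat \<Rightarrow> nat)" assume "z \<in># M"
  then obtain d x where z: "z = (d, x)" "x permutes {1..n}"
    using assms(1) by (cases z) (auto simp: supported_def)
  then show "filter_mset (\<lambda>(d, x). R x) (branch n P h (filter_mset (\<lambda>(d, x). R x) {#z#})) =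
      filter_mset (\<lambda>(d, x). R x) {#z#}"
    using assms(2) by (simp add: branch_simps)
qed (intro additive_comp_intros)+

lemma filter_fold_commute:
  assumes "\<And>j M. j \<in> set js \<Longrightarrow> filter_mset R (A j M) = B j (filter_mset R M)"
  shows "filter_mset R (fold A js M) = fold B js (filter_mset R M)"
  using assms by (induction js arbitrary: M) auto

lemma filter_mset_absorb:
  assumes "\<And>z. P z \<Longrightarrow> R z"
  shows "filter_mset P (filter_mset R M) = filter_mset P M"
  unfolding filter_filter_mset using assms by (intro filter_mset_cong) auto

lemma supported_filter: "supported n M \<Longrightarrow> supported n (filter_mset P M)"
  by (auto simp: supported_def)

text \<open>
  Both sides equal the endpoints of a product over all swaps involving position \<open>1\<close> or \<open>n\<close>, with the swap
  of \<open>1\<close> and \<open>n\<close> in the middle; \<open>fold_reverse_order\<close> compares the two products.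
\<close>

lemma double_entry_mset_first_last_commute:
  assumes n: "n \<ge> 2" and u: "u permutes {1..n}" and v: "v permutes {1..n}"
  shows "double_entry_mset n (\<lambda>x. x n) (\<lambda>x. rot180 n x n) u v = double_entry_mset n (\<lambda>x. rot180 n x n) (\<lambda>x. x n) u v"
proof -
  let ?js = "[2..<n]"
  let ?a = "\<lambda>j. right_branch n j n" and ?b = "\<lambda>j. right_branch n 1 j" and ?c = "right_branch n 1 n"
  let ?U = "{#(0, u)#} :: (nat \<times> (nat \<Rightarrow> nat)) multiset"
  let ?F = "filter_mset (\<lambda>(d :: nat, x). x n = v n)"
  let ?G = "filter_mset (\<lambda>(d :: nat, x). rot180 n x n = rot180 n v n)"
  let ?Q = "filter_mset (\<lambda>(d :: nat, b). bruhat_le n b v \<and> b n = v n \<and> rot180 n b n = rot180 n v n)"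
  let ?Q' = "filter_mset (\<lambda>(d :: nat, b). bruhat_le n b v \<and> rot180 n b n = rot180 n v n \<and> b n = v n)"
  have U: "supported n ?U" using u by (simp add: supported_def)
  have js: "2 \<le> j \<and> j < n" if "j \<in> set ?js" for j using that by simp
  have sa: "supported n (?a j M)" and sb: "supported n (?b j M)" if "j \<in> set ?js" for j M
    using js[OF that] by (simp_all add: supported_right_branch)
  have sc: "supported n (?c M)" for M using n by (simp add: supported_right_branch)
  have rev: "rev [1..<n] = rev ?js @ [1]" using n by (simp add: upt_conv_Cons numeral_2_eq_2)
  have upt: "[2..<Suc n] = ?js @ [n]" using n by simp
  have first: "rot180 n x n = rot180 n v n \<longleftrightarrow> x 1 = v 1" if "x permutes {1..n}" for x
    by (rule rot180_last_eq_iff) (use n that v in auto)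
  have Na: "mbind (entry_mset n (\<lambda>x. x n)) M = ?c (fold ?a (rev ?js) M)" if "supported n M" for M
  proof -
    have "mbind (entry_mset n (\<lambda>x. x n)) M = fold ?a (rev [1..<n]) M"
      by (rule mbind_entry_mset_fold[OF entry_mset_last_fold additive_right_branch that]) (use n in auto)
    then show ?thesis by (simp add: rev del: One_nat_def)
  qed
  have Nb: "mbind (entry_mset n (\<lambda>x. rot180 n x n)) M = ?c (fold ?b ?js M)" if "supported n M" for M
  proof -
    have "mbind (entry_mset n (\<lambda>x. rot180 n x n)) M = fold ?b [2..<Suc n] M"
      by (rule mbind_entry_mset_fold[OF entry_mset_first_fold additive_right_branch that]) (use n in auto)
    then show ?thesis by (simp only: upt fold_append fold.simps o_apply id_apply)
  qed
  have Fb: "?F (fold ?b ?js M) = fold ?b ?js (?F M)" for M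
  proof (rule filter_fold_commute)
    fix j M assume "j \<in> set ?js"
    from js[OF this] show "?F (?b j M) = ?b j (?F M)"
      unfolding right_branch_def by (intro filter_branch_commute) (simp add: swap_positions_apply)
  qed
  have Ga: "?G (fold ?a (rev ?js) M) = fold ?a (rev ?js) (?G M)" for M
  proof (rule filter_fold_commute)
    fix j M assume "j \<in> set (rev ?js)"
    then have j: "2 \<le> j \<and> j < n" by simp
    then show "?G (?a j M) = ?a j (?G M)"
      unfolding right_branch_def
    proof (intro filter_branch_commute)
      fix x assume x: "x permutes {1..n}"
      have "swap_positions x j n permutes {1..n}" by (rule swap_positions_permutes[OF x]) (use j in auto)
      then show "rot180 n (swap_positions x j n) n = rot180 n v n \<longleftrightarrow> rot180 n x n = rot180 n v n"
        using j by (simp add: first x swap_positions_apply del: One_nat_def)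
    qed
  qed
  have Fc: "?F (?c (?F M)) = ?F M" if "supported n M" for M
    unfolding right_branch_def
  proof (rule filter_branch_absorb[OF that])
    fix x assume x: "x permutes {1..n}" "x n = v n"
    have "x 1 \<noteq> x n" using n permutes_inj[OF x(1)] by (simp add: inj_eq)
    with x show "swap_positions x 1 n n \<noteq> v n" by (simp add: swap_positions_apply)
  qed
  have Gc: "?G (?c (?G M)) = ?G M" if "supported n M" for M
    unfolding right_branch_def
  proof (rule filter_branch_absorb[OF that])
    fix x assume x: "x permutes {1..n}" "rot180 n x n = rot180 n v n"
    have "x 1 \<noteq> x n" using n permutes_inj[OF x(1)] by (simp add: inj_eq)
    moreover have "swap_positions x 1 n permutes {1..n}" by (rule swap_positions_permutes[OF x(1)]) (use n in auto)
    ultimately show "rot180 n (swap_positions x 1 n) n \<noteq> rot180 n v n"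
      using x by (simp add: first swap_positions_apply del: One_nat_def)
  qed
  have entry: "entry_mset n f (0, u) = mbind (entry_mset n f) ?U" for f :: "(nat \<Rightarrow> nat) \<Rightarrow> nat"
    by simp
  have sup_a: "supported n (fold ?a (rev ?js) M)" if "supported n M" for M
    using that sa by (intro supported_fold) auto
  have sup_b: "supported n (fold ?b ?js M)" if "supported n M" for M
    using that sb by (intro supported_fold) auto
  have "double_entry_mset n (\<lambda>x. x n) (\<lambda>x. rot180 n x n) u v =
      ?Q (?c (fold ?b ?js (?F (?c (fold ?a (rev ?js) ?U)))))"
    unfolding double_entry_mset_def entry Na[OF U] Nb[OF supported_filter[OF sc]] ..
  also have "\<dots> = ?Q (?F (?c (?F (fold ?b ?js (?c (fold ?a (rev ?js) ?U))))))"
    unfolding Fb[symmetric] by (rule filter_mset_absorb[symmetric]) auto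
  also have "\<dots> = ?Q (fold ?b ?js (?c (fold ?a (rev ?js) ?U)))"
    unfolding Fc[OF sup_b[OF sc]] by (rule filter_mset_absorb) auto
  also have "fold ?b ?js (?c (fold ?a (rev ?js) ?U)) = fold ?a (rev ?js) (?c (fold ?b ?js ?U))"
  proof (rule fold_reverse_order)
    show "distinct ?js" by simp
    show "?b j (?c (?a j M)) = ?a j (?c (?b j M))" if "j \<in> set ?js" for j M
      by (rule right_branch_braid) (use js[OF that] in auto)
    show "?a i (?b j M) = ?b j (?a i M)" if "i \<in> set ?js" "j \<in> set ?js" "i \<noteq> j" for i j M
      by (rule right_branch_commute) (use js[OF that(1)] js[OF that(2)] that(3) in auto)
  qed
  also have "?Q (fold ?a (rev ?js) (?c (fold ?b ?js ?U))) = ?Q' (fold ?a (rev ?js) (?c (fold ?b ?js ?U)))"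
    by (rule filter_mset_cong) auto
  also have "\<dots> = ?Q' (?G (?c (?G (fold ?a (rev ?js) (?c (fold ?b ?js ?U))))))"
    unfolding Gc[OF sup_a[OF sc]] by (rule filter_mset_absorb[symmetric]) auto
  also have "\<dots> = ?Q' (?c (fold ?a (rev ?js) (?G (?c (fold ?b ?js ?U)))))"
    unfolding Ga by (rule filter_mset_absorb) auto
  also have "\<dots> = double_entry_mset n (\<lambda>x. rot180 n x n) (\<lambda>x. x n) u v"
    unfolding double_entry_mset_def entry Nb[OF U] Na[OF supported_filter[OF sc]] ..
  finally show ?thesis .
qed

section \<open>The last entry and the position of the largest value\<close>

text \<open>
  The linear order in which \<open>n\<close> is moved down to the place just below \<open>a\<close>. On \<open>{1..n}\<close> the usual order is
  \<open>a = n\<close>, and \<open>a = 1\<close> makes \<open>n\<close> the least element.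
\<close>

definition below :: "nat \<Rightarrow> nat \<Rightarrow> nat \<Rightarrow> nat \<Rightarrow> bool" where
  "below n a p q \<longleftrightarrow> (if p = n then q \<noteq> n \<and> a \<le> q else if q = n then p < a else p < q)"

lemma below_top: "p \<le> n \<Longrightarrow> q \<le> n \<Longrightarrow> below n n p q \<longleftrightarrow> p < q"
  by (auto simp: below_def)

text \<open>
  Swapping \<open>j\<close> and \<open>n\<close> is an isomorphism between the orders for \<open>j + 1\<close> and \<open>j\<close>, in which \<open>j\<close> and \<open>n\<close> are
  neighbours; away from this pair the two orders coincide.
\<close>

lemma below_transpose:
  assumes "j < n" "p \<noteq> q"
  shows "below n j (trp j n p) (trp j n q) \<longleftrightarrow> below n (Suc j) p q"
  using assms by (auto simp: below_def Transposition.transpose_def)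

lemma below_shift:
  assumes "j < n" "p \<noteq> q" "{p, q} \<noteq> {j, n}"
  shows "below n j p q \<longleftrightarrow> below n (Suc j) p q"
  using assms by (auto simp: below_def doubleton_eq_iff)

definition left_branch_at :: "nat \<Rightarrow> nat \<Rightarrow> nat \<Rightarrow> (nat \<times> (nat \<Rightarrow> nat)) multiset \<Rightarrow> (nat \<times> (nat \<Rightarrow> nat)) multiset" where
  "left_branch_at n a i = branch n (\<lambda>x. below n a (inv' x i) (inv' x n)) (\<lambda>x. trp i n \<circ> x)"

definition right_branch_at :: "nat \<Rightarrow> nat \<Rightarrow> nat \<Rightarrow> (nat \<times> (nat \<Rightarrow> nat)) multiset \<Rightarrow> (nat \<times> (nat \<Rightarrow> nat)) multiset" where
  "right_branch_at n b j = branch n (\<lambda>x. below n b (x j) (x n)) (\<lambda>x. x \<circ> trp j n)"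

lemma left_branch_at_top: "i \<in> {1..<n} \<Longrightarrow> left_branch_at n n i = left_branch n i n"
  unfolding left_branch_at_def left_branch_def
proof (rule branch_cong)
  fix x assume i: "i \<in> {1..<n}" and x: "x permutes {1..n}"
  have "inv' x i \<in> {1..n}" "inv' x n \<in> {1..n}"
    unfolding permutes_in_image[OF permutes_inv[OF x]] using i by auto
  then show "below n n (inv' x i) (inv' x n) \<longleftrightarrow> inv' x i < inv' x n" by (simp add: below_top)
qed

lemma right_branch_at_top: "j \<in> {1..<n} \<Longrightarrow> right_branch_at n n j = right_branch n j n"
  unfolding right_branch_at_def right_branch_def swap_positions_def
proof (rule branch_cong)
  fix x assume j: "j \<in> {1..<n}" and x: "x permutes {1..n}"
  have "x j \<in> {1..n}" "x n \<in> {1..n}" unfolding permutes_in_image[OF x] using j by auto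
  then show "below n n (x j) (x n) \<longleftrightarrow> x j < x n" by (simp add: below_top)
qed

text \<open>
  Up to the shift of the order from \<open>j + 1\<close> to \<open>j\<close>, or from \<open>i + 1\<close> to \<open>i\<close>, the guard of each swap is
  unaffected by the other swap. When swapping the values \<open>i, n\<close> and swapping the positions \<open>j, n\<close> lead to
  different elements, the shift makes no difference. When they coincide, the shift is visible on both
  sides and has the same total effect.
\<close>

lemma left_branch_at_right_branch_at:
  assumes i: "i \<in> {1..<n}" and j: "j \<in> {1..<n}"
  shows "left_branch_at n j i (right_branch_at n (Suc i) j M) = right_branch_at n i j (left_branch_at n (Suc j) i M)"
proof (rule additive_eqI[of "\<lambda>M. left_branch_at n j i (right_branch_at n (Suc i) j M)"
      "\<lambda>M. right_branch_at n i j (left_branch_at n (Suc j) i M)"])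
  fix z :: "nat \<times> (nat \<Rightarrow> nat)"
  obtain d x where z: "z = (d, x)" by (cases z)
  show "left_branch_at n j i (right_branch_at n (Suc i) j {#z#}) = right_branch_at n i j (left_branch_at n (Suc j) i {#z#})"
  proof (cases "x permutes {1..n}")
    case False
    then show ?thesis by (simp add: z left_branch_at_def right_branch_at_def branch_simps)
  next
    case x: True
    define y where "y = x \<circ> trp j n"
    define w where "w = trp i n \<circ> x"
    define t where "t = trp i n \<circ> x \<circ> trp j n"
    have yW: "y permutes {1..n}" unfolding y_def
      by (rule permutes_compose[OF permutes_swap_id x]) (use j in auto)
    have wW: "w permutes {1..n}" unfolding w_def
      by (rule permutes_compose[OF x permutes_swap_id]) (use i in auto)
    have inv_y: "inv' y p = trp j n (inv' x p)" for p
      using o_inv_distrib[OF permutes_bij[OF x] bij_transpose, of j n] by (simp add: y_def)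
    have ne: "inv' x i \<noteq> inv' x n" "x j \<noteq> x n"
      using i j permutes_inj[OF x] permutes_inj[OF permutes_inv[OF x]] by (simp_all add: inj_eq)
    have L: "left_branch_at n j i (right_branch_at n (Suc i) j {#z#}) =
        {#(d, x)#} + (if below n j (inv' x i) (inv' x n) then {#(Suc d, w)#} else {#}) +
        (if below n (Suc i) (x j) (x n) then {#(Suc d, y)#} +
          (if below n (Suc j) (inv' x i) (inv' x n) then {#(Suc (Suc d), t)#} else {#}) else {#})"
    proof -
      have y: "below n j (inv' y i) (inv' y n) \<longleftrightarrow> below n (Suc j) (inv' x i) (inv' x n)"
        unfolding inv_y by (rule below_transpose) (use j ne in auto)
      have 1: "right_branch_at n (Suc i) j {#z#} = {#(d, x)#} +
          (if below n (Suc i) (x j) (x n) then {#(Suc d, y)#} else {#})"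
        unfolding z right_branch_at_def y_def using x by (simp add: branch_simps)
      have 2: "left_branch_at n j i {#(e, y)#} = {#(e, y)#} +
          (if below n (Suc j) (inv' x i) (inv' x n) then {#(Suc e, t)#} else {#})" for e
        unfolding left_branch_at_def using yW
        by (simp add: branch_simps y) (simp add: y_def t_def o_assoc)
      have 3: "left_branch_at n j i {#(e, x)#} = {#(e, x)#} +
          (if below n j (inv' x i) (inv' x n) then {#(Suc e, w)#} else {#})" for e
        unfolding left_branch_at_def w_def using x by (simp add: branch_simps)
      have add: "left_branch_at n j i (M + N) = left_branch_at n j i M + left_branch_at n j i N" 
        and zero: "left_branch_at n j i {#} = {#}" for M N
        unfolding left_branch_at_def by (simp_all only: branch_simps)
      show ?thesis unfolding 1 add 3 by (simp only: if_distrib[of "left_branch_at n j i"] 2 zero)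
    qed
    have R: "right_branch_at n i j (left_branch_at n (Suc j) i {#z#}) =
        {#(d, x)#} + (if below n i (x j) (x n) then {#(Suc d, y)#} else {#}) +
        (if below n (Suc j) (inv' x i) (inv' x n) then {#(Suc d, w)#} +
          (if below n (Suc i) (x j) (x n) then {#(Suc (Suc d), t)#} else {#}) else {#})"
    proof -
      have w: "below n i (w j) (w n) \<longleftrightarrow> below n (Suc i) (x j) (x n)"
        unfolding w_def o_apply by (rule below_transpose) (use i ne in auto)
      have 1: "left_branch_at n (Suc j) i {#z#} = {#(d, x)#} +
          (if below n (Suc j) (inv' x i) (inv' x n) then {#(Suc d, w)#} else {#})"
        unfolding z left_branch_at_def w_def using x by (simp add: branch_simps)
      have 2: "right_branch_at n i j {#(e, w)#} = {#(e, w)#} +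
          (if below n (Suc i) (x j) (x n) then {#(Suc e, t)#} else {#})" for e
        unfolding right_branch_at_def using wW
        by (simp add: branch_simps w) (simp add: w_def t_def o_assoc)
      have 3: "right_branch_at n i j {#(e, x)#} = {#(e, x)#} +
          (if below n i (x j) (x n) then {#(Suc e, y)#} else {#})" for e
        unfolding right_branch_at_def y_def using x by (simp add: branch_simps)
      have add: "right_branch_at n i j (M + N) = right_branch_at n i j M + right_branch_at n i j N" 
        and zero: "right_branch_at n i j {#} = {#}" for M N
        unfolding right_branch_at_def by (simp_all only: branch_simps)
      show ?thesis unfolding 1 add 3 by (simp only: if_distrib[of "right_branch_at n i j"] 2 zero)
    qed
    show ?thesis
    proof (cases "{inv' x i, inv' x n} = {j, n}")
      case True
      have xi: "x (inv' x i) = i" "x (inv' x n) = n" using x by (simp_all add: permutes_inverses)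
      have wy: "w = y"
        unfolding w_def y_def transpose_comp_permutes[OF x]
        using True by (auto simp: doubleton_eq_iff transpose_commute)
      have "inv' x i = j \<and> inv' x n = n \<and> x j = i \<and> x n = n \<or>
          inv' x i = n \<and> inv' x n = j \<and> x n = i \<and> x j = n"
        using True xi by (auto simp: doubleton_eq_iff)
      then show ?thesis
        unfolding L R wy using i j by (elim disjE) (simp_all add: below_def)
    next
      case False
      have "{x j, x n} \<noteq> {i, n}"
      proof
        assume "{x j, x n} = {i, n}"
        then have "inv' x ` {x j, x n} = inv' x ` {i, n}" by simp
        with False show False using x by (auto simp: permutes_inverses)
      qed
      then have "below n i (x j) (x n) \<longleftrightarrow> below n (Suc i) (x j) (x n)"
        by (intro below_shift) (use i ne in auto)
      moreover have "below n j (inv' x i) (inv' x n) \<longleftrightarrow> below n (Suc j) (inv' x i) (inv' x n)"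
        by (rule below_shift) (use j ne False in auto)
      ultimately show ?thesis unfolding L R by (auto simp: ac_simps)
    qed
  qed
qed (unfold left_branch_at_def right_branch_at_def, (intro additive_comp_intros)+)

lemma grid_row:
  assumes step: "\<And>j M. 1 \<le> j \<Longrightarrow> j < n \<Longrightarrow> A j (B j M) = B' j (A (Suc j) M)"
    and k: "1 \<le> k" "k \<le> n"
  shows "A k (fold B (rev [k..<n]) M) = fold B' (rev [k..<n]) (A n M)"
  using k(2,1)
proof (induction rule: inc_induct)
  case (step k)
  have "rev [k..<n] = rev [Suc k..<n] @ [k]" using step by (simp add: upt_conv_Cons)
  then show ?case using step assms(1)[of k] by simp
qed simp

text \<open>
  The squares of \<open>left_branch_at_right_branch_at\<close> fill a grid with \<open>n - 1\<close> rows and columns; its four sides are the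
  two products for the order with \<open>n\<close> on top and the two for the order with \<open>n\<close> at the bottom.
\<close>

lemma grid_commute:
  assumes step: "\<And>i j M. 1 \<le> i \<Longrightarrow> i < n \<Longrightarrow> 1 \<le> j \<Longrightarrow> j < n \<Longrightarrow>
      A j i (B (Suc i) j M) = B i j (A (Suc j) i M)"
    and n: "1 \<le> n" and k: "1 \<le> k" "k \<le> n"
  shows "fold (A 1) (rev [k..<n]) (fold (B n) (rev [1..<n]) M) =
    fold (B k) (rev [1..<n]) (fold (A n) (rev [k..<n]) M)"
  using k(2,1)
proof (induction arbitrary: M rule: inc_induct)
  case (step k)
  have k: "rev [k..<n] = rev [Suc k..<n] @ [k]" using step by (simp add: upt_conv_Cons)
  have row: "A 1 k (fold (B (Suc k)) (rev [1..<n]) N) = fold (B k) (rev [1..<n]) (A n k N)" for N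
    by (rule grid_row[of n "\<lambda>j. A j k"]) (use assms(1)[of k] step n in auto)
  show ?case using step row by (simp add: k)
qed simp

text \<open>
  The two orders differ only in their treatment of position \<open>n\<close>. If it is the least position, a swap can
  bring the value \<open>n\<close> there, from where it is never moved again; if it is the greatest, a swap can take
  the value \<open>n\<close> away from it. Neither happens between elements whose last entry is \<open>c \<noteq> n\<close>, and with \<open>n\<close> the
  least position no such element is reached from outside this level.
\<close>

lemma filter_last_left_branch_at:
  assumes i: "i \<in> {1..<n}" and c: "c \<noteq> n"
  shows "filter_mset (\<lambda>(d, x). x n = c) (left_branch_at n 1 i M) =
    left_branch_at n n i (filter_mset (\<lambda>(d, x). x n = c) M)"
proof (rule additive_eqI[of "\<lambda>M. filter_mset (\<lambda>(d, x). x n = c) (left_branch_at n 1 i M)"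
      "\<lambda>M. left_branch_at n n i (filter_mset (\<lambda>(d, x). x n = c) M)"])
  fix z :: "nat \<times> (nat \<Rightarrow> nat)"
  obtain d x where z: "z = (d, x)" by (cases z)
  show "filter_mset (\<lambda>(d, x). x n = c) (left_branch_at n 1 i {#z#}) =
      left_branch_at n n i (filter_mset (\<lambda>(d, x). x n = c) {#z#})"
  proof (cases "x permutes {1..n}")
    case False
    then show ?thesis by (simp add: z left_branch_at_def branch_simps)
  next
    case x: True
    have inv_eq: "inv' x p = n \<longleftrightarrow> x n = p" for p using x by (metis permutes_inverses)
    have in_n: "inv' x p \<in> {1..n}" if "p \<in> {1..n}" for p
      unfolding permutes_in_image[OF permutes_inv[OF x]] by (rule that)
    have le: "1 \<le> inv' x i" "inv' x n \<le> n"
      using in_n[of i] in_n[of n] i by auto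
    \<comment> \<open>The swapped element is kept on the left iff it is produced at all on the right.\<close>
    have step: "below n 1 (inv' x i) (inv' x n) \<and> trp i n (x n) = c \<longleftrightarrow>
        x n = c \<and> below n n (inv' x i) (inv' x n)"
    proof (cases "x n = c")
      case True
      then have n: "inv' x n \<noteq> n" using c by (simp add: inv_eq)
      show ?thesis
      proof (cases "c = i")
        case True
        with \<open>x n = c\<close> have "inv' x i = n" by (simp add: inv_eq)
        with True \<open>x n = c\<close> n c le show ?thesis by (auto simp: below_def)
      next
        case False
        with \<open>x n = c\<close> have "inv' x i \<noteq> n" by (simp add: inv_eq)
        with False \<open>x n = c\<close> n c show ?thesis by (auto simp: below_def)
      qed
    next
      case False
      have "\<not> below n 1 (inv' x i) (inv' x n)" if "trp i n (x n) = c"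
      proof -
        have "x n = n" using that False c by (auto simp: Transposition.transpose_def split: if_splits)
        then have "inv' x n = n" "inv' x i \<noteq> n" using i by (auto simp: inv_eq)
        with le show ?thesis by (simp add: below_def)
      qed
      with False show ?thesis by blast
    qed
    then show ?thesis
      using x by (auto simp: z left_branch_at_def branch_simps)
  qed
qed (unfold left_branch_at_def, (intro additive_comp_intros)+)

text \<open>
  The mirror image, under inversion, of the previous lemma.
\<close>

lemma filter_value_right_branch_at:
  assumes j: "j \<in> {1..<n}" and k: "k \<noteq> n"
  shows "filter_mset (\<lambda>(d, x). inv' x n = k) (right_branch_at n 1 j M) =
    right_branch_at n n j (filter_mset (\<lambda>(d, x). inv' x n = k) M)"
proof (rule additive_eqI[of "\<lambda>M. filter_mset (\<lambda>(d, x). inv' x n = k) (right_branch_at n 1 j M)"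
      "\<lambda>M. right_branch_at n n j (filter_mset (\<lambda>(d, x). inv' x n = k) M)"])
  fix z :: "nat \<times> (nat \<Rightarrow> nat)"
  obtain d x where z: "z = (d, x)" by (cases z)
  show "filter_mset (\<lambda>(d, x). inv' x n = k) (right_branch_at n 1 j {#z#}) =
      right_branch_at n n j (filter_mset (\<lambda>(d, x). inv' x n = k) {#z#})"
  proof (cases "x permutes {1..n}")
    case False
    then show ?thesis by (simp add: z right_branch_at_def branch_simps)
  next
    case x: True
    have x_eq: "x p = n \<longleftrightarrow> inv' x n = p" for p using x by (metis permutes_inverses)
    have "x p \<in> {1..n}" if "p \<in> {1..n}" for p
      unfolding permutes_in_image[OF x] by (rule that)
    from this[of j] this[of n] j have le: "1 \<le> x j" "x n \<le> n" by auto
    have inv_y: "inv' (x \<circ> trp j n) n = trp j n (inv' x n)"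
      using o_inv_distrib[OF permutes_bij[OF x] bij_transpose, of j n] by simp
    \<comment> \<open>The swapped element is kept on the left iff it is produced at all on the right.\<close>
    have step: "below n 1 (x j) (x n) \<and> trp j n (inv' x n) = k \<longleftrightarrow>
        inv' x n = k \<and> below n n (x j) (x n)"
    proof (cases "inv' x n = k")
      case True
      then have n: "x n \<noteq> n" using k by (simp add: x_eq)
      show ?thesis
      proof (cases "k = j")
        case True
        with \<open>inv' x n = k\<close> have "x j = n" by (simp add: x_eq)
        with True \<open>inv' x n = k\<close> n k le show ?thesis by (auto simp: below_def)
      next
        case False
        with \<open>inv' x n = k\<close> have "x j \<noteq> n" by (simp add: x_eq)
        with False \<open>inv' x n = k\<close> n k show ?thesis by (auto simp: below_def)
      qed
    next
      case False
      have "\<not> below n 1 (x j) (x n)" if "trp j n (inv' x n) = k"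
      proof -
        have "inv' x n = n" using that False k by (auto simp: Transposition.transpose_def split: if_splits)
        then have "x n = n" "x j \<noteq> n" using j by (auto simp: x_eq)
        with le show ?thesis by (simp add: below_def)
      qed
      with False show ?thesis by blast
    qed
    then show ?thesis
      using x inv_y by (auto simp: z right_branch_at_def branch_simps)
  qed
qed (unfold right_branch_at_def, (intro additive_comp_intros)+)

lemma entry_mset_start_level:
  assumes u: "u permutes {1..n}" and fu: "f u = f v"
  shows "filter_mset (\<lambda>(d, p). f p = f v) (entry_mset n f (d, u)) = {#(d, u)#}"
proof -
  have d0: "bruhat_dist n u u = 0" by (rule bruhat_dist_eqI[OF u]) auto
  have "{p \<in> entry_points n f u. f p = f v} = {u}"
  proof (intro subset_antisym subsetI)
    fix p assume "p \<in> {p \<in> entry_points n f u. f p = f v}"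
    then have p: "p \<in> entry_points n f u" "f u = f p" and le: "bruhat_le n u p"
      using fu by (auto simp: entry_points_def)
    from entry_pointsD[OF p(1), of 0 u, OF _ relpowp_bruhat_dist[OF le]] p(2)
    show "p \<in> {u}" by simp
  next
    fix p assume "p \<in> {u}"
    have "x = u" if "(bruhat_edge n ^^ j) x u" "i + j = bruhat_dist n u u" for x i j
      using that by (simp add: d0)
    then have "u \<in> entry_points n f u"
      unfolding entry_points_def using bruhat_le_refl[OF u] by blast
    with fu \<open>p \<in> {u}\<close> show "p \<in> {p \<in> entry_points n f u. f p = f v}" by simp
  qed
  moreover have "filter_mset (\<lambda>p. f p = f v) (mset_set (entry_points n f u)) =
      mset_set {p \<in> entry_points n f u. f p = f v}"
    by (simp add: filter_mset_mset_set finite_entry_points)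
  ultimately show ?thesis
    by (simp add: entry_mset_def filter_mset_image_mset o_def d0)
qed

text \<open>
  If \<open>v n = n\<close>, then \<open>u\<close> already lies in both levels and is the only shortcut into either. Otherwise, moving the
  filter for the intermediate level to the outside turns the second product into the one with \<open>n\<close> at the
  bottom, and \<open>grid_commute\<close> applies.
\<close>

lemma double_entry_mset_last_value_commute:
  assumes n: "n \<ge> 1" and uv: "bruhat_le n u v"
  shows "double_entry_mset n (\<lambda>x. x n) (\<lambda>x. inv' x n) u v = double_entry_mset n (\<lambda>x. inv' x n) (\<lambda>x. x n) u v"
proof -
  note W = bruhat_le_permutes[OF uv]
  note u = W(1) and v = W(2)
  have inv_eq: "inv' x n = n \<longleftrightarrow> x n = n" if "x permutes {1..n}" for x
    using that by (metis permutes_inverses)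
  let ?U = "{#(0, u)#} :: (nat \<times> (nat \<Rightarrow> nat)) multiset"
  let ?F = "filter_mset (\<lambda>(d :: nat, x). x n = v n)"
  let ?G = "filter_mset (\<lambda>(d :: nat, x). inv' x n = inv' v n)"
  let ?Q = "filter_mset (\<lambda>(d :: nat, b). bruhat_le n b v \<and> b n = v n \<and> inv' b n = inv' v n)"
  let ?Q' = "filter_mset (\<lambda>(d :: nat, b). bruhat_le n b v \<and> inv' b n = inv' v n \<and> b n = v n)"
  have QQ: "?Q M = ?Q' M" for M by (rule filter_mset_cong) auto
  show ?thesis
  proof (cases "v n = n")
    case True
    have "u n \<in> {1..n}" unfolding permutes_in_image[OF u] using n by simp
    then have un: "u n = v n" using bruhat_le_last_le[OF uv] True by simp
    then have in': "inv' u n = inv' v n" using inv_eq[OF u] inv_eq[OF v] True by simp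
    have F: "?F (entry_mset n (\<lambda>x. x n) (0, u)) = ?U"
      by (rule entry_mset_start_level[OF u]) (rule un)
    have G: "?G (entry_mset n (\<lambda>x. inv' x n) (0, u)) = ?U"
      by (rule entry_mset_start_level[OF u]) (rule in')
    have "double_entry_mset n (\<lambda>x. x n) (\<lambda>x. inv' x n) u v = ?Q (entry_mset n (\<lambda>x. inv' x n) (0, u))"
      unfolding double_entry_mset_def F by simp
    also have "\<dots> = ?Q (?G (entry_mset n (\<lambda>x. inv' x n) (0, u)))"
      by (rule filter_mset_absorb[symmetric]) auto
    also have "\<dots> = ?Q (?F (entry_mset n (\<lambda>x. x n) (0, u)))"
      unfolding F G ..
    also have "\<dots> = ?Q (entry_mset n (\<lambda>x. x n) (0, u))"
      by (rule filter_mset_absorb) auto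
    also have "\<dots> = double_entry_mset n (\<lambda>x. inv' x n) (\<lambda>x. x n) u v"
      unfolding double_entry_mset_def G by (simp add: QQ)
    finally show ?thesis .
  next
    case False
    then have c: "v n \<noteq> n" "inv' v n \<noteq> n" using inv_eq[OF v] by simp_all
    let ?js = "rev [1..<n]"
    have sU: "supported n ?U" using u by (simp add: supported_def)
    have A: "fold (\<lambda>j. left_branch n j n) ?js M = fold (left_branch_at n n) ?js M" for M
      by (rule fold_cong) (auto simp: left_branch_at_top)
    have B: "fold (\<lambda>j. right_branch n j n) ?js M = fold (right_branch_at n n) ?js M" for M
      by (rule fold_cong) (auto simp: right_branch_at_top)
    have supl: "supported n (left_branch n j n M)" if "j \<in> set ?js" for j M
      unfolding left_branch_def
      by (rule supported_branch, rule permutes_compose, assumption, rule permutes_swap_id)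
        (use that in auto)
    have Na: "mbind (entry_mset n (\<lambda>x. inv' x n)) M = fold (left_branch_at n n) ?js M" if "supported n M" for M
      unfolding A[symmetric]
      by (rule mbind_entry_mset_fold[OF _ _ that])
         (use n in \<open>auto simp: left_branch_def entry_mset_value_fold[unfolded left_branch_def] additive_branch\<close>)
    have Nb: "mbind (entry_mset n (\<lambda>x. x n)) M = fold (right_branch_at n n) ?js M" if "supported n M" for M
      unfolding B[symmetric]
      by (rule mbind_entry_mset_fold[OF _ additive_right_branch that]) (rule entry_mset_last_fold[OF _ n])
    have sl: "supported n (fold (left_branch_at n n) ?js ?U)"
      unfolding A[symmetric] by (rule supported_fold[OF sU supl])
    have sr: "supported n (fold (right_branch_at n n) ?js ?U)"
      unfolding B[symmetric] by (rule supported_fold[OF sU]) (auto intro!: supported_right_branch)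
    have FA: "?F (fold (left_branch_at n 1) ?js M) = fold (left_branch_at n n) ?js (?F M)" for M
      by (rule filter_fold_commute, rule filter_last_left_branch_at) (use c in auto)
    have GB: "?G (fold (right_branch_at n 1) ?js M) = fold (right_branch_at n n) ?js (?G M)" for M
      by (rule filter_fold_commute, rule filter_value_right_branch_at) (use c in auto)
    have entry: "entry_mset n f (0, u) = mbind (entry_mset n f) ?U" for f :: "(nat \<Rightarrow> nat) \<Rightarrow> nat"
      by simp
    have "double_entry_mset n (\<lambda>x. x n) (\<lambda>x. inv' x n) u v =
        ?Q (fold (left_branch_at n n) ?js (?F (fold (right_branch_at n n) ?js ?U)))"
      unfolding double_entry_mset_def entry Nb[OF sU] Na[OF supported_filter[OF sr]] ..
    also have "\<dots> = ?Q (fold (left_branch_at n 1) ?js (fold (right_branch_at n n) ?js ?U))"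
      unfolding FA[symmetric] by (rule filter_mset_absorb) auto
    also have "fold (left_branch_at n 1) ?js (fold (right_branch_at n n) ?js ?U) =
        fold (right_branch_at n 1) ?js (fold (left_branch_at n n) ?js ?U)"
      by (rule grid_commute[of n "left_branch_at n" "right_branch_at n"]) (use n left_branch_at_right_branch_at in auto)
    also have "?Q (fold (right_branch_at n 1) ?js (fold (left_branch_at n n) ?js ?U)) =
        ?Q (?G (fold (right_branch_at n 1) ?js (fold (left_branch_at n n) ?js ?U)))"
      by (rule filter_mset_absorb[symmetric]) auto
    also have "\<dots> = double_entry_mset n (\<lambda>x. inv' x n) (\<lambda>x. x n) u v"
      unfolding double_entry_mset_def entry Na[OF sU] Nb[OF supported_filter[OF sl]] GB QQ ..
    finally show ?thesis .
  qed
qed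


theorem theorem3p2:
  fixes n :: nat and u v :: "nat \<Rightarrow> nat"
  assumes "n \<ge> 2"
    and "u \<in> carrier (sym_group n)" and "v \<in> carrier (sym_group n)"
    and "bruhat_le n u v"
  shows
    "let z_n = lower_std n (n - 1) u v;
         z_1 = lower_std n 1 u v;
         z'n = upper_std n (n - 1) u v;
         z'1 = upper_std n 1 u v;
         DS = double_shortcuts n u v
     in DS z_n z_1 = DS z_1 z_n \<and>
        DS z'n z'1 = DS z'1 z'n \<and>
        DS z_n z'n = DS z'n z_n \<and>
        DS z'1 z_1 = DS z_1 z'1"
proof -
  note n = assms(1) and uv = assms(4)
  note W = bruhat_le_permutes[OF uv]
  have n1: "1 \<le> n" using n by simp
  note sinv = bruhat_symmetry_inv[of n] and srot = bruhat_symmetry_rot180[of n]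
  define stat where "stat = (\<lambda>x :: nat \<Rightarrow> nat. x n)"
  have h: "hypercube_statistic n stat"
    unfolding stat_def by (rule hypercube_statistic_last[OF n1])
  have hi: "hypercube_statistic n (\<lambda>x. stat (inv' x))"
    by (rule hypercube_statistic_symmetry[OF sinv h])
  have hr: "hypercube_statistic n (\<lambda>x. stat (rot180 n x))"
    by (rule hypercube_statistic_symmetry[OF srot h])
  have hri: "hypercube_statistic n (\<lambda>x. stat (rot180 n (inv' x)))"
    by (rule hypercube_statistic_symmetry[OF sinv hr])
  have hir: "hypercube_statistic n (\<lambda>x. stat (inv' (rot180 n x)))"
    by (rule hypercube_statistic_symmetry[OF srot hi])
  \<comment> \<open>On permutations \<open>rot180\<close> commutes with inversion. Both ways of writing the fourth statistic occur, one for each symmetry used.\<close>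
  have lev: "level n (\<lambda>x. stat (rot180 n (inv' x))) u v = level n (\<lambda>x. stat (inv' (rot180 n x))) u v"
  proof -
    have "inv' (rot180 n x) = rot180 n (inv' x)" if "bruhat_le n x v" for x
      by (rule inv_rot180[OF bruhat_le_permutes(1)[OF that]])
    then show ?thesis
      using inv_rot180[OF W(2)] by (auto simp: level_def bruhat_interval_def)
  qed
  have std: "upper_std n (n - 1) u v = bruhat_min n (level n stat u v)"
    "upper_std n 1 u v = bruhat_min n (level n (\<lambda>x. stat (rot180 n x)) u v)"
    "lower_std n (n - 1) u v = bruhat_min n (level n (\<lambda>x. stat (inv' x)) u v)"
    "lower_std n 1 u v = bruhat_min n (level n (\<lambda>x. stat (rot180 n (inv' x))) u v)"
    unfolding stat_def by (rule std_eq_min_level[OF n uv])+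
  note ds = double_shortcuts_eq_double_entry_mset[OF _ _ uv]
  have e1: "double_entry_mset n stat (\<lambda>x. stat (rot180 n x)) a b = double_entry_mset n (\<lambda>x. stat (rot180 n x)) stat a b"
    if "a permutes {1..n}" "b permutes {1..n}" for a b
    using double_entry_mset_first_last_commute[OF n that] by (simp add: stat_def)
  have e2: "double_entry_mset n stat (\<lambda>x. stat (inv' x)) a b = double_entry_mset n (\<lambda>x. stat (inv' x)) stat a b"
    if "bruhat_le n a b" for a b
    using double_entry_mset_last_value_commute[OF n1 that] by (simp add: stat_def)
  have "double_shortcuts n u v (lower_std n (n - 1) u v) (lower_std n 1 u v) =
      double_shortcuts n u v (lower_std n 1 u v) (lower_std n (n - 1) u v)"
    unfolding std ds[OF hi hri] ds[OF hri hi]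
    using double_entry_mset_symmetry[OF sinv W, of stat "\<lambda>x. stat (rot180 n x)"]
      double_entry_mset_symmetry[OF sinv W, of "\<lambda>x. stat (rot180 n x)" stat]
      e1[OF permutes_inv[OF W(1)] permutes_inv[OF W(2)]] by (simp only:)
  moreover have "double_shortcuts n u v (upper_std n (n - 1) u v) (upper_std n 1 u v) =
      double_shortcuts n u v (upper_std n 1 u v) (upper_std n (n - 1) u v)"
    unfolding std ds[OF h hr] ds[OF hr h] by (rule e1[OF W])
  moreover have "double_shortcuts n u v (lower_std n (n - 1) u v) (upper_std n (n - 1) u v) =
      double_shortcuts n u v (upper_std n (n - 1) u v) (lower_std n (n - 1) u v)"
    unfolding std ds[OF h hi] ds[OF hi h] by (rule e2[OF uv, symmetric])
  moreover have "double_shortcuts n u v (upper_std n 1 u v) (lower_std n 1 u v) =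
      double_shortcuts n u v (lower_std n 1 u v) (upper_std n 1 u v)"
    unfolding std lev ds[OF hr hir] ds[OF hir hr]
    using double_entry_mset_symmetry[OF srot W, of stat "\<lambda>x. stat (inv' x)"]
      double_entry_mset_symmetry[OF srot W, of "\<lambda>x. stat (inv' x)" stat]
      e2[OF bruhat_le_symmetry[OF srot uv]] by (simp only:)
  ultimately show ?thesis unfolding Let_def by blast
qed

end
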